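(* Let $Z>0$ and let $N\ge1$ be an integer. If $N\ge 4Z+1$, then the many-body Schrödinger Hamiltonian $$H(N,Z)=\sum_{j=1}^N\left(-\Delta_{x_j}-\frac{Z}{|x_j|}\right)+\frac12\sum_{1\le k\ne\ell\le N}\frac{1}{|x_k-x_\ell|}$$ on $L^2((\mathbb{R}^3)^N)$ has no eigenvalue.
   Context: $H(N,Z)$ is a self-adjoint operator on the whole space $L^2((\mathbb{R}^3)^N)$ (no particle symmetry imposed) with domain $H^2((\mathbb{R}^3)^N)$. Points of $(\mathbb{R}^3)^N$ are written $(x_1,\dots,x_N)$ with $x_j\in\mathbb{R}^3$. "No eigenvalue" means no real number whatsoever (including numbers embedded in the essential spectrum) is an eigenvalue. *)

theory Defs
  imports "HOL-Analysis.Analysis"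
begin

primrec C_diff :: "nat \<Rightarrow> ('a::euclidean_space \<Rightarrow> 'b::real_normed_vector) \<Rightarrow> bool" where
  "C_diff 0 f \<longleftrightarrow> continuous_on UNIV f"
| "C_diff (Suc k) f \<longleftrightarrow>
     f differentiable_on UNIV \<and> (\<forall>b\<in>Basis. C_diff k (\<lambda>x. frechet_derivative f (at x) b))"

definition test_function :: "('a::euclidean_space \<Rightarrow> real) \<Rightarrow> bool" where
  "test_function \<phi> \<longleftrightarrow> (\<forall>k. C_diff k \<phi>) \<and> compact (closure {x. \<phi> x \<noteq> 0})"

text \<open>Elements of \<open>L\<^sup>2\<close> are represented by Borel functions; equality in \<open>L\<^sup>2\<close> is equality almost everywhere.\<close>

definition L2 :: "('a::euclidean_space \<Rightarrow> complex) set" where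
  "L2 = {f \<in> borel_measurable lborel. integrable lborel (\<lambda>x. (norm (f x))\<^sup>2)}"

definition has_weak_partial ::
    "'a::euclidean_space \<Rightarrow> ('a \<Rightarrow> complex) \<Rightarrow> ('a \<Rightarrow> complex) \<Rightarrow> bool" where
  "has_weak_partial b f g \<longleftrightarrow>
     (\<forall>\<phi>. test_function \<phi> \<longrightarrow>
        (LINT x|lborel. frechet_derivative \<phi> (at x) b *\<^sub>R f x) = - (LINT x|lborel. \<phi> x *\<^sub>R g x))"

text \<open>A weak derivative in \<open>L\<^sup>2\<close> is unique almost everywhere when it exists, so the representative
  selected here (a junk value if none exists) does not matter.\<close>

definition weak_partial :: "'a::euclidean_space \<Rightarrow> ('a \<Rightarrow> complex) \<Rightarrow> 'a \<Rightarrow> complex" where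
  "weak_partial b f = (SOME g. g \<in> L2 \<and> has_weak_partial b f g)"

definition H2 :: "('a::euclidean_space \<Rightarrow> complex) set" where
  "H2 = {f \<in> L2. \<forall>b\<in>Basis. \<exists>g\<in>L2. has_weak_partial b f g \<and>
           (\<forall>c\<in>Basis. \<exists>h\<in>L2. has_weak_partial c g h)}"

text \<open>The configuration space of \<open>N\<close> particles is \<open>(real^3)^'n\<close> with \<open>N = CARD('n)\<close>. The vectors
  \<open>axis j b\<close>, for \<open>b\<close> in the standard basis of \<open>real^3\<close>, are the coordinate directions of
  particle \<open>j\<close>.\<close>

definition particle_laplacian ::
    "'n::finite \<Rightarrow> ((real^3)^'n \<Rightarrow> complex) \<Rightarrow> (real^3)^'n \<Rightarrow> complex" where
  "particle_laplacian j \<psi> x =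
     (\<Sum>b\<in>Basis. weak_partial (axis j b) (weak_partial (axis j b) \<psi>) x)"

text \<open>Division by zero gives zero at the Coulomb singularities, which form a null set.\<close>

definition hamiltonian ::
    "real \<Rightarrow> ((real^3)^'n::finite \<Rightarrow> complex) \<Rightarrow> (real^3)^'n \<Rightarrow> complex" where
  "hamiltonian Z \<psi> x =
     (\<Sum>j\<in>UNIV. - particle_laplacian j \<psi> x - (Z / norm (x $ j)) *\<^sub>R \<psi> x)
     + (1/2) *\<^sub>R (\<Sum>(k, l)\<in>{(k, l). k \<noteq> l}. (1 / norm (x $ k - x $ l)) *\<^sub>R \<psi> x)"

definition is_eigenvalue ::
    "('a::euclidean_space \<Rightarrow> complex) set \<Rightarrow> (('a \<Rightarrow> complex) \<Rightarrow> 'a \<Rightarrow> complex) \<Rightarrow> complex \<Rightarrow> bool" where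
  "is_eigenvalue D T \<mu> \<longleftrightarrow>
     (\<exists>\<psi>\<in>D. \<not> (AE x in lborel. \<psi> x = 0) \<and> (AE x in lborel. T \<psi> x = \<mu> * \<psi> x))"

end

theory Submission
  imports Defs "HOL-Computational_Algebra.Polynomial"
begin

text \<open>Since the Hamiltonian is real, one may take a real eigenfunction \<open>f\<close>. Testing the eigenvalue equation against
  \<open>\<Sum>\<^sub>j (2 X\<^sub>j \<bullet> \<nabla>\<^sub>j f + (div X\<^sub>j) f)\<close> gives a virial identity. For the Morawetz-type field
  \<open>X\<^sub>j = |x\<^sub>j| x\<^sub>j\<close> the kinetic contribution is nonnegative, by a weighted Hardy inequality with sharp constant; each
  nucleus--electron term contributes \<open>- Z \<parallel>f\<parallel>\<^sup>2\<close>; and each electron pair contributes the integral of \<open>f\<^sup>2\<close> times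
  \<open>(|x| x - |y| y) \<bullet> (x - y) / |x - y|\<^sup>3\<close>, which exceeds \<open>1/2\<close> almost everywhere. Hence
  \<open>N (N - 1) / 4 < Z N\<close> unless \<open>f = 0\<close>.

  Since \<open>f\<close> is not known to decay, \<open>X\<^sub>j\<close> is replaced by a bounded smooth field depending on \<open>\<epsilon>\<close>; the kinetic term is then
  bounded below by a quantity of order \<open>- \<epsilon>\<close>, and monotonicity of the field keeps the pair terms nonnegative, so that
  Fatou's lemma applies as \<open>\<epsilon>\<close> tends to \<open>0\<close>. All integrations by parts reduce to a product rule for weak derivatives with
  bounded weights, which follows from density of test functions and continuity of translations in \<open>L\<^sup>2\<close>.\<close>


subsection \<open>Smooth functions\<close>

text \<open>The field \<open>|x| x\<close> is dictated by the nucleus: a radial field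
  \<open>X\<close> turns \<open>1 / |x|\<close> into \<open>X \<bullet> x / |x|^3\<close> up to
  sign, and this is constant only if \<open>X\<close> is a multiple of \<open>|x| x\<close>. The
  multiplier is antisymmetric, so its pairing with \<open>E f\<close> vanishes whatever
  \<open>E\<close> is; this is why embedded eigenvalues need no separate argument. The pair bound
  \<open>1/2\<close> is attained exactly at \<open>y = - x\<close>, a null set, and the resulting
  strictness settles the borderline \<open>N = 4 Z + 1\<close>. Two regularisations are kept apart.
  The parameter \<open>\<epsilon>\<close> smooths the field at the origin and bounds it at infinity.
  A second parameter \<open>\<eta>\<close> softens the Coulomb factor, since weights in the
  integration by parts must be bounded with bounded derivative. At fixed \<open>\<epsilon>\<close>,
  \<open>\<eta>\<close> is removed first, Hardy's inequality providing the domination; only then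
  does \<open>\<epsilon>\<close> tend to 0.\<close>

definition smooth :: "('a::euclidean_space \<Rightarrow> real) \<Rightarrow> bool" where
  "smooth f \<longleftrightarrow> (\<forall>k. C_diff k f)"

lemma smooth_continuous: "smooth f \<Longrightarrow> continuous_on UNIV f"
  unfolding smooth_def by (metis C_diff.simps(1))

lemma smooth_has_derivative:
  "smooth f \<Longrightarrow> (f has_derivative frechet_derivative f (at x)) (at x)"
  unfolding smooth_def
  by (metis C_diff.simps(2) UNIV_I differentiable_on_def frechet_derivative_works)

lemma smooth_partial:
  "smooth f \<Longrightarrow> b \<in> Basis \<Longrightarrow> smooth (\<lambda>x. frechet_derivative f (at x) b)"
  unfolding smooth_def using C_diff.simps(2) by blast

text \<open>\<open>C_diff\<close> refers to the chosen \<open>frechet_derivative\<close>; uniqueness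
  of derivatives lets an explicit candidate take its place in the inductions on the order
  below.\<close>

lemma C_diff_SucI:
  assumes "\<And>x. (f has_derivative f' x) (at x)" "\<And>b. b \<in> Basis \<Longrightarrow> C_diff k (\<lambda>x. f' x b)"
  shows "C_diff (Suc k) f"
proof -
  have "frechet_derivative f (at x) = f' x" for x
    using frechet_derivative_at[OF assms(1)] by simp
  then show ?thesis
    using assms by (auto simp: differentiable_on_def differentiable_def intro!: exI)
qed

lemma C_diff_Suc_has_derivative:
  "C_diff (Suc k) f \<Longrightarrow> (f has_derivative frechet_derivative f (at x)) (at x)"
  by (metis C_diff.simps(2) UNIV_I differentiable_on_def frechet_derivative_works)

lemma C_diff_mono: "C_diff (Suc k) f \<Longrightarrow> C_diff k f"
  by (induction k arbitrary: f) (auto simp: differentiable_imp_continuous_on)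

lemma C_diff_const: "C_diff k (\<lambda>x. c)"
proof (induction k arbitrary: c)
  case (Suc k)
  show ?case
    by (rule C_diff_SucI[where f'="\<lambda>x b. 0"]) (auto intro: Suc)
qed auto

lemma C_diff_add: "C_diff k f \<Longrightarrow> C_diff k g \<Longrightarrow> C_diff k (\<lambda>x. f x + g x)"
proof (induction k arbitrary: f g)
  case 0 then show ?case by (simp add: continuous_on_add)
next
  case (Suc k)
  show ?case
    by (rule C_diff_SucI[where f'="\<lambda>x b. frechet_derivative f (at x) b + frechet_derivative g (at x) b"])
       (intro has_derivative_add C_diff_Suc_has_derivative Suc.prems, use Suc in auto)
qed

lemma C_diff_mult:
  fixes f g :: "'a::euclidean_space \<Rightarrow> real"
  shows "C_diff k f \<Longrightarrow> C_diff k g \<Longrightarrow> C_diff k (\<lambda>x. f x * g x)"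
proof (induction k arbitrary: f g)
  case 0 then show ?case by (simp add: continuous_on_mult)
next
  case (Suc k)
  show ?case
  proof (rule C_diff_SucI)
    show "((\<lambda>x. f x * g x) has_derivative
            (\<lambda>b. f x * frechet_derivative g (at x) b + frechet_derivative f (at x) b * g x)) (at x)" for x
      using Suc.prems by (intro has_derivative_mult C_diff_Suc_has_derivative)
    show "C_diff k (\<lambda>x. f x * frechet_derivative g (at x) b + frechet_derivative f (at x) b * g x)"
      if "b \<in> Basis" for b
      using Suc.prems that C_diff_mono[OF Suc.prems(1)] C_diff_mono[OF Suc.prems(2)]
      by (auto intro!: C_diff_add Suc.IH)
  qed
qed

lemma smooth_const: "smooth (\<lambda>x. c)"
  by (simp add: smooth_def C_diff_const)

lemma smooth_add: "smooth f \<Longrightarrow> smooth g \<Longrightarrow> smooth (\<lambda>x. f x + g x)"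
  by (auto simp: smooth_def C_diff_add)

lemma smooth_mult: "smooth f \<Longrightarrow> smooth g \<Longrightarrow> smooth (\<lambda>x. f x * g x)"
  by (auto simp: smooth_def C_diff_mult)

lemma smooth_prod: "(\<And>i. i \<in> I \<Longrightarrow> smooth (f i)) \<Longrightarrow> smooth (\<lambda>x. \<Prod>i\<in>I. f i x)"
  by (induction I rule: infinite_finite_induct) (auto intro: smooth_const smooth_mult)

lemma smooth_linear:
  assumes "bounded_linear f" shows "smooth f"
  unfolding smooth_def
proof
  fix k show "C_diff k f"
  proof (cases k)
    case (Suc k)
    show ?thesis unfolding Suc
      by (rule C_diff_SucI[where f'="\<lambda>x. f"])
         (auto intro: C_diff_const bounded_linear_imp_has_derivative assms)
  qed (simp add: assms linear_continuous_on)
qed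

lemma C_diff_translate: "C_diff k f \<Longrightarrow> C_diff k (\<lambda>x. f (x + a))"
proof (induction k arbitrary: f)
  case 0 then show ?case
    by simp (rule continuous_on_compose2[of UNIV f], auto intro: continuous_intros)
next
  case (Suc k)
  show ?case
  proof (rule C_diff_SucI)
    show "((\<lambda>x. f (x + a)) has_derivative (\<lambda>b. frechet_derivative f (at (x + a)) b)) (at x)" for x
      by (rule has_derivative_compose[of "\<lambda>x. x + a" "\<lambda>h. h", simplified])
         (auto intro!: derivative_eq_intros C_diff_Suc_has_derivative[OF Suc.prems])
    show "C_diff k (\<lambda>x. frechet_derivative f (at (x + a)) b)" if "b \<in> Basis" for b
      using Suc.IH[of "\<lambda>x. frechet_derivative f (at x) b"] Suc.prems that by auto
  qed
qed

lemma smooth_translate: "smooth f \<Longrightarrow> smooth (\<lambda>x. f (x + a))"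
  by (auto simp: smooth_def C_diff_translate)

section \<open>Flat functions and a bump function\<close>

definition flat_exp :: "real poly \<Rightarrow> real \<Rightarrow> real" where
  "flat_exp p t = (if t > 0 then poly p (1/t) * exp (- 1/t) else 0)"

lemma poly_exp_tendsto_0: "((\<lambda>z. poly p z * exp (- z)) \<longlongrightarrow> (0::real)) at_top"
proof -
  have "((\<lambda>z. \<Sum>i\<le>degree p. coeff p i * (z ^ i / exp z)) \<longlongrightarrow> (\<Sum>i\<le>degree p. coeff p i * 0)) at_top"
    by (intro tendsto_sum tendsto_mult_left tendsto_power_div_exp_0)
  then show ?thesis
    by (simp add: poly_altdef exp_minus sum_distrib_right divide_inverse mult.assoc)
qed

lemma flat_exp_tendsto_0: "(flat_exp p \<longlongrightarrow> 0) (at 0)"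
proof -
  have "((\<lambda>t. poly p (inverse t) * exp (- inverse t)) \<longlongrightarrow> 0) (at_right 0)"
    using filterlim_compose[OF poly_exp_tendsto_0 filterlim_inverse_at_top_right] .
  then have "(flat_exp p \<longlongrightarrow> 0) (at_right 0)"
    by (rule Lim_transform_eventually)
       (auto simp: flat_exp_def eventually_at_filter inverse_eq_divide)
  moreover have "(flat_exp p \<longlongrightarrow> 0) (at_left 0)"
    by (rule Lim_transform_eventually[of "\<lambda>_. 0"]) (auto simp: flat_exp_def eventually_at_filter)
  ultimately show ?thesis by (simp add: filterlim_split_at)
qed

text \<open>Differentiating \<open>p(1/t) exp(-1/t)\<close> gives \<open>z^2 (p - p')\<close> at
  \<open>z = 1/t\<close> times the same exponential. The polynomial parameter of
  \<open>flat_exp\<close> makes the family closed under differentiation, so that smoothness becomes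
  an induction on the order.\<close>

lemma flat_exp_has_derivative:
  "(flat_exp p has_real_derivative flat_exp ([:0,0,1:] * (p - pderiv p)) t) (at t)"
proof -
  consider "t > 0" | "t < 0" | "t = 0" by linarith
  then show ?thesis
  proof cases
    case 1
    have "((\<lambda>t. poly p (1/t) * exp (- 1/t)) has_real_derivative flat_exp ([:0,0,1:] * (p - pderiv p)) t) (at t)"
      using 1 by (auto intro!: derivative_eq_intros DERIV_chain'[OF _ poly_DERIV] simp: flat_exp_def field_simps power2_eq_square)
    then show ?thesis
      by (rule has_field_derivative_transform_within_open[of _ _ _ "{0<..}"]) (use 1 in \<open>auto simp: flat_exp_def\<close>)
  next
    case 2
    have "((\<lambda>t. 0) has_real_derivative flat_exp ([:0,0,1:] * (p - pderiv p)) t) (at t)"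
      using 2 by (auto simp: flat_exp_def)
    then show ?thesis
      by (rule has_field_derivative_transform_within_open[of _ _ _ "{..<0}"]) (use 2 in \<open>auto simp: flat_exp_def\<close>)
  next
    case 3
    \<comment> \<open>The difference quotient at 0 is again in the family, with polynomial
      \<open>z p(z)\<close>, so its limit is already known.\<close>
    have "(\<lambda>h. (flat_exp p (0 + h) - flat_exp p 0) / h) = flat_exp ([:0,1:] * p)"
      by (auto simp: flat_exp_def fun_eq_iff)
    then show ?thesis
      using flat_exp_tendsto_0[of "[:0,1:] * p"] 3 by (simp add: DERIV_def flat_exp_def)
  qed
qed

lemma smooth_flat_exp: "smooth (\<lambda>x. flat_exp p (x \<bullet> c + a))"
proof -
  have "C_diff k (\<lambda>x. flat_exp p (x \<bullet> c + a))" for k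
  proof (induction k arbitrary: p)
    case 0
    have "continuous_on UNIV (flat_exp p)"
      by (meson DERIV_isCont continuous_at_imp_continuous_on flat_exp_has_derivative)
    then show ?case
      by simp (rule continuous_on_compose2[of UNIV "flat_exp p"], auto intro!: continuous_intros)
  next
    case (Suc k)
    show ?case
    proof (rule C_diff_SucI)
      show "((\<lambda>x. flat_exp p (x \<bullet> c + a)) has_derivative
          (\<lambda>b. (b \<bullet> c) * flat_exp ([:0,0,1:] * (p - pderiv p)) (x \<bullet> c + a))) (at x)" for x
      proof -
        have "((\<lambda>x. x \<bullet> c + a) has_derivative (\<lambda>h. h \<bullet> c)) (at x)"
          by (auto intro!: derivative_eq_intros)
        from has_derivative_compose[OF this flat_exp_has_derivative[unfolded has_field_derivative_def]]
        show ?thesis by (simp only: mult.commute)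
      qed
    qed (intro C_diff_mult C_diff_const Suc)
  qed
  then show ?thesis by (simp add: smooth_def)
qed

lemma flat_exp_one_pos: "flat_exp 1 t > 0 \<longleftrightarrow> t > 0" and flat_exp_one_nonpos: "t \<le> 0 \<Longrightarrow> flat_exp 1 t = 0"
  by (auto simp: flat_exp_def)

text \<open>A product of one-dimensional bumps is positive on an open cube of half-side
  \<open>R\<close> and zero off it. The cube contains the ball of radius \<open>R\<close>; by the
  \<open>l1\<close> bound on the norm it lies in the larger ball.\<close>

lemma test_function_bump:
  fixes R :: real
  obtains \<beta> :: "'a::euclidean_space \<Rightarrow> real" where "smooth \<beta>" "\<And>x. norm x < R \<Longrightarrow> \<beta> x > 0"
    "\<And>x. x \<notin> cball 0 (R * DIM('a)) \<Longrightarrow> \<beta> x = 0"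
proof
  let ?\<beta> = "\<lambda>x::'a. \<Prod>b\<in>Basis. flat_exp 1 (x \<bullet> b + R) * flat_exp 1 (x \<bullet> (- b) + R)"
  show "smooth ?\<beta>" by (intro smooth_prod smooth_mult smooth_flat_exp)
  show "?\<beta> x > 0" if "norm x < R" for x
  proof (intro prod_pos ballI mult_pos_pos)
    fix b :: 'a assume "b \<in> Basis"
    then have "\<bar>x \<bullet> b\<bar> < R" using Basis_le_norm[of b x] that by linarith
    then show "flat_exp 1 (x \<bullet> b + R) > 0" "flat_exp 1 (x \<bullet> (- b) + R) > 0"
      by (auto simp: flat_exp_one_pos)
  qed
  show "?\<beta> x = 0" if "x \<notin> cball 0 (R * DIM('a))" for x
  proof -
    have "\<exists>b\<in>Basis. \<bar>x \<bullet> b\<bar> > R"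
    proof (rule ccontr)
      assume "\<not> ?thesis"
      then have "(\<Sum>b\<in>Basis. \<bar>x \<bullet> b\<bar>) \<le> (\<Sum>b\<in>(Basis::'a set). R)" by (intro sum_mono) (auto simp: not_less)
      then show False using that norm_le_l1[of x] by (auto simp: mult.commute)
    qed
    then obtain b where "b \<in> Basis" "\<bar>x \<bullet> b\<bar> > R" by auto
    then show ?thesis by (auto intro!: prod_zero bexI[of _ b] flat_exp_one_nonpos simp: abs_if split: if_splits)
  qed
qed

subsection \<open>Test functions\<close>

lemma test_functionI:
  assumes "smooth f" "\<And>x. norm x > R \<Longrightarrow> f x = 0"
  shows "test_function f"
proof -
  have "{x. f x \<noteq> 0} \<subseteq> cball 0 R" using assms(2) by (force simp: not_le)
  then have "bounded {x. f x \<noteq> 0}" using bounded_cball bounded_subset by blast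
  then show ?thesis using assms(1) by (auto simp: test_function_def smooth_def)
qed

lemma test_function_smooth: "test_function f \<Longrightarrow> smooth f"
  by (simp add: test_function_def smooth_def)

lemma test_function_support:
  assumes "test_function f" obtains R where "R > 0" "\<And>x. norm x > R \<Longrightarrow> f x = 0"
proof -
  have "bounded {x. f x \<noteq> 0}"
    using assms bounded_subset[OF compact_imp_bounded closure_subset] by (auto simp: test_function_def)
  then obtain R where "R > 0" "\<forall>x\<in>{x. f x \<noteq> 0}. norm x \<le> R" by (auto simp: bounded_pos)
  then show ?thesis using that[of R] by force
qed

lemma test_function_partial:
  assumes "test_function f" "b \<in> Basis" shows "test_function (\<lambda>x. frechet_derivative f (at x) b)"
proof -
  obtain R where R: "\<And>x. norm x > R \<Longrightarrow> f x = 0" using test_function_support[OF assms(1)] by blast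
  have "frechet_derivative f (at x) b = 0" if "norm x > R" for x
  proof -
    have "open (- cball 0 R :: 'a set)" by (simp only: open_Compl closed_cball)
    moreover have "x \<in> - cball 0 R" using that by simp
    moreover have "0 = f y" if "y \<in> - cball 0 R" for y using that R[of y] by simp
    ultimately have "(f has_derivative (\<lambda>_. 0)) (at x)"
      by (rule has_derivative_transform_within_open[OF has_derivative_const])
    from frechet_derivative_at[OF this, symmetric] show ?thesis by simp
  qed
  then show ?thesis
    using smooth_partial[OF test_function_smooth[OF assms(1)] assms(2)] by (auto intro: test_functionI[of _ R])
qed

lemma test_function_translate:
  assumes "test_function f" shows "test_function (\<lambda>x. f (x + a))"
proof -
  obtain R where R: "\<And>x. norm x > R \<Longrightarrow> f x = 0" using test_function_support[OF assms(1)] by blast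
  have "f (x + a) = 0" if "norm x > R + norm a" for x
    using R[of "x + a"] that norm_diff_ineq[of x a] by linarith
  then show ?thesis
    using smooth_translate[OF test_function_smooth[OF assms]] by (auto intro: test_functionI[of _ "R + norm a"])
qed

lemma test_function_partial_translate:
  assumes "test_function f"
  shows "frechet_derivative (\<lambda>x. f (x + a)) (at x) b = frechet_derivative f (at (x + a)) b"
proof -
  have "((\<lambda>x. f (x + a)) has_derivative (\<lambda>b. frechet_derivative f (at (x + a)) b)) (at x)"
    by (rule has_derivative_compose[of "\<lambda>x. x + a" "\<lambda>h. h", simplified])
       (auto intro!: derivative_eq_intros smooth_has_derivative test_function_smooth assms)
  then show ?thesis using frechet_derivative_at by metis
qed

section \<open>Symmetry of second partial derivatives\<close>

lemma smooth_line_derivative: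
  assumes "smooth f"
  shows "((\<lambda>t. f (x + t *\<^sub>R b)) has_real_derivative frechet_derivative f (at (x + t *\<^sub>R b)) b) (at t)"
proof -
  have "((\<lambda>t. f (x + t *\<^sub>R b)) has_derivative (\<lambda>s. frechet_derivative f (at (x + t *\<^sub>R b)) (s *\<^sub>R b))) (at t)"
  proof (rule has_derivative_compose[of "\<lambda>t. x + t *\<^sub>R b" "\<lambda>s. s *\<^sub>R b", OF _ smooth_has_derivative[OF assms]])
    show "((\<lambda>t. x + t *\<^sub>R b) has_derivative (\<lambda>s. s *\<^sub>R b)) (at t)"
      by (auto intro!: derivative_eq_intros)
  qed
  moreover have "(\<lambda>s. frechet_derivative f (at y) (s *\<^sub>R b)) = (*) (frechet_derivative f (at y) b)" for y
  proof
    fix s show "frechet_derivative f (at y) (s *\<^sub>R b) = frechet_derivative f (at y) b * s"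
      using linear_scale[OF has_derivative_linear[OF smooth_has_derivative[OF assms, of y]], of s b]
      by (simp add: mult.commute)
  qed
  ultimately show ?thesis unfolding has_field_derivative_def by metis
qed

text \<open>The mean value theorem is applied along \<open>a\<close> to a difference in direction
  \<open>b\<close>, and then along \<open>b\<close> to the partial derivative in direction
  \<open>a\<close>.\<close>

lemma smooth_second_difference:
  assumes "smooth f" "a \<in> Basis" "b \<in> Basis" "h > 0"
  shows "\<exists>s t. 0 < s \<and> s < h \<and> 0 < t \<and> t < h \<and>
    f (x + h *\<^sub>R a + h *\<^sub>R b) - f (x + h *\<^sub>R a) - f (x + h *\<^sub>R b) + f x =
    h\<^sup>2 * frechet_derivative (\<lambda>y. frechet_derivative f (at y) a) (at (x + s *\<^sub>R a + t *\<^sub>R b)) b"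
proof -
  define fa where "fa y = frechet_derivative f (at y) a" for y
  have fa: "smooth fa" unfolding fa_def using smooth_partial assms by blast
  define g where "g s = f ((x + h *\<^sub>R b) + s *\<^sub>R a) - f (x + s *\<^sub>R a)" for s
  have "(g has_real_derivative fa ((x + h *\<^sub>R b) + s *\<^sub>R a) - fa (x + s *\<^sub>R a)) (at s)" for s
    unfolding g_def fa_def by (intro DERIV_diff smooth_line_derivative assms)
  then obtain s where s: "0 < s" "s < h" "g h - g 0 = (h - 0) * (fa ((x + h *\<^sub>R b) + s *\<^sub>R a) - fa (x + s *\<^sub>R a))"
    using MVT2[of 0 h g "\<lambda>s. fa ((x + h *\<^sub>R b) + s *\<^sub>R a) - fa (x + s *\<^sub>R a)"] assms(4) by blast
  obtain t where t: "0 < t" "t < h" "fa ((x + s *\<^sub>R a) + h *\<^sub>R b) - fa ((x + s *\<^sub>R a) + 0 *\<^sub>R b)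
      = (h - 0) * frechet_derivative fa (at ((x + s *\<^sub>R a) + t *\<^sub>R b)) b"
    using MVT2[of 0 h "\<lambda>t. fa ((x + s *\<^sub>R a) + t *\<^sub>R b)"
      "\<lambda>t. frechet_derivative fa (at ((x + s *\<^sub>R a) + t *\<^sub>R b)) b"] assms(4) smooth_line_derivative[OF fa] by blast
  have "f (x + h *\<^sub>R a + h *\<^sub>R b) - f (x + h *\<^sub>R a) - f (x + h *\<^sub>R b) + f x = g h - g 0"
    by (simp add: g_def algebra_simps)
  also have "\<dots> = h * (fa ((x + s *\<^sub>R a) + h *\<^sub>R b) - fa ((x + s *\<^sub>R a) + 0 *\<^sub>R b))"
    using s(3) by (simp add: add_ac)
  also have "\<dots> = h\<^sup>2 * frechet_derivative fa (at (x + s *\<^sub>R a + t *\<^sub>R b)) b"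
    unfolding t(3) by (simp add: power2_eq_square)
  finally show ?thesis using s(1,2) t(1,2) unfolding fa_def[abs_def] by blast
qed

text \<open>The second difference is unchanged when \<open>a\<close> and \<open>b\<close> are
  swapped, so both mixed partials take equal values at points converging to \<open>x\<close>. This
  is the source of the symmetry of second weak derivatives.\<close>

lemma smooth_partial_commute:
  assumes "smooth f" "a \<in> Basis" "b \<in> Basis"
  shows "frechet_derivative (\<lambda>y. frechet_derivative f (at y) a) (at x) b =
    frechet_derivative (\<lambda>y. frechet_derivative f (at y) b) (at x) a"
proof -
  define fab where "fab z = frechet_derivative (\<lambda>y. frechet_derivative f (at y) a) (at z) b" for z
  define fba where "fba z = frechet_derivative (\<lambda>y. frechet_derivative f (at y) b) (at z) a" for z
  have lim: "(\<lambda>n. g (x + s n *\<^sub>R c + t n *\<^sub>R d)) \<longlonglongrightarrow> g x"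
    if "continuous_on UNIV g" and st: "\<And>n. 0 < s n \<and> s n < inverse (Suc n) \<and> 0 < t n \<and> t n < inverse (Suc n)"
    for g :: "'a \<Rightarrow> real" and s t :: "nat \<Rightarrow> real" and c d
  proof -
    have "s \<longlonglongrightarrow> 0" "t \<longlonglongrightarrow> 0"
      using st by (auto intro!: tendsto_sandwich[OF _ _ tendsto_const LIMSEQ_inverse_real_of_nat] always_eventually less_imp_le)
    then have "(\<lambda>n. x + s n *\<^sub>R c + t n *\<^sub>R d) \<longlonglongrightarrow> x + 0 *\<^sub>R c + 0 *\<^sub>R d"
      by (intro tendsto_intros)
    moreover have "isCont g x" using that(1) continuous_on_eq_continuous_at by blast
    ultimately show ?thesis using isCont_tendsto_compose by fastforce
  qed
  have sm: "smooth fab" "smooth fba"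
    unfolding fab_def[abs_def] fba_def[abs_def] using assms smooth_partial by blast+
  have "\<exists>s t. 0 < s \<and> s < inverse (Suc n) \<and> 0 < t \<and> t < inverse (Suc n) \<and>
    f (x + inverse (Suc n) *\<^sub>R a + inverse (Suc n) *\<^sub>R b) - f (x + inverse (Suc n) *\<^sub>R a) - f (x + inverse (Suc n) *\<^sub>R b) + f x =
    (inverse (Suc n))\<^sup>2 * fab (x + s *\<^sub>R a + t *\<^sub>R b)" for n
    unfolding fab_def by (rule smooth_second_difference) (use assms in auto)
  then obtain s t where st: "\<And>n. 0 < s n \<and> s n < inverse (Suc n) \<and> 0 < t n \<and> t n < inverse (Suc n) \<and>
    f (x + inverse (Suc n) *\<^sub>R a + inverse (Suc n) *\<^sub>R b) - f (x + inverse (Suc n) *\<^sub>R a) - f (x + inverse (Suc n) *\<^sub>R b) + f x =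
    (inverse (Suc n))\<^sup>2 * fab (x + s n *\<^sub>R a + t n *\<^sub>R b)" by metis
  have "\<exists>s t. 0 < s \<and> s < inverse (Suc n) \<and> 0 < t \<and> t < inverse (Suc n) \<and>
    f (x + inverse (Suc n) *\<^sub>R b + inverse (Suc n) *\<^sub>R a) - f (x + inverse (Suc n) *\<^sub>R b) - f (x + inverse (Suc n) *\<^sub>R a) + f x =
    (inverse (Suc n))\<^sup>2 * fba (x + s *\<^sub>R b + t *\<^sub>R a)" for n
    unfolding fba_def by (rule smooth_second_difference) (use assms in auto)
  then obtain s' t' where st': "\<And>n. 0 < s' n \<and> s' n < inverse (Suc n) \<and> 0 < t' n \<and> t' n < inverse (Suc n) \<and>
    f (x + inverse (Suc n) *\<^sub>R b + inverse (Suc n) *\<^sub>R a) - f (x + inverse (Suc n) *\<^sub>R b) - f (x + inverse (Suc n) *\<^sub>R a) + f x =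
    (inverse (Suc n))\<^sup>2 * fba (x + s' n *\<^sub>R b + t' n *\<^sub>R a)" by metis
  have eq: "fab (x + s n *\<^sub>R a + t n *\<^sub>R b) = fba (x + s' n *\<^sub>R b + t' n *\<^sub>R a)" for n
  proof -
    have "(inverse (real (Suc n)))\<^sup>2 * fab (x + s n *\<^sub>R a + t n *\<^sub>R b) =
        (inverse (real (Suc n)))\<^sup>2 * fba (x + s' n *\<^sub>R b + t' n *\<^sub>R a)"
    proof -
      have *: "x + inverse (real (Suc n)) *\<^sub>R a + inverse (real (Suc n)) *\<^sub>R b =
          x + inverse (real (Suc n)) *\<^sub>R b + inverse (real (Suc n)) *\<^sub>R a" by (simp only: add_ac)
      show ?thesis using st[of n, unfolded *] st'[of n] by linarith
    qed
    moreover have "(inverse (real (Suc n)))\<^sup>2 \<noteq> 0" by simp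
    ultimately show ?thesis using mult_left_cancel by blast
  qed
  have "(\<lambda>n. fab (x + s n *\<^sub>R a + t n *\<^sub>R b)) \<longlonglongrightarrow> fab x"
    by (rule lim) (use st sm smooth_continuous in auto)
  moreover have "(\<lambda>n. fba (x + s' n *\<^sub>R b + t' n *\<^sub>R a)) \<longlonglongrightarrow> fba x"
    by (rule lim) (use st' sm smooth_continuous in auto)
  ultimately have "fab x = fba x" unfolding eq by (rule LIMSEQ_unique)
  then show ?thesis unfolding fab_def fba_def .
qed

lemma compact_support_bounded:
  fixes f :: "'a::euclidean_space \<Rightarrow> real"
  assumes "continuous_on UNIV f" "\<And>x. norm x > R \<Longrightarrow> f x = 0"
  obtains M where "M > 0" "\<And>x. \<bar>f x\<bar> \<le> M"
proof -
  have "bounded (f ` cball 0 R)"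
    by (meson assms(1) compact_cball compact_continuous_image compact_imp_bounded continuous_on_subset subset_UNIV)
  then obtain M where M: "M > 0" "\<forall>y\<in>f ` cball 0 R. norm y \<le> M" by (auto simp: bounded_pos)
  have "\<bar>f x\<bar> \<le> M" for x
    by (cases "norm x > R") (use M assms(2) in \<open>auto simp: not_less\<close>)
  then show ?thesis using that M by blast
qed


subsection \<open>Square integrable functions\<close>

definition sq_int :: "('a::euclidean_space \<Rightarrow> real) \<Rightarrow> bool" where
  "sq_int f \<longleftrightarrow> f \<in> borel_measurable lborel \<and> integrable lborel (\<lambda>x. (f x)\<^sup>2)"

lemma sq_int_measurable [measurable_dest]: "sq_int f \<Longrightarrow> f \<in> borel_measurable borel"
  by (simp add: sq_int_def)

lemma sq_int_integrable: "sq_int f \<Longrightarrow> integrable lborel (\<lambda>x. (f x)\<^sup>2)"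
  by (simp add: sq_int_def)

lemma abs_mult_le_squares: "\<bar>a * b\<bar> \<le> a\<^sup>2 + (b::real)\<^sup>2"
proof -
  have "2 * (\<bar>a\<bar> * \<bar>b\<bar>) \<le> a\<^sup>2 + b\<^sup>2" using sum_squares_bound[of "\<bar>a\<bar>" "\<bar>b\<bar>"] by (simp add: mult.assoc)
  moreover have "0 \<le> \<bar>a\<bar> * \<bar>b\<bar>" by simp
  ultimately show ?thesis by (simp only: abs_mult)
qed

lemma sq_int_mult_integrable:
  assumes "sq_int f" "sq_int g" shows "integrable lborel (\<lambda>x. f x * g x)"
proof (rule Bochner_Integration.integrable_bound)
  show "integrable lborel (\<lambda>x. (f x)\<^sup>2 + (g x)\<^sup>2)"
    using assms by (auto simp: sq_int_def)
  show "(\<lambda>x. f x * g x) \<in> borel_measurable lborel" using assms by (auto simp: sq_int_def)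
  show "AE x in lborel. norm (f x * g x) \<le> norm ((f x)\<^sup>2 + (g x)\<^sup>2)"
    using abs_mult_le_squares by (auto intro!: AE_I2 order_trans[OF abs_mult_le_squares])
qed

lemma sq_int_bound:
  assumes "sq_int f" "g \<in> borel_measurable lborel" "\<And>x. \<bar>g x\<bar> \<le> C * \<bar>f x\<bar>"
  shows "sq_int g"
  unfolding sq_int_def
proof
  show "integrable lborel (\<lambda>x. (g x)\<^sup>2)"
  proof (rule Bochner_Integration.integrable_bound)
    show "integrable lborel (\<lambda>x. C\<^sup>2 * (f x)\<^sup>2)" using assms(1) by (simp add: sq_int_def)
    have "(g x)\<^sup>2 \<le> C\<^sup>2 * (f x)\<^sup>2" for x
      using power_mono[OF assms(3)[of x], of 2] by (simp add: power_mult_distrib)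
    then show "AE x in lborel. norm ((g x)\<^sup>2) \<le> norm (C\<^sup>2 * (f x)\<^sup>2)"
      by simp
  qed (use assms in auto)
qed (use assms in auto)

lemma sq_int_bounded_mult:
  assumes "sq_int f" "W \<in> borel_measurable borel" "\<And>x. \<bar>W x\<bar> \<le> C"
  shows "sq_int (\<lambda>x. W x * f x)"
  by (rule sq_int_bound[OF assms(1), of _ C])
     (use assms in \<open>auto simp: sq_int_def abs_mult intro!: mult_right_mono\<close>)

lemma sq_int_cmult: "sq_int f \<Longrightarrow> sq_int (\<lambda>x. c * f x)"
  by (rule sq_int_bounded_mult) auto

lemma square_add_le: "((a::real) + b)\<^sup>2 \<le> 2 * a\<^sup>2 + 2 * b\<^sup>2"
  using sum_squares_bound[of a b] by (simp add: power2_sum)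

lemma sq_int_add:
  assumes "sq_int f" "sq_int g" shows "sq_int (\<lambda>x. f x + g x)"
proof -
  have "integrable lborel (\<lambda>x. (f x)\<^sup>2 + (g x)\<^sup>2 + 2 * (f x * g x))"
    using assms sq_int_mult_integrable[OF assms] by (auto simp: sq_int_def)
  then show ?thesis using assms by (auto simp: sq_int_def power2_sum mult.assoc)
qed

lemma sq_int_diff: "sq_int f \<Longrightarrow> sq_int g \<Longrightarrow> sq_int (\<lambda>x. f x - g x)"
  using sq_int_add[of f "\<lambda>x. (-1) * g x"] sq_int_cmult[of g "-1"] by simp

lemma sq_int_zero: "sq_int (\<lambda>x. 0)"
  by (simp add: sq_int_def)

lemma sq_int_sum: "(\<And>i. i \<in> I \<Longrightarrow> sq_int (f i)) \<Longrightarrow> sq_int (\<lambda>x. \<Sum>i\<in>I. f i x)"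
  by (induction I rule: infinite_finite_induct) (auto intro: sq_int_add sq_int_zero)

lemma sq_int_triangle:
  assumes "sq_int f" "sq_int g" "sq_int h"
  shows "(LINT x|lborel. (f x - h x)\<^sup>2) \<le> 2 * (LINT x|lborel. (f x - g x)\<^sup>2) + 2 * (LINT x|lborel. (g x - h x)\<^sup>2)"
proof -
  have "(LINT x|lborel. (f x - h x)\<^sup>2) \<le> (LINT x|lborel. 2 * (f x - g x)\<^sup>2 + 2 * (g x - h x)\<^sup>2)"
    using assms square_add_le[of "f x - g x" "g x - h x" for x]
    by (intro integral_mono) (auto intro!: sq_int_integrable sq_int_diff)
  also have "\<dots> = 2 * (LINT x|lborel. (f x - g x)\<^sup>2) + 2 * (LINT x|lborel. (g x - h x)\<^sup>2)"
    using assms by (subst Bochner_Integration.integral_add) (auto intro!: sq_int_integrable sq_int_diff)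
  finally show ?thesis .
qed

lemma integral_translate:
  fixes f :: "'a::euclidean_space \<Rightarrow> real"
  assumes [measurable]: "f \<in> borel_measurable borel"
  shows "(LINT x|lborel. f (x + a)) = (LINT x|lborel. f x)"
  using integral_distr[of "(+) a" lborel borel f] by (simp add: lborel_distr_plus add.commute)

lemma integrable_translate:
  fixes f :: "'a::euclidean_space \<Rightarrow> real"
  assumes "integrable lborel f"
  shows "integrable lborel (\<lambda>x. f (x + a))"
proof -
  have [measurable]: "f \<in> borel_measurable borel" using assms by auto
  show ?thesis
    using integrable_distr_eq[of "(+) a" lborel borel f] assms by (simp add: lborel_distr_plus add.commute)
qed

lemma sq_int_translate: "sq_int f \<Longrightarrow> sq_int (\<lambda>x. f (x + a))"
  using integrable_translate[of "\<lambda>x. (f x)\<^sup>2" a] by (auto simp: sq_int_def)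

lemma integrable_indicator_cball: "integrable lborel (indicator (cball a R) :: 'a::euclidean_space \<Rightarrow> real)"
  by (rule integrable_real_indicator) (use emeasure_bounded_finite[OF bounded_cball, of a R] in simp_all)

lemma compact_support_integrable:
  fixes f :: "'a::euclidean_space \<Rightarrow> real"
  assumes "f \<in> borel_measurable borel" "\<And>x. \<bar>f x\<bar> \<le> M" "\<And>x. norm x > R \<Longrightarrow> f x = 0"
  shows "integrable lborel f"
proof (rule Bochner_Integration.integrable_bound)
  show "integrable lborel (\<lambda>x. M * indicator (cball 0 R) x :: real)"
    by (intro integrable_mult_right integrable_indicator_cball)
  show "AE x in lborel. norm (f x) \<le> norm (M * indicator (cball 0 R) x :: real)"
  proof (rule AE_I2)
    fix x show "norm (f x) \<le> norm (M * indicator (cball 0 R) x :: real)"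
      using assms(2)[of x] assms(3)[of x] by (auto simp: indicator_def not_le)
  qed
qed (use assms in auto)

lemma compact_support_sq_int:
  fixes f :: "'a::euclidean_space \<Rightarrow> real"
  assumes "f \<in> borel_measurable borel" "\<And>x. \<bar>f x\<bar> \<le> M" "\<And>x. norm x > R \<Longrightarrow> f x = 0"
  shows "sq_int f"
proof -
  have "(f x)\<^sup>2 \<le> M\<^sup>2" for x using assms(2)[of x] by (metis abs_ge_zero power2_abs power_mono)
  then show ?thesis unfolding sq_int_def
    using compact_support_integrable[of "\<lambda>x. (f x)\<^sup>2" "M\<^sup>2" R] assms by auto
qed

lemma continuous_compact_support_sq_int:
  fixes f :: "'a::euclidean_space \<Rightarrow> real"
  assumes "continuous_on UNIV f" "\<And>x. norm x > R \<Longrightarrow> f x = 0"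
  shows "sq_int f"
  using compact_support_bounded[OF assms] compact_support_sq_int[OF borel_measurable_continuous_onI[OF assms(1)]] assms(2)
  by metis

lemma test_function_sq_int: "test_function f \<Longrightarrow> sq_int f"
  using continuous_compact_support_sq_int[OF smooth_continuous[OF test_function_smooth]] test_function_support by blast

lemma sq_int_dominated:
  fixes D :: "'a::euclidean_space \<Rightarrow> real"
  assumes [measurable]: "\<And>n. f n \<in> borel_measurable borel" "g \<in> borel_measurable borel"
    and "integrable lborel (\<lambda>x. (D x)\<^sup>2)"
    and "AE x in lborel. (\<lambda>n. f n x) \<longlonglongrightarrow> g x" "\<And>n x. \<bar>f n x - g x\<bar> \<le> \<bar>D x\<bar>"
  shows "(\<lambda>n. LINT x|lborel. (f n x - g x)\<^sup>2) \<longlonglongrightarrow> 0"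
proof -
  have "(\<lambda>n. LINT x|lborel. (f n x - g x)\<^sup>2) \<longlonglongrightarrow> (LINT x|(lborel::'a measure). 0)"
  proof (rule integral_dominated_convergence[where w="\<lambda>x. (D x)\<^sup>2"])
    show "AE x in lborel. (\<lambda>n. (f n x - g x)\<^sup>2) \<longlonglongrightarrow> 0"
      using assms(4)
    proof eventually_elim
      case (elim x)
      then have "(\<lambda>n. (f n x - g x)\<^sup>2) \<longlonglongrightarrow> (g x - g x)\<^sup>2" by (intro tendsto_intros)
      then show ?case by simp
    qed
    show "AE x in lborel. norm ((f n x - g x)\<^sup>2) \<le> (D x)\<^sup>2" for n
      using power_mono[OF assms(5), of n _ 2] by simp
  qed (use assms in auto)
  then show ?thesis by simp
qed

subsection \<open>Density of test functions\<close>

text \<open>Stone-Weierstrass supplies smooth approximants, but only on a compact set. So the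
  quotient \<open>q = h / \<beta>\<close> by a bump positive on the support of \<open>h\<close> is
  approximated, and multiplying back by \<open>\<beta>\<close> restores compact support.\<close>

lemma test_function_dense_continuous:
  fixes h :: "'a::euclidean_space \<Rightarrow> real"
  assumes h: "continuous_on UNIV h" "\<And>x. norm x > R \<Longrightarrow> h x = 0" and "e > 0"
  shows "\<exists>w. test_function w \<and> (LINT x|lborel. (h x - w x)\<^sup>2) < e"
proof -
  obtain \<beta> :: "'a \<Rightarrow> real" where \<beta>: "smooth \<beta>" "\<And>x. norm x < R + 1 \<Longrightarrow> \<beta> x > 0"
    "\<And>x. x \<notin> cball 0 ((R + 1) * DIM('a)) \<Longrightarrow> \<beta> x = 0"
    using test_function_bump[of "R + 1"] by metis
  define R' where "R' = (R + 1) * DIM('a)"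
  have \<beta>0: "norm x > R' \<Longrightarrow> \<beta> x = 0" for x using \<beta>(3)[of x] by (simp add: R'_def)
  obtain M where M: "M > 0" "\<And>x. \<bar>\<beta> x\<bar> \<le> M"
    using compact_support_bounded[OF smooth_continuous[OF \<beta>(1)] \<beta>0] by blast
  define q where "q x = h x / \<beta> x" for x
  have hq: "h x = \<beta> x * q x" for x
    using h(2)[of x] \<beta>(2)[of x] by (cases "norm x < R + 1") (auto simp: q_def)
  \<comment> \<open>Two open sets cover the space: on one \<open>\<beta>\<close> is positive, on the
    other \<open>h\<close> and hence \<open>q\<close> vanish, including where the denominator is
    0.\<close>
  have "continuous_on (ball 0 (R + 1) \<union> - cball 0 R) q"
  proof (rule continuous_on_open_Un)
    show "continuous_on (ball 0 (R + 1)) q" unfolding q_def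
      using \<beta>(2) by (intro continuous_on_divide continuous_on_subset[OF h(1)] continuous_on_subset[OF smooth_continuous[OF \<beta>(1)]])
        (auto simp: less_imp_neq[symmetric])
    show "continuous_on (- cball 0 R) q"
      by (rule continuous_on_cong[THEN iffD2, OF refl _ continuous_on_const[of _ 0]]) (use h(2) in \<open>auto simp: q_def\<close>)
  qed auto
  moreover have "ball 0 (R + 1) \<union> - cball 0 R = (UNIV::'a set)" by auto
  ultimately have q: "continuous_on UNIV q" by metis
  define V where "V = measure lborel (cball 0 R' :: 'a set)"
  \<comment> \<open>Chosen to make the final bound \<open>M\<^sup>2 * d\<^sup>2 * V\<close> on the
    squared error at most \<open>e / 4\<close>; the \<open>+ 1\<close> keeps the denominator
    positive.\<close>
  define d where "d = sqrt (e / (M\<^sup>2 * V + 1)) / 2"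
  have V: "V \<ge> 0" by (simp add: V_def)
  have d: "d > 0" unfolding d_def using \<open>e > 0\<close> M V
    by (intro divide_pos_pos real_sqrt_gt_zero add_nonneg_pos mult_nonneg_nonneg) auto
  have "\<exists>p. smooth p \<and> (\<forall>x\<in>cball 0 R'. \<bar>q x - p x\<bar> < d)"
  proof (rule Stone_Weierstrass_HOL[where P = smooth])
    show "\<exists>f. smooth f \<and> f x \<noteq> f y" if "x \<in> cball 0 R' \<and> y \<in> cball 0 R' \<and> x \<noteq> y" for x y :: 'a
    proof -
      have "\<not> (\<forall>b. x \<bullet> b = y \<bullet> b)" using that vector_eq_ldot[of x y] vector_eq_rdot[of x y] by simp
      then obtain b where "x \<bullet> b \<noteq> y \<bullet> b" by blast
      then show ?thesis
        using smooth_linear[OF bounded_linear_inner_left[of b]] by auto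
    qed
  qed (use d in \<open>auto intro: smooth_const smooth_add smooth_mult continuous_on_subset[OF q] continuous_on_subset[OF smooth_continuous]\<close>)
  then obtain p where p: "smooth p" "\<And>x. norm x \<le> R' \<Longrightarrow> \<bar>q x - p x\<bar> < d" by auto
  have tw: "test_function (\<lambda>x. \<beta> x * p x)"
    by (rule test_functionI[of _ R']) (auto simp: R'_def \<beta> p(1) smooth_mult)
  have "(h x - \<beta> x * p x)\<^sup>2 \<le> M\<^sup>2 * d\<^sup>2 * indicator (cball 0 R') x" for x
  proof (cases "norm x \<le> R'")
    case True
    have "\<bar>h x - \<beta> x * p x\<bar> = \<bar>\<beta> x\<bar> * \<bar>q x - p x\<bar>"
      unfolding hq[of x] by (simp add: abs_mult[symmetric] right_diff_distrib)
    also have "\<dots> \<le> M * d" using M p(2)[OF True] by (intro mult_mono) auto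
    finally have "\<bar>h x - \<beta> x * p x\<bar>\<^sup>2 \<le> (M * d)\<^sup>2" by (intro power_mono) auto
    then show ?thesis using True by (simp add: power_mult_distrib)
  next
    case False
    then have "\<beta> x = 0" using \<beta>(3) by (auto simp: R'_def)
    then show ?thesis using hq[of x] by simp
  qed
  then have "(LINT x|lborel. (h x - \<beta> x * p x)\<^sup>2) \<le> (LINT x|lborel. M\<^sup>2 * d\<^sup>2 * indicator (cball 0 R') (x::'a))"
    by (intro integral_mono integrable_mult_right integrable_indicator_cball sq_int_integrable sq_int_diff
        continuous_compact_support_sq_int[OF h] test_function_sq_int[OF tw])
  also have "\<dots> = M\<^sup>2 * d\<^sup>2 * V" by (simp add: V_def)
  also have "\<dots> = (M\<^sup>2 * V) / (M\<^sup>2 * V + 1) * (e / 4)"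
    unfolding d_def power_divide using \<open>e > 0\<close> V by (subst real_sqrt_pow2) auto
  also have "\<dots> \<le> 1 * (e / 4)"
  proof (intro mult_right_mono)
    have "0 \<le> M\<^sup>2 * V" using V by simp
    then show "M\<^sup>2 * V / (M\<^sup>2 * V + 1) \<le> 1" by (simp add: divide_le_eq_1)
  qed (use \<open>e > 0\<close> in auto)
  also have "\<dots> < e" using \<open>e > 0\<close> by simp
  finally show ?thesis using tw by blast
qed

text \<open>Three successive approximations: truncation in value and in space, continuous functions
  converging off a null set, and the continuous case.\<close>

lemma test_function_dense:
  fixes f :: "'a::euclidean_space \<Rightarrow> real"
  assumes f: "sq_int f" and "e > 0"
  shows "\<exists>w. test_function w \<and> (LINT x|lborel. (f x - w x)\<^sup>2) < e"
proof -
  note [measurable] = sq_int_measurable[OF f]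
  define F where "F n x = (if norm x \<le> real n \<and> \<bar>f x\<bar> \<le> real n then f x else 0)" for n x
  have [measurable]: "F n \<in> borel_measurable borel" for n unfolding F_def by measurable
  have Fsq: "sq_int (F n)" for n
    by (rule sq_int_bound[OF f, of _ 1]) (auto simp: F_def)
  have "(\<lambda>n. LINT x|lborel. (F n x - f x)\<^sup>2) \<longlonglongrightarrow> 0"
  proof (rule sq_int_dominated[where D=f])
    show "AE x in lborel. (\<lambda>n. F n x) \<longlonglongrightarrow> f x"
    proof (rule AE_I2)
      fix x
      obtain N where N: "norm x + \<bar>f x\<bar> \<le> real N" using real_arch_simple by blast
      have "eventually (\<lambda>n. F n x = f x) sequentially"
        using eventually_ge_at_top[of N]
      proof eventually_elim
        case (elim n)
        then have "norm x + \<bar>f x\<bar> \<le> real n" using N by linarith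
        moreover have "norm x \<ge> 0" "\<bar>f x\<bar> \<ge> 0" by auto
        ultimately have "norm x \<le> real n" "\<bar>f x\<bar> \<le> real n" by linarith+
        then show ?case by (simp add: F_def)
      qed
      then show "(\<lambda>n. F n x) \<longlonglongrightarrow> f x" by (rule tendsto_eventually)
    qed
  qed (use f in \<open>auto simp: F_def sq_int_def\<close>)
  then obtain n where n: "(LINT x|lborel. (F n x - f x)\<^sup>2) < e / 8"
    using order_tendstoD(2)[of _ 0 sequentially "e/8"] \<open>e > 0\<close> by (metis (no_types, lifting) eventually_sequentially order_refl zero_less_divide_iff zero_less_numeral)
  have "F n measurable_on UNIV"
    by (rule lebesgue_measurable_imp_measurable_on_real) (auto intro: measurable_completion)
  then obtain N g where N: "negligible N" and g: "\<And>m. continuous_on UNIV (g m)"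
    and lim: "\<And>x. x \<notin> N \<Longrightarrow> (\<lambda>m. g m x) \<longlonglongrightarrow> F n x"
    unfolding measurable_on_def by auto
  define c where "c x = max 0 (min 1 (real n + 1 - norm x))" for x :: 'a
  \<comment> \<open>Clipping and cutting off do not disturb the limit \<open>F n\<close>, which is
    bounded by \<open>n\<close> and supported in the ball already, and they supply a dominating
    function.\<close>
  define h where "h m x = max (- real n) (min (real n) (g m x)) * c x" for m x
  have hc: "continuous_on UNIV (h m)" for m unfolding h_def c_def by (intro continuous_intros g)
  have h0: "norm x > real n + 1 \<Longrightarrow> h m x = 0" for m x by (auto simp: h_def c_def)
  have c1: "0 \<le> c x" "c x \<le> 1" for x by (auto simp: c_def)
  have hb: "\<bar>h m x\<bar> \<le> real n" for m x
  proof -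
    have "\<bar>h m x\<bar> \<le> real n * 1" unfolding h_def abs_mult using c1[of x] by (intro mult_mono) auto
    then show ?thesis by simp
  qed
  have "(\<lambda>m. LINT x|lborel. (h m x - F n x)\<^sup>2) \<longlonglongrightarrow> 0"
  proof (rule sq_int_dominated[where D="\<lambda>x. 2 * real n * indicator (cball 0 (real n + 1)) x"])
    show "h m \<in> borel_measurable borel" for m by (rule borel_measurable_continuous_onI[OF hc])
    have "sq_int (\<lambda>x::'a. 2 * real n * indicator (cball 0 (real n + 1)) x)"
      by (rule compact_support_sq_int[of _ "2 * real n" "real n + 1"]) (auto simp: indicator_def)
    then show "integrable lborel (\<lambda>x::'a. (2 * real n * indicator (cball 0 (real n + 1)) x)\<^sup>2)" by (simp add: sq_int_def)
    show "AE x in lborel. (\<lambda>m. h m x) \<longlonglongrightarrow> F n x"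
    proof -
      have "AE x in lebesgue. x \<notin> N" using N by (simp add: negligible_iff_null_sets AE_not_in)
      then have "AE x in lborel. x \<notin> N" by (simp add: AE_completion_iff)
      then show ?thesis
      proof eventually_elim
        case (elim x)
        have "(\<lambda>m. h m x) \<longlonglongrightarrow> max (- real n) (min (real n) (F n x)) * c x"
          unfolding h_def by (intro tendsto_intros lim elim)
        moreover have "max (- real n) (min (real n) (F n x)) * c x = F n x" by (auto simp: F_def c_def)
        ultimately show ?case by simp
      qed
    qed
    show "\<bar>h m x - F n x\<bar> \<le> \<bar>2 * real n * indicator (cball 0 (real n + 1)) x\<bar>" for m x
    proof (cases "norm x > real n + 1")
      case True then show ?thesis using h0[OF True] by (auto simp: F_def)
    next
      case False
      then show ?thesis using hb[of m x] by (auto simp: F_def)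
    qed
  qed auto
  then obtain m where m: "(LINT x|lborel. (h m x - F n x)\<^sup>2) < e / 16"
    using order_tendstoD(2)[of _ 0 sequentially "e/16"] \<open>e > 0\<close> by (metis (no_types, lifting) eventually_sequentially order_refl zero_less_divide_iff zero_less_numeral)
  obtain w where w: "test_function w" "(LINT x|lborel. (h m x - w x)\<^sup>2) < e / 16"
    using test_function_dense_continuous[where e="e/16", OF hc[of m] h0[of _ m]] \<open>e > 0\<close> by force
  have hsq: "sq_int (h m)" using continuous_compact_support_sq_int[OF hc h0] .
  have "(LINT x|lborel. (f x - w x)\<^sup>2) \<le> 2 * (LINT x|lborel. (f x - F n x)\<^sup>2) + 2 * (LINT x|lborel. (F n x - w x)\<^sup>2)"
    by (intro sq_int_triangle f Fsq test_function_sq_int w)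
  also have "\<dots> \<le> 2 * (LINT x|lborel. (f x - F n x)\<^sup>2) + 2 * (2 * (LINT x|lborel. (F n x - h m x)\<^sup>2) + 2 * (LINT x|lborel. (h m x - w x)\<^sup>2))"
    using sq_int_triangle[OF Fsq[of n] hsq test_function_sq_int[OF w(1)]] by simp
  also have "\<dots> < e" 
  proof -
    have "(LINT x|lborel. (f x - F n x)\<^sup>2) = (LINT x|lborel. (F n x - f x)\<^sup>2)"
      "(LINT x|lborel. (F n x - h m x)\<^sup>2) = (LINT x|lborel. (h m x - F n x)\<^sup>2)"
      by (intro Bochner_Integration.integral_cong refl power2_commute)+
    moreover have "2 * A + 2 * (2 * B + 2 * C) < e" if "A < e / 8" "B < e / 16" "C < e / 16" for A B C :: real
      using that \<open>e > 0\<close> by simp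
    ultimately show ?thesis using n m w(2) by presburger
  qed
  finally show ?thesis using w(1) by blast
qed


subsection \<open>Continuity of translations and weak derivatives\<close>

lemma sq_int_Cauchy_Schwarz:
  assumes "sq_int f" "sq_int g"
  shows "\<bar>LINT x|lborel. f x * g x\<bar> \<le> sqrt (LINT x|lborel. (f x)\<^sup>2) * sqrt (LINT x|lborel. (g x)\<^sup>2)"
proof -
  define a b c where "a = (LINT x|lborel. (f x)\<^sup>2)" and "b = (LINT x|lborel. f x * g x)" and "c = (LINT x|lborel. (g x)\<^sup>2)"
  note int = sq_int_integrable[OF assms(1)] sq_int_integrable[OF assms(2)] sq_int_mult_integrable[OF assms]
  have nonneg: "0 \<le> a + 2 * t * b + t\<^sup>2 * c" for t
  proof -
    have "0 \<le> (LINT x|lborel. (f x + t * g x)\<^sup>2)" by simp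
    also have "\<dots> = (LINT x|lborel. (f x)\<^sup>2 + (2 * t * (f x * g x) + t\<^sup>2 * (g x)\<^sup>2))"
      by (rule Bochner_Integration.integral_cong) (auto simp: power2_eq_square algebra_simps)
    also have "\<dots> = a + (2 * t * b + t\<^sup>2 * c)" unfolding a_def b_def c_def
      using int by (subst Bochner_Integration.integral_add; (intro Bochner_Integration.integrable_add)?; simp)+
    finally show ?thesis by simp
  qed
  have ac: "a \<ge> 0" "c \<ge> 0" by (auto simp: a_def c_def)
  have "b\<^sup>2 \<le> a * c"
  proof (cases "c = 0")
    case True
    have "b = 0"
    proof (rule ccontr)
      assume "b \<noteq> 0"
      \<comment> \<open>With \<open>c = 0\<close> the expression is linear in \<open>t\<close>, and
        at this \<open>t\<close> it equals \<open>-1\<close>.\<close>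
      then show False using nonneg[of "- (a + 1) / (2 * b)"] True by (simp add: field_simps)
    qed
    then show ?thesis using True by simp
  next
    case False
    have "0 \<le> a + 2 * (- b / c) * b + (- b / c)\<^sup>2 * c" by (rule nonneg)
    also have "\<dots> = a - b\<^sup>2 / c" using False by (simp add: power2_eq_square field_simps)
    finally show ?thesis using False ac by (simp add: field_simps)
  qed
  then have "sqrt (b\<^sup>2) \<le> sqrt (a * c)" by (rule real_sqrt_le_mono)
  then show ?thesis by (simp add: real_sqrt_mult a_def b_def c_def)
qed

text \<open>For \<open>w\<close> close to \<open>g\<close>, expand
  \<open>\<parallel>g\<parallel>\<^sup>2 = \<parallel>g - w\<parallel>\<^sup>2 + 2 <w, g> -
  \<parallel>w\<parallel>\<^sup>2\<close>; the assumption bounds the last two terms by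
  \<open>e\<close>. Estimates available only after pairing with test functions thus become norm
  bounds, with no supremum over unit vectors.\<close>

lemma sq_int_dual_bound:
  assumes g: "sq_int g"
    and bound: "\<And>w. test_function w \<Longrightarrow> 2 * (LINT x|lborel. w x * g x) \<le> (LINT x|lborel. (w x)\<^sup>2) + e"
  shows "(LINT x|lborel. (g x)\<^sup>2) \<le> e"
proof (rule field_le_epsilon)
  fix \<eta> :: real assume "\<eta> > 0"
  then obtain w where w: "test_function w" "(LINT x|lborel. (g x - w x)\<^sup>2) < \<eta>"
    using test_function_dense[OF g] by blast
  note ws = test_function_sq_int[OF w(1)]
  have "(LINT x|lborel. (g x - w x)\<^sup>2) = (LINT x|lborel. (g x)\<^sup>2 + ((w x)\<^sup>2 - 2 * (w x * g x)))"
    by (rule Bochner_Integration.integral_cong) (auto simp: power2_eq_square algebra_simps)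
  also have "\<dots> = (LINT x|lborel. (g x)\<^sup>2) + ((LINT x|lborel. (w x)\<^sup>2) - 2 * (LINT x|lborel. w x * g x))"
    using sq_int_integrable[OF g] sq_int_integrable[OF ws] sq_int_mult_integrable[OF ws g]
    by simp
  finally show "(LINT x|lborel. (g x)\<^sup>2) \<le> e + \<eta>" using bound[OF w(1)] w(2) by linarith
qed

lemma test_function_translate_L2:
  assumes w: "test_function (w :: 'a::euclidean_space \<Rightarrow> real)" and "e > 0"
  obtains \<delta> where "\<delta> > 0" "\<And>a. norm a < \<delta> \<Longrightarrow> (LINT x|lborel. (w (x + a) - w x)\<^sup>2) < e"
proof -
  obtain R where R: "R > 0" "\<And>x. norm x > R \<Longrightarrow> w x = 0" using test_function_support[OF w] by blast
  define V where "V = measure lborel (cball 0 (R + 1) :: 'a set)"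
  have V: "V \<ge> 0" by (simp add: V_def)
  define d where "d = sqrt (e / (V + 1))"
  have d: "d > 0" using \<open>e > 0\<close> V by (simp add: d_def)
  have "uniformly_continuous_on (cball 0 (R + 2)) w"
    using continuous_on_subset[OF smooth_continuous[OF test_function_smooth[OF w]]]
    by (intro compact_uniformly_continuous) auto
  then obtain \<delta> where \<delta>: "\<delta> > 0" "\<And>x y. x \<in> cball 0 (R + 2) \<Longrightarrow> y \<in> cball 0 (R + 2) \<Longrightarrow> dist y x < \<delta> \<Longrightarrow> dist (w y) (w x) < d"
    unfolding uniformly_continuous_on_def using d by metis
  have "(LINT x|lborel. (w (x + a) - w x)\<^sup>2) < e" if a: "norm a < min \<delta> 1" for a
  proof -
    have "(w (x + a) - w x)\<^sup>2 \<le> d\<^sup>2 * indicator (cball 0 (R + 1)) x" for x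
    proof (cases "norm x \<le> R + 1")
      case True
      then have "norm (x + a) \<le> R + 2" using a norm_triangle_ineq[of x a] by linarith
      then have "x \<in> cball 0 (R + 2)" "x + a \<in> cball 0 (R + 2)" using True by simp_all
      moreover have "dist (x + a) x < \<delta>" using a by (simp add: dist_norm)
      ultimately have "\<bar>w (x + a) - w x\<bar> < d" using \<delta>(2) by (metis dist_real_def)
      then have "\<bar>w (x + a) - w x\<bar>\<^sup>2 \<le> d\<^sup>2" by (intro power_mono) auto
      then show ?thesis using True by simp
    next
      case False
      have "norm (x + a) > R" using False a norm_diff_ineq[of x a] by linarith
      then show ?thesis using R(2)[of x] R(2)[of "x + a"] False by simp
    qed
    then have "(LINT x|lborel. (w (x + a) - w x)\<^sup>2) \<le> (LINT x|lborel. d\<^sup>2 * indicator (cball 0 (R + 1)) (x::'a))"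
      by (intro integral_mono integrable_mult_right integrable_indicator_cball sq_int_integrable sq_int_diff
        sq_int_translate test_function_sq_int w)
    also have "\<dots> = d\<^sup>2 * V" by (simp add: V_def)
    also have "\<dots> = e * (V / (V + 1))" unfolding d_def using V \<open>e > 0\<close> by simp
    also have "\<dots> < e * 1" using V \<open>e > 0\<close> by (intro mult_strict_left_mono) auto
    finally show ?thesis by simp
  qed
  then show ?thesis using that[of "min \<delta> 1"] \<delta>(1) by auto
qed

lemma sq_int_translate_continuous:
  assumes f: "sq_int (f :: 'a::euclidean_space \<Rightarrow> real)" and "e > 0"
  obtains \<delta> where "\<delta> > 0" "\<And>a. norm a < \<delta> \<Longrightarrow> (LINT x|lborel. (f (x + a) - f x)\<^sup>2) < e"
proof -
  have e16: "e / 16 > 0" using \<open>e > 0\<close> by simp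
  obtain w where w: "test_function w" "(LINT x|lborel. (f x - w x)\<^sup>2) < e / 16"
    using test_function_dense[OF f e16] by blast
  obtain \<delta> where \<delta>: "\<delta> > 0" "\<And>a. norm a < \<delta> \<Longrightarrow> (LINT x|lborel. (w (x + a) - w x)\<^sup>2) < e / 16"
    using test_function_translate_L2[OF w(1) e16] by blast
  note ws = test_function_sq_int[OF w(1)]
  have "(LINT x|lborel. (f (x + a) - f x)\<^sup>2) < e" if "norm a < \<delta>" for a
  proof -
    have "(LINT x|lborel. (f (x + a) - f x)\<^sup>2) \<le>
        2 * (LINT x|lborel. (f (x + a) - w (x + a))\<^sup>2) + 2 * (LINT x|lborel. (w (x + a) - f x)\<^sup>2)"
      by (intro sq_int_triangle sq_int_translate f ws)
    moreover have "(LINT x|lborel. (w (x + a) - f x)\<^sup>2) \<le>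
        2 * (LINT x|lborel. (w (x + a) - w x)\<^sup>2) + 2 * (LINT x|lborel. (w x - f x)\<^sup>2)"
      by (intro sq_int_triangle sq_int_translate f ws)
    moreover have "(LINT x|lborel. (f (x + a) - w (x + a))\<^sup>2) = (LINT x|lborel. (f x - w x)\<^sup>2)"
      using integral_translate[of "\<lambda>x. (f x - w x)\<^sup>2" a] sq_int_measurable[OF f] sq_int_measurable[OF ws] by measurable
    moreover have "(LINT x|lborel. (w x - f x)\<^sup>2) = (LINT x|lborel. (f x - w x)\<^sup>2)" by (simp add: power2_commute)
    ultimately show ?thesis using \<delta>(2)[OF that] w(2) \<open>e > 0\<close> by linarith
  qed
  then show ?thesis using that \<delta>(1) by blast
qed

section \<open>Weak derivatives and their difference quotients\<close>

definition weak_deriv :: "'a::euclidean_space \<Rightarrow> ('a \<Rightarrow> real) \<Rightarrow> ('a \<Rightarrow> real) \<Rightarrow> bool" where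
  "weak_deriv b f g \<longleftrightarrow> sq_int f \<and> sq_int g \<and> (\<forall>\<phi>. test_function \<phi> \<longrightarrow>
     (LINT x|lborel. frechet_derivative \<phi> (at x) b * f x) = - (LINT x|lborel. \<phi> x * g x))"

lemma weak_derivD: "weak_deriv b f g \<Longrightarrow> sq_int f" "weak_deriv b f g \<Longrightarrow> sq_int g"
  by (auto simp: weak_deriv_def)

lemma weak_deriv_translate:
  assumes b: "b \<in> Basis" and fg: "weak_deriv b f g"
  shows "weak_deriv b (\<lambda>x. f (x + a)) (\<lambda>x. g (x + a))"
  unfolding weak_deriv_def
proof (intro conjI allI impI)
  show "sq_int (\<lambda>x. f (x + a))" "sq_int (\<lambda>x. g (x + a))" using fg by (auto intro: sq_int_translate weak_derivD)
  fix \<phi> :: "'a \<Rightarrow> real" assume \<phi>: "test_function \<phi>"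
  define \<theta> where "\<theta> x = \<phi> (x + (- a))" for x
  have \<theta>: "test_function \<theta>" unfolding \<theta>_def using test_function_translate[OF \<phi>] .
  have d\<theta>: "frechet_derivative \<theta> (at x) b = frechet_derivative \<phi> (at (x - a)) b" for x
    unfolding \<theta>_def using test_function_partial_translate[OF \<phi>, of "- a"] by simp
  note [measurable] = sq_int_measurable[OF weak_derivD(1)[OF fg]] sq_int_measurable[OF weak_derivD(2)[OF fg]]
    sq_int_measurable[OF test_function_sq_int[OF \<theta>]] sq_int_measurable[OF test_function_sq_int[OF test_function_partial[OF \<theta> b]]]
  have m: "(\<lambda>x. frechet_derivative \<theta> (at x) b * f x) \<in> borel_measurable borel" "(\<lambda>x. \<theta> x * g x) \<in> borel_measurable borel"
    by measurable
  have "(LINT x|lborel. frechet_derivative \<phi> (at x) b * f (x + a)) = (LINT x|lborel. frechet_derivative \<theta> (at x) b * f x)"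
    using integral_translate[OF m(1), of a] by (simp add: d\<theta>)
  also have "\<dots> = - (LINT x|lborel. \<theta> x * g x)" using fg \<theta> by (simp add: weak_deriv_def)
  also have "(LINT x|lborel. \<theta> x * g x) = (LINT x|lborel. \<phi> x * g (x + a))"
    using integral_translate[OF m(2), of a] by (simp add: \<theta>_def)
  finally show "(LINT x|lborel. frechet_derivative \<phi> (at x) b * f (x + a)) = - (LINT x|lborel. \<phi> x * g (x + a))" .
qed

text \<open>The difference quotients fall on the smooth factor; for steps at most 1 they are bounded
  by \<open>M\<close> and supported in the ball of radius \<open>R + 1\<close>, which dominates them
  against \<open>v\<close>.\<close>

lemma test_function_pairing_deriv_0:
  assumes w: "test_function (w :: 'a::euclidean_space \<Rightarrow> real)" and b: "b \<in> Basis" and v: "sq_int v"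
  shows "((\<lambda>t. LINT x|lborel. w (x + t *\<^sub>R b) * v x) has_real_derivative
    (LINT x|lborel. frechet_derivative w (at x) b * v x)) (at 0)"
proof -
  define w' where "w' x = frechet_derivative w (at x) b" for x
  have tw': "test_function w'" unfolding w'_def using test_function_partial[OF w b] .
  obtain R where R: "R > 0" "\<And>x. norm x > R \<Longrightarrow> w x = 0" using test_function_support[OF w] by blast
  obtain R' where R': "\<And>x. norm x > R' \<Longrightarrow> w' x = 0" using test_function_support[OF tw'] by blast
  obtain M where M: "M > 0" "\<And>x. \<bar>w' x\<bar> \<le> M"
    using compact_support_bounded[OF smooth_continuous[OF test_function_smooth[OF tw']] R'] by blast
  have dw: "((\<lambda>t. w (x + t *\<^sub>R b)) has_real_derivative w' (x + t *\<^sub>R b)) (at t)" for x t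
    unfolding w'_def by (rule smooth_line_derivative[OF test_function_smooth[OF w]])
  have lip: "\<bar>w (x + h *\<^sub>R b) - w x\<bar> \<le> M * \<bar>h\<bar>" for x h
    using field_differentiable_bound[of UNIV "\<lambda>t. w (x + t *\<^sub>R b)" "\<lambda>t. w' (x + t *\<^sub>R b)" M h 0] dw M(2) by auto
  have bound: "\<bar>(w (x + h *\<^sub>R b) - w x) / h\<bar> \<le> M * indicator (cball 0 (R + 1)) x" if "h \<noteq> 0" "\<bar>h\<bar> \<le> 1" for x h
  proof (cases "norm x \<le> R + 1")
    case True then show ?thesis using lip[of x h] that by (simp add: field_simps)
  next
    case False
    have "norm (h *\<^sub>R b) \<le> 1" using that b by simp
    then have "norm (x + h *\<^sub>R b) > R" using False norm_diff_ineq[of x "h *\<^sub>R b"] by linarith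
    then show ?thesis using R(2)[of x] R(2)[of "x + h *\<^sub>R b"] False by simp
  qed
  define q where "q h x = (w (x + h *\<^sub>R b) - w x) / h * v x" for h x
  have "((\<lambda>h. LINT x|lborel. q h x) \<longlongrightarrow> (LINT x|lborel. w' x * v x)) (at 0)"
    unfolding tendsto_at_iff_sequentially
  proof (intro allI impI)
    fix X :: "nat \<Rightarrow> real" assume X: "\<forall>i. X i \<in> UNIV - {0}" "X \<longlonglongrightarrow> 0"
    have "eventually (\<lambda>i. \<bar>X i\<bar> < 1) sequentially"
      using order_tendstoD(2)[OF tendsto_rabs_zero[OF X(2)], of 1] by simp
    then obtain N where N: "\<And>i. i \<ge> N \<Longrightarrow> \<bar>X i\<bar> < 1" by (auto simp: eventually_sequentially)
    have "(\<lambda>i. LINT x|lborel. q (X (i + N)) x) \<longlonglongrightarrow> (LINT x|lborel. w' x * v x)"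
    proof (rule integral_dominated_convergence[where w="\<lambda>x. M * indicator (cball 0 (R + 1)) x * \<bar>v x\<bar>"])
      have "sq_int (\<lambda>x::'a. M * indicator (cball 0 (R + 1)) x)"
        by (rule compact_support_sq_int[of _ M "R + 1"]) (use M in \<open>auto simp: indicator_def\<close>)
      moreover have "sq_int (\<lambda>x. \<bar>v x\<bar>)" using v by (auto simp: sq_int_def)
      ultimately show "integrable lborel (\<lambda>x. M * indicator (cball 0 (R + 1)) x * \<bar>v x\<bar>)"
        by (rule sq_int_mult_integrable)
      show "AE x in lborel. (\<lambda>i. q (X (i + N)) x) \<longlonglongrightarrow> w' x * v x"
      proof (rule AE_I2)
        fix x
        have "((\<lambda>h. (w (x + h *\<^sub>R b) - w x) / h) \<longlongrightarrow> w' x) (at 0)"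
          using dw[of x 0] by (simp add: DERIV_def)
        then have "(\<lambda>i. (w (x + X i *\<^sub>R b) - w x) / X i) \<longlonglongrightarrow> w' x"
          using X unfolding tendsto_at_iff_sequentially comp_def by blast
        then show "(\<lambda>i. q (X (i + N)) x) \<longlonglongrightarrow> w' x * v x"
          unfolding q_def by (intro tendsto_mult_right) (rule LIMSEQ_ignore_initial_segment)
      qed
      show "AE x in lborel. norm (q (X (i + N)) x) \<le> M * indicator (cball 0 (R + 1)) x * \<bar>v x\<bar>" for i
        using bound[of "X (i + N)"] X(1) N[of "i + N"]
        by (intro AE_I2) (simp only: q_def abs_mult real_norm_def, intro mult_right_mono, auto simp: less_imp_le)
      have [measurable]: "w \<in> borel_measurable borel" "w' \<in> borel_measurable borel" "v \<in> borel_measurable borel"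
        using sq_int_measurable test_function_sq_int w tw' v by blast+
      show "(\<lambda>x. w' x * v x) \<in> borel_measurable lborel" "q (X (i + N)) \<in> borel_measurable lborel" for i
        unfolding q_def by measurable
    qed
    then show "((\<lambda>h. LINT x|lborel. q h x) \<circ> X) \<longlonglongrightarrow> (LINT x|lborel. w' x * v x)"
      unfolding comp_def by (rule LIMSEQ_offset)
  qed
  moreover have "(LINT x|lborel. q h x) = ((LINT x|lborel. w (x + (0 + h) *\<^sub>R b) * v x) - (LINT x|lborel. w (x + 0 *\<^sub>R b) * v x)) / h" for h
  proof -
    have "integrable lborel (\<lambda>x. w (x + h *\<^sub>R b) * v x)" "integrable lborel (\<lambda>x. w x * v x)"
      by (intro sq_int_mult_integrable sq_int_translate test_function_sq_int w v)+
    then show ?thesis unfolding q_def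
      by (simp add: left_diff_distrib diff_divide_distrib)
  qed
  ultimately show ?thesis unfolding DERIV_def w'_def by simp
qed

text \<open>A change of variables moves the translation to \<open>w\<close> with opposite sign; the
  derivative then falls on the test function and the weak derivative brings it back, cancelling the
  sign.\<close>

lemma weak_deriv_pairing_deriv:
  assumes w: "test_function w" and b: "b \<in> Basis" and v: "weak_deriv b v v'"
  shows "((\<lambda>t. LINT x|lborel. w x * v (x + t *\<^sub>R b)) has_real_derivative
    (LINT x|lborel. w x * v' (x + t *\<^sub>R b))) (at t)"
proof -
  define u where "u x = v (x + t *\<^sub>R b)" for x
  define u' where "u' x = v' (x + t *\<^sub>R b)" for x
  have u: "weak_deriv b u u'" unfolding u_def u'_def by (rule weak_deriv_translate[OF b v])
  note [measurable] = sq_int_measurable[OF weak_derivD(1)[OF u]] sq_int_measurable[OF test_function_sq_int[OF w]]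
  have eq: "(LINT x|lborel. w (x + (- k) *\<^sub>R b) * u x) = (LINT x|lborel. w x * v (x + (k + t) *\<^sub>R b))" for k
  proof -
    have "(\<lambda>x. w (x + (- k) *\<^sub>R b) * u x) \<in> borel_measurable borel" by measurable
    from integral_translate[OF this, of "k *\<^sub>R b"] show ?thesis by (simp add: u_def algebra_simps)
  qed
  define F where "F k = (LINT x|lborel. w (x + k *\<^sub>R b) * u x)" for k
  have Feq: "F (- k) = (LINT x|lborel. w x * v (x + (k + t) *\<^sub>R b))" for k
    unfolding F_def by (rule eq)
  have "(F has_real_derivative (LINT x|lborel. frechet_derivative w (at x) b * u x)) (at (- 0))"
    using test_function_pairing_deriv_0[OF w b weak_derivD(1)[OF u]] unfolding F_def by simp
  then have "((\<lambda>k. F (- k)) has_real_derivative - (LINT x|lborel. frechet_derivative w (at x) b * u x)) (at 0)"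
    by (subst (asm) DERIV_mirror)
  also have "- (LINT x|lborel. frechet_derivative w (at x) b * u x) = (LINT x|lborel. w x * u' x)"
    using u w by (simp add: weak_deriv_def)
  finally have "((\<lambda>k. LINT x|lborel. w x * v (x + (k + t) *\<^sub>R b)) has_real_derivative
      (LINT x|lborel. w x * v' (x + t *\<^sub>R b))) (at 0)"
    unfolding Feq u'_def .
  then show ?thesis
    using DERIV_shift[of "\<lambda>t. LINT x|lborel. w x * v (x + t *\<^sub>R b)" _ 0 t] by simp
qed

text \<open>Strong convergence by duality: against a fixed test function \<open>w\<close>, the mean
  value theorem turns the quotient into \<open>v'\<close> shifted by \<open>s\<close> times
  \<open>b\<close> for some \<open>s\<close> between 0 and \<open>h\<close>. The shift depends on
  \<open>w\<close>, but continuity of translations bounds the difference from \<open>v'\<close>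
  independently of it, so \<open>sq_int_dual_bound\<close> applies.\<close>

lemma weak_deriv_quotient:
  fixes v v' :: "'a::euclidean_space \<Rightarrow> real"
  assumes b: "b \<in> Basis" and v: "weak_deriv b v v'"
  shows "(\<lambda>n. LINT x|lborel. ((v (x + inverse (real (Suc n)) *\<^sub>R b) - v x) * real (Suc n) - v' x)\<^sup>2) \<longlonglongrightarrow> 0"
proof (rule LIMSEQ_I)
  fix e :: real assume "e > 0"
  note vs = weak_derivD[OF v]
  obtain \<delta> where \<delta>: "\<delta> > 0" "\<And>a. norm a < \<delta> \<Longrightarrow> (LINT x|lborel. (v' (x + a) - v' x)\<^sup>2) < e / 2"
    using sq_int_translate_continuous[OF vs(2) half_gt_zero[OF \<open>e > 0\<close>]] by blast
  obtain N where N: "inverse (real (Suc N)) < \<delta>" using reals_Archimedean[OF \<delta>(1)] by blast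
  show "\<exists>no. \<forall>n\<ge>no. norm ((LINT x|lborel. ((v (x + inverse (real (Suc n)) *\<^sub>R b) - v x) * real (Suc n) - v' x)\<^sup>2) - 0) < e"
  proof (intro exI allI impI)
    fix n assume "n \<ge> N"
    then have "inverse (real (Suc n)) \<le> inverse (real (Suc N))" by (intro le_imp_inverse_le) auto
    then have hd: "inverse (real (Suc n)) < \<delta>" using N by linarith
    define h where "h = inverse (real (Suc n))"
    have h: "h > 0" "real (Suc n) = 1 / h" by (auto simp: h_def inverse_eq_divide)
    define g where "g x = (v (x + h *\<^sub>R b) - v x) * (1 / h) - v' x" for x
    have gs: "sq_int g"
    proof -
      have "g = (\<lambda>x. 1 / h * (v (x + h *\<^sub>R b) - v x) - v' x)" by (auto simp: g_def)
      then show ?thesis by (simp only:) (intro sq_int_diff sq_int_cmult sq_int_translate vs)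
    qed
    have "(LINT x|lborel. (g x)\<^sup>2) \<le> e / 2"
    proof (rule sq_int_dual_bound[OF gs])
      fix w :: "'a \<Rightarrow> real" assume w: "test_function w"
      note ws = test_function_sq_int[OF w]
      define G where "G t = (LINT x|lborel. w x * v (x + t *\<^sub>R b))" for t
      obtain s where s: "0 < s" "s < h" "G h - G 0 = (h - 0) * (LINT x|lborel. w x * v' (x + s *\<^sub>R b))"
        using MVT2[OF h(1), of G "\<lambda>t. LINT x|lborel. w x * v' (x + t *\<^sub>R b)"]
          weak_deriv_pairing_deriv[OF w b v] unfolding G_def by blast
      have i: "integrable lborel (\<lambda>x. w x * v (x + t *\<^sub>R b))" "integrable lborel (\<lambda>x. w x * v' (x + t *\<^sub>R b))" for t
        by (intro sq_int_mult_integrable sq_int_translate vs ws)+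
      have i0: "integrable lborel (\<lambda>x. w x * v x)" "integrable lborel (\<lambda>x. w x * v' x)"
        by (intro sq_int_mult_integrable vs ws)+
      have "(LINT x|lborel. w x * g x) = (LINT x|lborel. (1 / h) * (w x * v (x + h *\<^sub>R b)) - (1 / h) * (w x * v x) - w x * v' x)"
        by (rule Bochner_Integration.integral_cong) (auto simp: g_def algebra_simps)
      also have "\<dots> = (1 / h) * (G h - G 0) - (LINT x|lborel. w x * v' x)"
        using i i0 h by (simp add: G_def right_diff_distrib)
      also have "\<dots> = (LINT x|lborel. w x * (v' (x + s *\<^sub>R b) - v' x))"
        using s(3) h i i0 by (simp add: right_diff_distrib)
      finally have "2 * (LINT x|lborel. w x * g x) = (LINT x|lborel. 2 * (w x * (v' (x + s *\<^sub>R b) - v' x)))" by simp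
      also have "\<dots> \<le> (LINT x|lborel. (w x)\<^sup>2 + (v' (x + s *\<^sub>R b) - v' x)\<^sup>2)"
        using sum_squares_bound[of "w _" "v' _ - v' _"]
        by (intro integral_mono Bochner_Integration.integrable_add integrable_mult_right sq_int_mult_integrable sq_int_integrable sq_int_diff
            sq_int_translate vs ws) (auto simp: mult.assoc)
      also have "\<dots> = (LINT x|lborel. (w x)\<^sup>2) + (LINT x|lborel. (v' (x + s *\<^sub>R b) - v' x)\<^sup>2)"
        by (intro Bochner_Integration.integral_add sq_int_integrable sq_int_diff sq_int_translate vs ws)
      also have "\<dots> \<le> (LINT x|lborel. (w x)\<^sup>2) + e / 2"
        using \<delta>(2)[of "s *\<^sub>R b"] s hd b by (simp add: h_def)
      finally show "2 * (LINT x|lborel. w x * g x) \<le> (LINT x|lborel. (w x)\<^sup>2) + e / 2" .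
    qed
    then show "norm ((LINT x|lborel. ((v (x + inverse (real (Suc n)) *\<^sub>R b) - v x) * real (Suc n) - v' x)\<^sup>2) - 0) < e"
      using \<open>e > 0\<close> unfolding g_def h_def[symmetric] h(2) by simp
  qed
qed

text \<open>Splitting \<open>f n\<close> and \<open>g n\<close> around their limits leaves the term
  in \<open>F\<close> and \<open>G\<close>, treated by dominated convergence since the weights
  converge only pointwise, and three terms with a factor tending to 0 in \<open>L\<^sup>2\<close>,
  treated by Cauchy-Schwarz.\<close>

lemma sq_int_pairing_tendsto:
  fixes f g :: "nat \<Rightarrow> 'a::euclidean_space \<Rightarrow> real"
  assumes f: "\<And>n. sq_int (f n)" "sq_int F" "(\<lambda>n. LINT x|lborel. (f n x - F x)\<^sup>2) \<longlonglongrightarrow> 0"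
    and g: "\<And>n. sq_int (g n)" "sq_int G" "(\<lambda>n. LINT x|lborel. (g n x - G x)\<^sup>2) \<longlonglongrightarrow> 0"
    and W: "\<And>n. W n \<in> borel_measurable borel" "\<And>n x. \<bar>W n x\<bar> \<le> C" "\<And>x. (\<lambda>n. W n x) \<longlonglongrightarrow> V x"
  shows "(\<lambda>n. LINT x|lborel. W n x * f n x * g n x) \<longlonglongrightarrow> (LINT x|lborel. V x * F x * G x)"
proof -
  have Wm [measurable]: "W n \<in> borel_measurable borel" for n by (rule W)
  have [measurable]: "V \<in> borel_measurable borel" by (rule borel_measurable_LIMSEQ_real[OF W(3) W(1)])
  note [measurable] = sq_int_measurable[OF f(2)] sq_int_measurable[OF g(2)]
  have C: "C \<ge> 0" using W(2)[of 0 0] by linarith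
  have small: "(\<lambda>n. LINT x|lborel. W n x * p n x * q n x) \<longlonglongrightarrow> 0"
    if p: "\<And>n. sq_int (p n)" "(\<lambda>n. LINT x|lborel. (p n x)\<^sup>2) \<longlonglongrightarrow> P"
      and q: "\<And>n. sq_int (q n)" "(\<lambda>n. LINT x|lborel. (q n x)\<^sup>2) \<longlonglongrightarrow> Q" and PQ: "P = 0 \<or> Q = 0"
    for p q :: "nat \<Rightarrow> 'a \<Rightarrow> real" and P Q
  proof (rule Lim_null_comparison)
    have "(\<lambda>n. C * sqrt (LINT x|lborel. (p n x)\<^sup>2) * sqrt (LINT x|lborel. (q n x)\<^sup>2)) \<longlonglongrightarrow> C * sqrt P * sqrt Q"
      by (intro tendsto_intros p q)
    then show "(\<lambda>n. C * sqrt (LINT x|lborel. (p n x)\<^sup>2) * sqrt (LINT x|lborel. (q n x)\<^sup>2)) \<longlonglongrightarrow> 0"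
      using PQ by auto
    show "\<forall>\<^sub>F n in sequentially. norm (LINT x|lborel. W n x * p n x * q n x) \<le>
        C * sqrt (LINT x|lborel. (p n x)\<^sup>2) * sqrt (LINT x|lborel. (q n x)\<^sup>2)"
    proof (intro always_eventually allI)
      fix n
      have Wp: "sq_int (\<lambda>x. W n x * p n x)" by (rule sq_int_bounded_mult[OF p(1) W(1,2)])
      have "(W n x * p n x)\<^sup>2 \<le> C\<^sup>2 * (p n x)\<^sup>2" for x
        using power_mono[OF W(2)[of n x], of 2] by (simp add: power_mult_distrib mult_right_mono)
      then have "(LINT x|lborel. (W n x * p n x)\<^sup>2) \<le> (LINT x|lborel. C\<^sup>2 * (p n x)\<^sup>2)"
        by (intro integral_mono sq_int_integrable Wp integrable_mult_right p)
      then have "sqrt (LINT x|lborel. (W n x * p n x)\<^sup>2) \<le> C * sqrt (LINT x|lborel. (p n x)\<^sup>2)"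
        using real_sqrt_le_mono C by (fastforce simp: real_sqrt_mult)
      then have "sqrt (LINT x|lborel. (W n x * p n x)\<^sup>2) * sqrt (LINT x|lborel. (q n x)\<^sup>2)
          \<le> C * sqrt (LINT x|lborel. (p n x)\<^sup>2) * sqrt (LINT x|lborel. (q n x)\<^sup>2)"
        by (intro mult_right_mono) auto
      from order_trans[OF sq_int_Cauchy_Schwarz[OF Wp q(1)] this]
      show "norm (LINT x|lborel. W n x * p n x * q n x) \<le>
          C * sqrt (LINT x|lborel. (p n x)\<^sup>2) * sqrt (LINT x|lborel. (q n x)\<^sup>2)" by simp
    qed
  qed
  have int: "integrable lborel (\<lambda>x. W n x * p x * q x)" if "sq_int p" "sq_int q" for n p q
    using sq_int_mult_integrable[OF sq_int_bounded_mult[OF that(1) W(1,2)] that(2)] .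
  have "(\<lambda>n. LINT x|lborel. W n x * F x * G x) \<longlonglongrightarrow> (LINT x|lborel. V x * F x * G x)"
  proof (rule integral_dominated_convergence[where w="\<lambda>x. C * \<bar>F x * G x\<bar>"])
    show "integrable lborel (\<lambda>x. C * \<bar>F x * G x\<bar>)"
      by (intro integrable_mult_right integrable_abs sq_int_mult_integrable f g)
    show "AE x in lborel. (\<lambda>n. W n x * F x * G x) \<longlonglongrightarrow> V x * F x * G x"
      by (intro AE_I2 tendsto_intros W)
    show "AE x in lborel. norm (W n x * F x * G x) \<le> C * \<bar>F x * G x\<bar>" for n
      using W(2) by (intro AE_I2) (auto simp: abs_mult mult.assoc intro!: mult_right_mono)
  qed measurable
  moreover have "(\<lambda>n. LINT x|lborel. W n x * F x * (g n x - G x)) \<longlonglongrightarrow> 0"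
    by (rule small[where P="LINT x|lborel. (F x)\<^sup>2" and Q=0]) (auto intro: f g sq_int_diff)
  moreover have "(\<lambda>n. LINT x|lborel. W n x * (f n x - F x) * G x) \<longlonglongrightarrow> 0"
    by (rule small[where Q="LINT x|lborel. (G x)\<^sup>2" and P=0]) (auto intro: f g sq_int_diff)
  moreover have "(\<lambda>n. LINT x|lborel. W n x * (f n x - F x) * (g n x - G x)) \<longlonglongrightarrow> 0"
    by (rule small[where Q=0 and P=0]) (auto intro: f g sq_int_diff)
  ultimately have "(\<lambda>n. (LINT x|lborel. W n x * F x * G x) + ((LINT x|lborel. W n x * F x * (g n x - G x)) +
      ((LINT x|lborel. W n x * (f n x - F x) * G x) + (LINT x|lborel. W n x * (f n x - F x) * (g n x - G x)))))
      \<longlonglongrightarrow> (LINT x|lborel. V x * F x * G x) + (0 + (0 + 0))"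
    by (intro tendsto_add)
  moreover have "(LINT x|lborel. W n x * F x * G x) + ((LINT x|lborel. W n x * F x * (g n x - G x)) +
      ((LINT x|lborel. W n x * (f n x - F x) * G x) + (LINT x|lborel. W n x * (f n x - F x) * (g n x - G x))))
      = (LINT x|lborel. W n x * f n x * g n x)" for n
  proof -
    have "(LINT x|lborel. W n x * f n x * g n x) = (LINT x|lborel. W n x * F x * G x + (W n x * F x * (g n x - G x) +
      (W n x * (f n x - F x) * G x + W n x * (f n x - F x) * (g n x - G x))))"
      by (rule Bochner_Integration.integral_cong) (auto simp: algebra_simps)
    also have "\<dots> = (LINT x|lborel. W n x * F x * G x) + ((LINT x|lborel. W n x * F x * (g n x - G x)) +
      ((LINT x|lborel. W n x * (f n x - F x) * G x) + (LINT x|lborel. W n x * (f n x - F x) * (g n x - G x))))"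
      using f g by (intro Bochner_Integration.integral_add[THEN trans] arg_cong2[where f="(+)"] refl
          Bochner_Integration.integrable_add int sq_int_diff)
    finally show ?thesis by simp
  qed
  ultimately show ?thesis by simp
qed

text \<open>Differentiability along one direction is all that integration by parts asks of a weight,
  and it reduces the rules for weights to one-variable calculus.\<close>

definition line_deriv :: "'a::euclidean_space \<Rightarrow> ('a \<Rightarrow> real) \<Rightarrow> ('a \<Rightarrow> real) \<Rightarrow> bool" where
  "line_deriv b f f' \<longleftrightarrow> (\<forall>x. ((\<lambda>t. f (x + t *\<^sub>R b)) has_real_derivative f' x) (at 0))"

lemma line_deriv_at:
  assumes "line_deriv b f f'"
  shows "((\<lambda>t. f (x + t *\<^sub>R b)) has_real_derivative f' (x + t *\<^sub>R b)) (at t)"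
proof -
  have "((\<lambda>s. f ((x + t *\<^sub>R b) + s *\<^sub>R b)) has_real_derivative f' (x + t *\<^sub>R b)) (at 0)"
    using assms unfolding line_deriv_def by blast
  then have "((\<lambda>s. f (x + (s + t) *\<^sub>R b)) has_real_derivative f' (x + t *\<^sub>R b)) (at 0)"
    by (simp add: scaleR_left_distrib add_ac)
  then show ?thesis using DERIV_shift[of "\<lambda>s. f (x + s *\<^sub>R b)" _ 0 t] by simp
qed

text \<open>Obtained as the limit of the identity expressing that the integral of a product of difference
  quotients is translation invariant.\<close>

theorem weak_deriv_by_parts:
  fixes u v W :: "'a::euclidean_space \<Rightarrow> real"
  assumes b: "b \<in> Basis" and u: "weak_deriv b u u'" and v: "weak_deriv b v v'"
    and W: "W \<in> borel_measurable borel" "\<And>x. \<bar>W x\<bar> \<le> C"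
    and W': "line_deriv b W W'" "\<And>x. \<bar>W' x\<bar> \<le> C'"
  shows "(LINT x|lborel. W x * u' x * v x) + (LINT x|lborel. W x * u x * v' x) + (LINT x|lborel. W' x * u x * v x) = 0"
proof -
  define h where "h n = inverse (real (Suc n))" for n
  define T where "T n f x = f (x + h n *\<^sub>R b)" for n and f :: "'a \<Rightarrow> real" and x
  define Q where "Q n f x = (T n f x - f x) * real (Suc n)" for n f x
  note [measurable] = W(1)
  note us = weak_derivD[OF u] and vs = weak_derivD[OF v]
  have h0: "h \<longlonglongrightarrow> 0" unfolding h_def[abs_def] by (rule LIMSEQ_inverse_real_of_nat)
  have hpos: "h n > 0" for n by (simp add: h_def)
  have hinv: "real (Suc n) = 1 / h n" for n by (simp add: h_def inverse_eq_divide)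
  have Ts: "sq_int (T n f)" if "sq_int f" for n f unfolding T_def using that by (rule sq_int_translate)
  have Qs: "sq_int (Q n f)" if "sq_int f" for n f
    using sq_int_cmult[OF sq_int_diff[OF Ts[OF that] that], of "real (Suc n)"] unfolding Q_def by (simp add: mult.commute)
  have TW [measurable]: "T n W \<in> borel_measurable borel" for n unfolding T_def by measurable
  have QW [measurable]: "Q n W \<in> borel_measurable borel" for n unfolding Q_def by measurable
  have QWb: "\<bar>Q n W x\<bar> \<le> C'" for n x
  proof -
    have "\<bar>T n W x - W x\<bar> \<le> C' * h n"
      using field_differentiable_bound[of UNIV "\<lambda>t. W (x + t *\<^sub>R b)" "\<lambda>t. W' (x + t *\<^sub>R b)" C' "h n" 0]
        line_deriv_at[OF W'(1)] W'(2) hpos[of n] by (auto simp: T_def)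
    then show ?thesis using hpos[of n] unfolding Q_def hinv by (simp add: abs_mult field_simps)
  qed
  have Tlim: "(\<lambda>n. LINT x|lborel. (T n f x - f x)\<^sup>2) \<longlonglongrightarrow> 0" if f: "sq_int f" for f
  proof (rule LIMSEQ_I)
    fix e :: real assume "e > 0"
    then obtain \<delta> where \<delta>: "\<delta> > 0" "\<And>a. norm a < \<delta> \<Longrightarrow> (LINT x|lborel. (f (x + a) - f x)\<^sup>2) < e"
      using sq_int_translate_continuous[OF f] by blast
    obtain N where N: "\<And>n. n \<ge> N \<Longrightarrow> norm (h n) < \<delta>" using LIMSEQ_D[OF h0 \<delta>(1)] by auto
    show "\<exists>no. \<forall>n\<ge>no. norm ((LINT x|lborel. (T n f x - f x)\<^sup>2) - 0) < e"
      using \<delta>(2)[of "h _ *\<^sub>R b"] N b by (intro exI[of _ N]) (auto simp: T_def)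
  qed
  have Qlim: "(\<lambda>n. LINT x|lborel. (Q n f x - f' x)\<^sup>2) \<longlonglongrightarrow> 0" if "weak_deriv b f f'" for f f'
    using weak_deriv_quotient[OF b that] unfolding Q_def T_def h_def .
  have const: "(\<lambda>n. LINT x|lborel. (f x - f x)\<^sup>2) \<longlonglongrightarrow> 0" for f :: "'a \<Rightarrow> real" by simp
  have TWlim: "(\<lambda>n. T n W x) \<longlonglongrightarrow> W x" for x
  proof -
    have "isCont (\<lambda>t. W (x + t *\<^sub>R b)) 0" using line_deriv_at[OF W'(1), of x 0] DERIV_isCont by blast
    from isCont_tendsto_compose[OF this h0] show ?thesis by (simp add: T_def)
  qed
  have QWlim: "(\<lambda>n. Q n W x) \<longlonglongrightarrow> W' x" for x
  proof -
    have "((\<lambda>t. (W (x + t *\<^sub>R b) - W x) / t) \<longlongrightarrow> W' x) (at 0)"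
      using line_deriv_at[OF W'(1), of x 0] by (simp add: DERIV_def)
    then have "(\<lambda>n. (W (x + h n *\<^sub>R b) - W x) / h n) \<longlonglongrightarrow> W' x"
      using h0 hpos unfolding tendsto_at_iff_sequentially comp_def by (metis DiffI UNIV_I less_irrefl singletonD)
    then show ?thesis unfolding Q_def T_def hinv by simp
  qed
  have "(\<lambda>n. LINT x|lborel. T n W x * Q n u x * v x) \<longlonglongrightarrow> (LINT x|lborel. W x * u' x * v x)"
    by (rule sq_int_pairing_tendsto[where C=C])
       (auto intro!: Qs us vs Qlim u const TWlim TW, auto simp: T_def W)
  moreover have "(\<lambda>n. LINT x|lborel. T n W x * T n u x * Q n v x) \<longlonglongrightarrow> (LINT x|lborel. W x * u x * v' x)"
    by (rule sq_int_pairing_tendsto[where C=C])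
       (auto intro!: Qs Ts us vs Qlim Tlim v const TWlim TW, auto simp: T_def W)
  moreover have "(\<lambda>n. LINT x|lborel. Q n W x * u x * v x) \<longlonglongrightarrow> (LINT x|lborel. W' x * u x * v x)"
    by (rule sq_int_pairing_tendsto[where C=C'])
       (auto intro!: us vs const QWlim QWb simp del: diff_self)
  ultimately have "(\<lambda>n. (LINT x|lborel. T n W x * Q n u x * v x) + (LINT x|lborel. T n W x * T n u x * Q n v x)
      + (LINT x|lborel. Q n W x * u x * v x)) \<longlonglongrightarrow>
     (LINT x|lborel. W x * u' x * v x) + (LINT x|lborel. W x * u x * v' x) + (LINT x|lborel. W' x * u x * v x)"
    by (intro tendsto_add)
  moreover have "(LINT x|lborel. T n W x * Q n u x * v x) + (LINT x|lborel. T n W x * T n u x * Q n v x)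
      + (LINT x|lborel. Q n W x * u x * v x) = 0" for n
  proof -
    define F where "F x = W x * u x * v x" for x
    have F: "integrable lborel F" unfolding F_def
      using sq_int_mult_integrable[OF sq_int_bounded_mult[OF us(1) W] vs(1)] .
    have i: "integrable lborel (\<lambda>x. T n W x * Q n u x * v x)" "integrable lborel (\<lambda>x. T n W x * T n u x * Q n v x)"
      "integrable lborel (\<lambda>x. Q n W x * u x * v x)"
      using sq_int_mult_integrable[OF sq_int_bounded_mult[OF Qs[OF us(1)] TW] vs(1)]
        sq_int_mult_integrable[OF sq_int_bounded_mult[OF Ts[OF us(1)] TW] Qs[OF vs(1)]]
        sq_int_mult_integrable[OF sq_int_bounded_mult[OF us(1) QW QWb] vs(1)] W(2)
      unfolding T_def by blast+
    have "(LINT x|lborel. T n W x * Q n u x * v x) + (LINT x|lborel. T n W x * T n u x * Q n v x)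
      + (LINT x|lborel. Q n W x * u x * v x) = (LINT x|lborel. T n W x * Q n u x * v x + T n W x * T n u x * Q n v x + Q n W x * u x * v x)"
      using i by simp
    \<comment> \<open>Discrete Leibniz rule: with the translation on the weight in the first product
      and on weight and \<open>u\<close> in the second, the terms telescope to the difference
      quotient of \<open>W u v\<close>.\<close>
    also have "\<dots> = (LINT x|lborel. real (Suc n) * (F (x + h n *\<^sub>R b) - F x))"
      by (rule Bochner_Integration.integral_cong) (auto simp: F_def Q_def T_def algebra_simps simp del: of_nat_Suc)
    also have "\<dots> = real (Suc n) * ((LINT x|lborel. F (x + h n *\<^sub>R b)) - (LINT x|lborel. F x))"
      using F integrable_translate[OF F] by simp
    also have "\<dots> = 0" using integral_translate[of F "h n *\<^sub>R b"] F by auto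
    finally show ?thesis .
  qed
  ultimately show ?thesis using LIMSEQ_unique[of "\<lambda>_. 0" 0] by (simp add: LIMSEQ_const_iff)
qed


subsection \<open>Reduction to real eigenfunctions\<close>

definition coulomb :: "real \<Rightarrow> (real^3)^'n::finite \<Rightarrow> real" where
  "coulomb Z x = (1/2) * (\<Sum>(k, l)\<in>{(k, l). k \<noteq> l}. 1 / norm (x $ k - x $ l)) - Z * (\<Sum>j\<in>UNIV. 1 / norm (x $ j))"

lemma L2_sq_int:
  assumes "f \<in> L2" "l = Re \<or> l = Im" shows "sq_int (\<lambda>x. l (f x))"
  unfolding sq_int_def
proof
  have [measurable]: "f \<in> borel_measurable borel" using assms by (simp add: L2_def)
  have lm [measurable]: "l \<in> borel_measurable borel" using assms(2) by auto
  show "(\<lambda>x. l (f x)) \<in> borel_measurable lborel" by measurable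
  have "(l z)\<^sup>2 \<le> (norm z)\<^sup>2" for z
    using assms(2) by (auto simp: cmod_power2)
  then have bd: "norm ((l (f x))\<^sup>2) \<le> norm ((norm (f x))\<^sup>2)" for x by simp
  show "integrable lborel (\<lambda>x. (l (f x))\<^sup>2)"
  proof (rule Bochner_Integration.integrable_bound)
    show "integrable lborel (\<lambda>x. (norm (f x))\<^sup>2)" using assms(1) by (simp add: L2_def)
  qed (use bd in simp_all)
qed

lemma test_function_L2_integrable:
  assumes "test_function \<phi>" "f \<in> L2" shows "integrable lborel (\<lambda>x. \<phi> x *\<^sub>R f x)"
proof -
  have fm [measurable]: "f \<in> borel_measurable borel" and fs: "sq_int (\<lambda>x. norm (f x))"
    using assms(2) by (auto simp: L2_def sq_int_def)
  have [measurable]: "\<phi> \<in> borel_measurable borel"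
    by (rule sq_int_measurable[OF test_function_sq_int[OF assms(1)]])
  show ?thesis
    by (rule Bochner_Integration.integrable_bound[OF sq_int_mult_integrable[OF test_function_sq_int[OF assms(1)] fs]])
       (auto simp: abs_mult)
qed

lemma has_weak_partial_weak_deriv:
  assumes "b \<in> Basis" "f \<in> L2" "g \<in> L2" "has_weak_partial b f g" "l = Re \<or> l = Im"
  shows "weak_deriv b (\<lambda>x. l (f x)) (\<lambda>x. l (g x))"
  unfolding weak_deriv_def
proof (intro conjI allI impI L2_sq_int assms)
  fix \<phi> :: "'a \<Rightarrow> real" assume \<phi>: "test_function \<phi>"
  have l: "bounded_linear l" using assms(5) bounded_linear_Re bounded_linear_Im by auto
  have pull: "(LINT x|lborel. \<theta> x * l (h x)) = l (LINT x|lborel. \<theta> x *\<^sub>R h x)"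
    if "test_function \<theta>" "h \<in> L2" for \<theta> :: "'a \<Rightarrow> real" and h
  proof -
    have "(LINT x|lborel. l (\<theta> x *\<^sub>R h x)) = l (LINT x|lborel. \<theta> x *\<^sub>R h x)"
      by (rule integral_bounded_linear[OF l test_function_L2_integrable[OF that]])
    then show ?thesis by (simp add: linear_scale[OF bounded_linear.linear[OF l]])
  qed
  show "(LINT x|lborel. frechet_derivative \<phi> (at x) b * l (f x)) = - (LINT x|lborel. \<phi> x * l (g x))"
    using assms(4) \<phi> by (simp add: pull test_function_partial[OF \<phi> assms(1)] assms(2,3) has_weak_partial_def
        linear_neg[OF bounded_linear.linear[OF l]])
qed

lemma weak_partial_exists:
  assumes "g \<in> L2" "has_weak_partial b f g"
  shows "weak_partial b f \<in> L2 \<and> has_weak_partial b f (weak_partial b f)"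
  unfolding weak_partial_def by (rule someI[of _ g]) (use assms in simp)

text \<open>\<open>H2\<close> provides second derivatives of some first derivative \<open>g\<close>,
  whereas the Hamiltonian uses the chosen \<open>weak_partial\<close>. Against a derivative of a
  test function both give the same pairing with \<open>f\<close>, so almost-everywhere uniqueness is
  not invoked.\<close>

lemma has_weak_partial_cong:
  assumes "b \<in> Basis" "c \<in> Basis" "has_weak_partial b f g" "has_weak_partial b f g'" "has_weak_partial c g h"
  shows "has_weak_partial c g' h"
  unfolding has_weak_partial_def
proof (intro allI impI)
  fix \<phi> :: "'a \<Rightarrow> real" assume \<phi>: "test_function \<phi>"
  note \<phi>' = test_function_partial[OF \<phi> assms(2)]
  have "(LINT x|lborel. frechet_derivative \<phi> (at x) c *\<^sub>R g' x) = (LINT x|lborel. frechet_derivative \<phi> (at x) c *\<^sub>R g x)"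
    using assms(3)[unfolded has_weak_partial_def, rule_format, OF \<phi>'] assms(4)[unfolded has_weak_partial_def, rule_format, OF \<phi>']
    by simp
  then show "(LINT x|lborel. frechet_derivative \<phi> (at x) c *\<^sub>R g' x) = - (LINT x|lborel. \<phi> x *\<^sub>R h x)"
    using assms(5) \<phi> by (simp add: has_weak_partial_def)
qed

text \<open>Both iterated derivatives unfold to pairings of \<open>f\<close> with second partials of
  the test function, and those commute.\<close>

lemma has_weak_partial_commute:
  assumes "b \<in> Basis" "c \<in> Basis" "has_weak_partial b f g" "has_weak_partial c f g'" "has_weak_partial c g h"
  shows "has_weak_partial b g' h"
  unfolding has_weak_partial_def
proof (intro allI impI)
  fix \<phi> :: "'a \<Rightarrow> real" assume \<phi>: "test_function \<phi>"
  note \<phi>b = test_function_partial[OF \<phi> assms(1)] and \<phi>c = test_function_partial[OF \<phi> assms(2)]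
  have "(LINT x|lborel. frechet_derivative \<phi> (at x) b *\<^sub>R g' x) =
      - (LINT x|lborel. frechet_derivative (\<lambda>y. frechet_derivative \<phi> (at y) b) (at x) c *\<^sub>R f x)"
    using assms(4)[unfolded has_weak_partial_def, rule_format, OF \<phi>b] by simp
  also have "\<dots> = - (LINT x|lborel. frechet_derivative (\<lambda>y. frechet_derivative \<phi> (at y) c) (at x) b *\<^sub>R f x)"
    using smooth_partial_commute[OF test_function_smooth[OF \<phi>] assms(1,2)] by simp
  also have "\<dots> = (LINT x|lborel. frechet_derivative \<phi> (at x) c *\<^sub>R g x)"
    using assms(3)[unfolded has_weak_partial_def, rule_format, OF \<phi>c] by simp
  also have "\<dots> = - (LINT x|lborel. \<phi> x *\<^sub>R h x)"
    using assms(5) \<phi> by (simp add: has_weak_partial_def)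
  finally show "(LINT x|lborel. frechet_derivative \<phi> (at x) b *\<^sub>R g' x) = - (LINT x|lborel. \<phi> x *\<^sub>R h x)" .
qed

lemma sum_Basis_vec:
  fixes F :: "('b::euclidean_space)^'n::finite \<Rightarrow> 'c::comm_monoid_add"
  shows "(\<Sum>c\<in>Basis. F c) = (\<Sum>j\<in>UNIV. \<Sum>b\<in>Basis. F (axis j b))"
proof -
  have inj: "inj_on (\<lambda>(j, b). axis j b :: 'b^'n) (UNIV \<times> Basis)"
    by (auto simp: inj_on_def axis_eq_axis nonzero_Basis)
  have "(Basis :: ('b^'n) set) = (\<lambda>(j, b). axis j b) ` (UNIV \<times> Basis)"
    by (auto simp: Basis_vec_def)
  then have "sum F Basis = (\<Sum>z\<in>UNIV \<times> Basis. F (case z of (j, b) \<Rightarrow> axis j b))"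
    using sum.reindex[OF inj, of F] by (simp only: comp_def)
  then show ?thesis by (simp add: sum.cartesian_product case_prod_unfold)
qed

lemma real_eigenfunction:
  assumes "is_eigenvalue H2 (hamiltonian Z :: ((real^3)^'n::finite \<Rightarrow> complex) \<Rightarrow> _) (complex_of_real E)"
  obtains f :: "(real^3)^'n \<Rightarrow> real" and p q where
    "\<not> (AE x in lborel. f x = 0)"
    "\<And>b. b \<in> Basis \<Longrightarrow> weak_deriv b f (p b)"
    "\<And>b c. b \<in> Basis \<Longrightarrow> c \<in> Basis \<Longrightarrow> weak_deriv c (p b) (q b c)"
    "\<And>b c. q b c = q c b"
    "AE x in lborel. coulomb Z x * f x = E * f x + (\<Sum>b\<in>Basis. q b b x)"
proof -
  obtain \<psi> :: "(real^3)^'n \<Rightarrow> complex" where \<psi>: "\<psi> \<in> H2" "\<not> (AE x in lborel. \<psi> x = 0)"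
    "AE x in lborel. hamiltonian Z \<psi> x = complex_of_real E * \<psi> x"
    using assms unfolding is_eigenvalue_def by blast
  have "\<not> (AE x in lborel. Re (\<psi> x) = 0) \<or> \<not> (AE x in lborel. Im (\<psi> x) = 0)"
  proof (rule ccontr)
    assume "\<not> ?thesis"
    then have "AE x in lborel. Re (\<psi> x) = 0" "AE x in lborel. Im (\<psi> x) = 0" by auto
    then have "AE x in lborel. \<psi> x = 0" by eventually_elim (simp add: complex_eq_iff)
    then show False using \<psi>(2) by blast
  qed
  then obtain l where l: "l = Re \<or> l = Im" "\<not> (AE x in lborel. l (\<psi> x) = 0)" by auto
  have \<psi>L2: "\<psi> \<in> L2" using \<psi>(1) by (simp add: H2_def)
  define P where "P b = weak_partial b \<psi>" for b
  \<comment> \<open>The condition is symmetric in \<open>b\<close> and \<open>c\<close>, so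
    \<open>Q b c = Q c b\<close> holds literally and not just almost everywhere. For
    \<open>b = c\<close> it collapses to the condition behind \<open>weak_partial\<close>, so the
    diagonal is the very function occurring in the Hamiltonian.\<close>
  define Q where "Q b c = (SOME h. h \<in> L2 \<and> has_weak_partial c (P b) h \<and> has_weak_partial b (P c) h)" for b c
  have P: "P b \<in> L2" "has_weak_partial b \<psi> (P b)" if "b \<in> Basis" for b
    using weak_partial_exists \<psi>(1) that unfolding P_def H2_def by blast+
  have Q: "Q b c \<in> L2 \<and> has_weak_partial c (P b) (Q b c) \<and> has_weak_partial b (P c) (Q b c)"
    if bc: "b \<in> Basis" "c \<in> Basis" for b c
  proof -
    obtain g h where gh: "has_weak_partial b \<psi> g" "h \<in> L2" "has_weak_partial c g h"
      using \<psi>(1) bc unfolding H2_def by blast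
    have 1: "has_weak_partial c (P b) h"
      by (rule has_weak_partial_cong[OF bc gh(1) P(2)[OF bc(1)] gh(3)])
    have "has_weak_partial b (P c) h"
      by (rule has_weak_partial_commute[OF bc P(2)[OF bc(1)] P(2)[OF bc(2)] 1])
    then show ?thesis unfolding Q_def using someI_ex[of "\<lambda>h. h \<in> L2 \<and> has_weak_partial c (P b) h \<and> has_weak_partial b (P c) h"] gh(2) 1 by blast
  qed
  have Qdiag: "Q b b = weak_partial b (weak_partial b \<psi>)" for b
    by (simp add: Q_def weak_partial_def[of b "P b"] P_def[symmetric])
  have "AE x in lborel. coulomb Z x * l (\<psi> x) = E * l (\<psi> x) + (\<Sum>b\<in>Basis. l (Q b b x))"
    using \<psi>(3)
  proof eventually_elim
    case (elim x)
    have lin: "l (u + v) = l u + l v" "l (u - v) = l u - l v" "l (- u) = - l u" "l (r *\<^sub>R u) = r * l u" "l (complex_of_real r * u) = r * l u"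
      "l 0 = 0" for u v r
      using l(1) by auto
    have lsum: "l (sum F I) = (\<Sum>i\<in>I. l (F i))" for F :: "'z \<Rightarrow> complex" and I
      by (induction I rule: infinite_finite_induct) (auto simp: lin)
    have "E * l (\<psi> x) = l (hamiltonian Z \<psi> x)" using elim by (simp add: lin)
    also have "\<dots> = (\<Sum>j\<in>UNIV. - (\<Sum>b\<in>Basis. l (Q (axis j b) (axis j b) x)) - (Z / norm (x $ j)) * l (\<psi> x))
        + (1/2) * (\<Sum>(k, i)\<in>{(k, i). k \<noteq> i}. (1 / norm (x $ k - x $ i)) * l (\<psi> x))"
      by (simp add: hamiltonian_def particle_laplacian_def lin lsum Qdiag case_prod_unfold)
    also have "\<dots> = coulomb Z x * l (\<psi> x) - (\<Sum>b\<in>Basis. l (Q b b x))"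
      unfolding sum_Basis_vec coulomb_def
      by (simp add: sum_subtractf sum_negf sum_distrib_left sum_distrib_right left_diff_distrib case_prod_unfold)
    finally show ?case by simp
  qed
  moreover have "weak_deriv b (\<lambda>x. l (\<psi> x)) (\<lambda>x. l (P b x))" if "b \<in> Basis" for b
    by (rule has_weak_partial_weak_deriv[OF that \<psi>L2 P[OF that] l(1)])
  moreover have "weak_deriv c (\<lambda>x. l (P b x)) (\<lambda>x. l (Q b c x))" if "b \<in> Basis" "c \<in> Basis" for b c
    using has_weak_partial_weak_deriv[OF that(2) P(1)[OF that(1)] _ _ l(1)] Q[OF that] by blast
  moreover have "Q b c = Q c b" for b c unfolding Q_def by (simp add: conj_commute)
  ultimately show thesis using l(2) that[of "\<lambda>x. l (\<psi> x)" "\<lambda>b x. l (P b x)" "\<lambda>b c x. l (Q b c x)"] by simp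
qed


subsection \<open>Bounded continuous weights\<close>

lemma line_derivD: "line_deriv b f f' \<Longrightarrow> ((\<lambda>t. f (x + t *\<^sub>R b)) has_real_derivative f' x) (at 0)"
  by (simp add: line_deriv_def)

lemma line_deriv_const: "line_deriv b (\<lambda>x. c) (\<lambda>x. 0)"
  by (simp add: line_deriv_def)

lemma line_deriv_add: "line_deriv b f f' \<Longrightarrow> line_deriv b g g' \<Longrightarrow> line_deriv b (\<lambda>x. f x + g x) (\<lambda>x. f' x + g' x)"
  unfolding line_deriv_def by (auto intro!: DERIV_add)

lemma line_deriv_mult:
  "line_deriv b f f' \<Longrightarrow> line_deriv b g g' \<Longrightarrow> line_deriv b (\<lambda>x. f x * g x) (\<lambda>x. f' x * g x + f x * g' x)"
  unfolding line_deriv_def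
proof
  fix x
  assume "\<forall>x. ((\<lambda>t. f (x + t *\<^sub>R b)) has_real_derivative f' x) (at 0)" "\<forall>x. ((\<lambda>t. g (x + t *\<^sub>R b)) has_real_derivative g' x) (at 0)"
  then show "((\<lambda>t. f (x + t *\<^sub>R b) * g (x + t *\<^sub>R b)) has_real_derivative f' x * g x + f x * g' x) (at 0)"
    using DERIV_mult[of "\<lambda>t. f (x + t *\<^sub>R b)" "f' x" 0 UNIV "\<lambda>t. g (x + t *\<^sub>R b)" "g' x"] by (simp add: mult.commute)
qed

lemma line_deriv_compose:
  assumes "line_deriv b f f'" "\<And>x. (F has_real_derivative F' x) (at (f x))"
  shows "line_deriv b (\<lambda>x. F (f x)) (\<lambda>x. F' x * f' x)"
  unfolding line_deriv_def
proof
  fix x show "((\<lambda>t. F (f (x + t *\<^sub>R b))) has_real_derivative F' x * f' x) (at 0)"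
    using DERIV_chain2[OF _ line_derivD[OF assms(1), of x], of F "F' x"] assms(2)[of x] by simp
qed

lemma line_deriv_eq: "line_deriv b f f' \<Longrightarrow> (\<And>x. f' x = g' x) \<Longrightarrow> line_deriv b f g'"
  by (simp add: line_deriv_def)

text \<open>Closed under ring operations, so the boundedness and measurability conditions for the
  explicit weights below follow from their syntax.\<close>

definition bounded_cont :: "('a::euclidean_space \<Rightarrow> real) \<Rightarrow> bool" where
  "bounded_cont f \<longleftrightarrow> continuous_on UNIV f \<and> (\<exists>C. \<forall>x. \<bar>f x\<bar> \<le> C)"

lemma bounded_contI: "continuous_on UNIV f \<Longrightarrow> (\<And>x. \<bar>f x\<bar> \<le> C) \<Longrightarrow> bounded_cont f"
  by (auto simp: bounded_cont_def)

lemma bounded_cont_const: "bounded_cont (\<lambda>x. c)"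
  by (rule bounded_contI[of _ "\<bar>c\<bar>"]) auto

lemma bounded_cont_add: "bounded_cont f \<Longrightarrow> bounded_cont g \<Longrightarrow> bounded_cont (\<lambda>x. f x + g x)"
  unfolding bounded_cont_def
proof (elim conjE exE, intro conjI)
  fix C D assume "\<forall>x. \<bar>f x\<bar> \<le> C" "\<forall>x. \<bar>g x\<bar> \<le> D"
  then show "\<exists>C. \<forall>x. \<bar>f x + g x\<bar> \<le> C"
    by (intro exI[of _ "C + D"]) (meson abs_triangle_ineq add_mono order_trans)
qed (auto intro: continuous_on_add)

lemma bounded_cont_mult: "bounded_cont f \<Longrightarrow> bounded_cont g \<Longrightarrow> bounded_cont (\<lambda>x. f x * g x)"
  unfolding bounded_cont_def
proof (elim conjE exE, intro conjI)
  fix C D assume C: "\<forall>x. \<bar>f x\<bar> \<le> C" "\<forall>x. \<bar>g x\<bar> \<le> D"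
  have "C \<ge> 0" using C(1)[rule_format, of 0] by linarith
  then show "\<exists>C. \<forall>x. \<bar>f x * g x\<bar> \<le> C"
    using C by (intro exI[of _ "C * D"]) (simp add: abs_mult mult_mono)
qed (auto intro: continuous_on_mult)

lemma bounded_cont_minus: "bounded_cont f \<Longrightarrow> bounded_cont (\<lambda>x. - f x)"
  using bounded_cont_mult[OF bounded_cont_const[of "-1"], of f] by simp

lemma bounded_cont_diff: "bounded_cont f \<Longrightarrow> bounded_cont g \<Longrightarrow> bounded_cont (\<lambda>x. f x - g x)"
  using bounded_cont_add[OF _ bounded_cont_minus, of f g] by simp

lemma bounded_cont_power: "bounded_cont f \<Longrightarrow> bounded_cont (\<lambda>x. f x ^ n)"
  by (induction n) (auto intro: bounded_cont_const bounded_cont_mult)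

lemma bounded_cont_sum: "(\<And>i. i \<in> I \<Longrightarrow> bounded_cont (f i)) \<Longrightarrow> bounded_cont (\<lambda>x. \<Sum>i\<in>I. f i x)"
  by (induction I rule: infinite_finite_induct) (auto intro: bounded_cont_const bounded_cont_add)

lemmas bounded_cont_intros = bounded_cont_const bounded_cont_add bounded_cont_mult bounded_cont_minus
  bounded_cont_diff bounded_cont_power bounded_cont_sum

lemma bounded_cont_sq_int: "bounded_cont W \<Longrightarrow> sq_int f \<Longrightarrow> sq_int (\<lambda>x. W x * f x)"
  unfolding bounded_cont_def using sq_int_bounded_mult borel_measurable_continuous_onI by blast

lemma bounded_cont_integrable:
  "bounded_cont W \<Longrightarrow> sq_int f \<Longrightarrow> sq_int g \<Longrightarrow> integrable lborel (\<lambda>x. W x * f x * g x)"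
  by (rule sq_int_mult_integrable[OF bounded_cont_sq_int])

lemma bounded_cont_by_parts:
  assumes "b \<in> Basis" "weak_deriv b u u'" "weak_deriv b v v'" "bounded_cont W" "bounded_cont W'" "line_deriv b W W'"
  shows "(LINT x|lborel. W x * u' x * v x) + (LINT x|lborel. W x * u x * v' x) + (LINT x|lborel. W' x * u x * v x) = 0"
proof -
  obtain C C' where "\<And>x. \<bar>W x\<bar> \<le> C" "\<And>x. \<bar>W' x\<bar> \<le> C'" using assms(4,5) unfolding bounded_cont_def by blast
  moreover have "W \<in> borel_measurable borel"
    using assms(4) borel_measurable_continuous_onI unfolding bounded_cont_def by blast
  ultimately show ?thesis using weak_deriv_by_parts[OF assms(1-3) _ _ assms(6)] by blast
qed

text \<open>Moving one \<open>b\<close> derivative off \<open>fbb\<close> produces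
  \<open>X fb fab\<close>, which is half an \<open>a\<close> derivative of \<open>fb\<^sup>2\<close>
  and so turns into \<open>Xa fb\<^sup>2\<close>. The divergence part of the multiplier produces the
  same term with opposite sign; its weight is chosen for this cancellation.\<close>

lemma kinetic_by_parts:
  assumes a: "a \<in> Basis" and b: "b \<in> Basis"
    and f: "weak_deriv a f fa" "weak_deriv b f fb"
    and fa: "weak_deriv b fa fab" and fb: "weak_deriv a fb fab" "weak_deriv b fb fbb"
    and X: "bounded_cont X" "bounded_cont Xa" "bounded_cont Xb" "bounded_cont Xab"
      "line_deriv a X Xa" "line_deriv b X Xb" "line_deriv b Xa Xab"
  shows "- 2 * (LINT x|lborel. X x * fbb x * fa x) - (LINT x|lborel. Xa x * fbb x * f x)
    = 2 * (LINT x|lborel. Xb x * fb x * fa x) + (LINT x|lborel. Xab x * fb x * f x)"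
proof -
  have 1: "(LINT x|lborel. X x * fbb x * fa x) + (LINT x|lborel. X x * fb x * fab x) + (LINT x|lborel. Xb x * fb x * fa x) = 0"
    by (rule bounded_cont_by_parts[OF b fb(2) fa X(1,3,6)])
  have 2: "(LINT x|lborel. X x * fab x * fb x) + (LINT x|lborel. X x * fb x * fab x) + (LINT x|lborel. Xa x * fb x * fb x) = 0"
    by (rule bounded_cont_by_parts[OF a fb(1) fb(1) X(1,2,5)])
  have 3: "(LINT x|lborel. Xa x * fbb x * f x) + (LINT x|lborel. Xa x * fb x * fb x) + (LINT x|lborel. Xab x * fb x * f x) = 0"
    by (rule bounded_cont_by_parts[OF b fb(2) f(2) X(2,4,7)])
  have "(LINT x|lborel. X x * fab x * fb x) = (LINT x|lborel. X x * fb x * fab x)"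
    by (rule Bochner_Integration.integral_cong) auto
  then show ?thesis using 1 2 3 by linarith
qed

subsection \<open>Regularised distances\<close>

definition dir :: "'n::finite \<Rightarrow> 3 \<Rightarrow> (real^3)^'n" where
  "dir j i = axis j (axis i 1)"

lemma dir_Basis: "dir j i \<in> Basis"
  by (auto simp: dir_def Basis_vec_def)

lemma sum_Basis_dir:
  fixes F :: "(real^3)^'n::finite \<Rightarrow> 'c::comm_monoid_add"
  shows "(\<Sum>c\<in>Basis. F c) = (\<Sum>j\<in>UNIV. \<Sum>i\<in>UNIV. F (dir j i))"
proof -
  have "(\<Sum>b\<in>Basis. G b) = (\<Sum>i\<in>UNIV. G (axis i (1::real)))" for G :: "real^3 \<Rightarrow> 'c"
    using sum_Basis_vec[where F="G"] by simp
  then show ?thesis by (simp add: sum_Basis_vec dir_def)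
qed

text \<open>The maps \<open>rel c\<close> cover both \<open>x\<^sub>j\<close> and \<open>x\<^sub>k - x\<^sub>l\<close>, so that the Hardy inequality and the two kinds of
  Coulomb terms can be treated uniformly.\<close>

definition rel :: "('n::finite \<Rightarrow> real) \<Rightarrow> (real^3)^'n \<Rightarrow> real^3" where
  "rel c x = (\<Sum>j\<in>UNIV. c j *\<^sub>R x $ j)"

lemma rel_dir: "rel c (dir j i) = c j *\<^sub>R axis i 1"
proof -
  have "rel c (dir j i) = (\<Sum>k\<in>UNIV. if k = j then c k *\<^sub>R axis i 1 else 0)"
    unfolding rel_def dir_def by (rule sum.cong) (auto simp: axis_def vec_eq_iff)
  then show ?thesis by simp
qed

lemma bounded_linear_rel: "bounded_linear (rel c)"
  unfolding rel_def
  by (intro bounded_linear_sum bounded_linear_scaleR_right[THEN bounded_linear_compose] bounded_linear_vec_nth)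

lemma continuous_on_rel [continuous_intros]: "continuous_on S (rel c)"
  by (rule linear_continuous_on[OF bounded_linear_rel])

lemma line_deriv_rel: "line_deriv (dir j i) (\<lambda>x. rel c x $ m) (\<lambda>x. if m = i then c j else 0)"
proof -
  have "rel c (x + t *\<^sub>R dir j i) $ m = rel c x $ m + t * (if m = i then c j else 0)" for x t
    using linear_add[OF bounded_linear.linear[OF bounded_linear_rel], of c x "t *\<^sub>R dir j i"]
      linear_scale[OF bounded_linear.linear[OF bounded_linear_rel], of c t "dir j i"]
    by (auto simp: rel_dir axis_def)
  then show ?thesis unfolding line_deriv_def by (auto intro!: derivative_eq_intros)
qed

text \<open>The reciprocal \<open>1 / s\<close> of a regularised distance \<open>s\<close>; with
  \<open>y = rel c x\<close>, \<open>nrel\<close> is \<open>y / s\<close>, a smoothed unit vector.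
  Derivatives of both are polynomials in both, so later differentiation is algebra and the weights
  stay bounded.\<close>

definition isg :: "real \<Rightarrow> ('n::finite \<Rightarrow> real) \<Rightarrow> (real^3)^'n \<Rightarrow> real" where
  "isg \<eta> c x = 1 / sqrt ((norm (rel c x))\<^sup>2 + \<eta>\<^sup>2)"

definition nrel :: "real \<Rightarrow> ('n::finite \<Rightarrow> real) \<Rightarrow> 3 \<Rightarrow> (real^3)^'n \<Rightarrow> real" where
  "nrel \<eta> c i x = rel c x $ i * isg \<eta> c x"

lemma norm3: "(norm (y::real^3))\<^sup>2 = (\<Sum>i\<in>UNIV. (y $ i)\<^sup>2)"
  unfolding power2_norm_eq_inner inner_vec_def by (simp add: power2_eq_square)

lemma reg_pos: "\<eta> > 0 \<Longrightarrow> (norm y)\<^sup>2 + (\<eta>::real)\<^sup>2 > 0"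
  by (intro add_nonneg_pos) auto

lemma isg_pos: "\<eta> > 0 \<Longrightarrow> isg \<eta> c x > 0"
  using reg_pos[of \<eta> "rel c x"] by (simp add: isg_def)

lemma isg_le: assumes "\<eta> > 0" shows "\<eta> * isg \<eta> c x \<le> 1"
proof -
  have "\<eta> \<le> sqrt ((norm (rel c x))\<^sup>2 + \<eta>\<^sup>2)" using assms by (intro real_le_rsqrt) auto
  then show ?thesis using assms reg_pos[of \<eta> "rel c x"] by (simp add: isg_def divide_le_eq_1)
qed

lemma isg_square: "\<eta> > 0 \<Longrightarrow> (isg \<eta> c x)\<^sup>2 * ((norm (rel c x))\<^sup>2 + \<eta>\<^sup>2) = 1"
  using reg_pos[of \<eta> "rel c x"] by (simp add: isg_def power_divide)

text \<open>The defect from unit length recorded here is one source of the error terms in the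
  kinetic estimate.\<close>

lemma sum_nrel_square: assumes "\<eta> > 0" shows "(\<Sum>i\<in>UNIV. (nrel \<eta> c i x)\<^sup>2) = 1 - \<eta>\<^sup>2 * (isg \<eta> c x)\<^sup>2"
proof -
  have "(\<Sum>i\<in>UNIV. (nrel \<eta> c i x)\<^sup>2) = (isg \<eta> c x)\<^sup>2 * (norm (rel c x))\<^sup>2"
    by (simp add: nrel_def norm3 power_mult_distrib sum_distrib_left mult.commute)
  then show ?thesis using isg_square[OF assms, of c x] by (simp add: algebra_simps)
qed

lemma nrel_le: assumes "\<eta> > 0" shows "\<bar>nrel \<eta> c i x\<bar> \<le> 1"
proof -
  have "(nrel \<eta> c i x)\<^sup>2 \<le> (\<Sum>i\<in>UNIV. (nrel \<eta> c i x)\<^sup>2)" by (rule member_le_sum) auto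
  also have "\<dots> \<le> 1" using assms by (simp add: sum_nrel_square)
  finally show ?thesis by (simp add: abs_square_le_1)
qed

lemma isg_bounded_cont: assumes "\<eta> > 0" shows "bounded_cont (isg \<eta> c)"
proof (rule bounded_contI)
  show "continuous_on UNIV (isg \<eta> c)" unfolding isg_def
  proof (intro continuous_intros ballI)
    fix x show "sqrt ((norm (rel c x))\<^sup>2 + \<eta>\<^sup>2) \<noteq> 0"
      using real_sqrt_gt_zero[OF reg_pos[OF assms, of "rel c x"]] by linarith
  qed
  show "\<bar>isg \<eta> c x\<bar> \<le> 1 / \<eta>" for x
    using isg_le[OF assms, of c x] isg_pos[OF assms, of c x] assms by (simp add: field_simps)
qed

lemma nrel_bounded_cont: assumes "\<eta> > 0" shows "bounded_cont (nrel \<eta> c i)"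
proof (rule bounded_contI)
  show "continuous_on UNIV (nrel \<eta> c i)" unfolding nrel_def
    using isg_bounded_cont[OF assms, of c] by (intro continuous_intros) (auto simp: bounded_cont_def)
qed (rule nrel_le[OF assms])

lemma isg_line_deriv:
  assumes "\<eta> > 0" shows "line_deriv (dir j m) (isg \<eta> c) (\<lambda>x. - (c j * (isg \<eta> c x)\<^sup>2 * nrel \<eta> c m x))"
proof -
  have "line_deriv (dir j m) (\<lambda>x. (norm (rel c x))\<^sup>2) (\<lambda>x. 2 * c j * rel c x $ m)"
  proof -
    have "line_deriv (dir j m) (\<lambda>x. rel c x $ 1 * rel c x $ 1 + (rel c x $ 2 * rel c x $ 2 + rel c x $ 3 * rel c x $ 3))
      (\<lambda>x. 2 * c j * rel c x $ m)"
      by (rule line_deriv_eq[OF line_deriv_add[OF line_deriv_mult[OF line_deriv_rel line_deriv_rel]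
         line_deriv_add[OF line_deriv_mult[OF line_deriv_rel line_deriv_rel] line_deriv_mult[OF line_deriv_rel line_deriv_rel]]]])
         (use exhaust_3[of m] in auto)
    then show ?thesis unfolding norm3 sum_3 unfolding power2_eq_square add.assoc .
  qed
  then have "line_deriv (dir j m) (isg \<eta> c) (\<lambda>x. - ((isg \<eta> c x) ^ 3 / 2) * (2 * c j * rel c x $ m))"
    unfolding isg_def
  proof (rule line_deriv_compose)
    fix x
    have p: "(norm (rel c x))\<^sup>2 + \<eta>\<^sup>2 > 0" by (rule reg_pos[OF assms])
    show "((\<lambda>v. 1 / sqrt (v + \<eta>\<^sup>2)) has_real_derivative - ((1 / sqrt ((norm (rel c x))\<^sup>2 + \<eta>\<^sup>2)) ^ 3 / 2)) (at ((norm (rel c x))\<^sup>2))"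
      using p by (auto intro!: derivative_eq_intros simp: field_simps power3_eq_cube)
  qed
  then show ?thesis
    by (rule line_deriv_eq) (simp add: nrel_def power3_eq_cube power2_eq_square)
qed

lemma nrel_line_deriv:
  assumes "\<eta> > 0"
  shows "line_deriv (dir j m) (nrel \<eta> c i)
    (\<lambda>x. c j * isg \<eta> c x * ((if i = m then 1 else 0) - nrel \<eta> c i x * nrel \<eta> c m x))"
  unfolding nrel_def
  by (rule line_deriv_eq[OF line_deriv_mult[OF line_deriv_rel isg_line_deriv[OF assms]]])
     (auto simp: nrel_def algebra_simps power2_eq_square)


subsection \<open>The kinetic estimate\<close>

text \<open>Contracts the derivatives of the field with the gradient \<open>P\<close>; apart from
  \<open>\<bar>P\<bar>\<^sup>2\<close>, only its component along \<open>u\<close> survives. The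
  coefficients are those of \<open>DXreg\<close> and \<open>DDXreg\<close>, and the factor 3 is the
  dimension.\<close>

lemma inner3_expand:
  fixes u P :: "3 \<Rightarrow> real"
  shows "(\<Sum>m\<in>UNIV. \<Sum>i\<in>UNIV. 2 * ((if i = m then a else 0) + b * u i * u m) * P m * P i
      + (c * u m + d * (u i)\<^sup>2 * u m + (if i = m then e * u i else 0)) * P m * y)
    = 2 * a * (\<Sum>i\<in>UNIV. (P i)\<^sup>2) + 2 * b * (\<Sum>i\<in>UNIV. u i * P i)\<^sup>2
      + (3 * c + d * (\<Sum>i\<in>UNIV. (u i)\<^sup>2) + e) * (\<Sum>i\<in>UNIV. u i * P i) * y"
  by (simp add: sum_3 power2_eq_square algebra_simps)

lemma Cauchy_Schwarz3:
  fixes u P :: "3 \<Rightarrow> real"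
  shows "(\<Sum>i\<in>UNIV. u i * P i)\<^sup>2 \<le> (\<Sum>i\<in>UNIV. (u i)\<^sup>2) * (\<Sum>i\<in>UNIV. (P i)\<^sup>2)"
  by (rule Cauchy_Schwarz_ineq_sum)

text \<open>The first three constants are sums of absolute values of coefficients, such as
  \<open>6 + 10 + 3 = 19\<close>; what counts is that they are independent of
  \<open>\<epsilon>\<close>.\<close>

lemma poly_bounds:
  fixes w :: real assumes "0 \<le> w" "w \<le> 1"
  shows "\<bar>w\<^sup>2 * (6 * w\<^sup>2 - 10 * w + 3)\<bar> \<le> 19" "\<bar>6 * w ^ 4 - 8 * w ^ 3 - 2 * w\<^sup>2\<bar> \<le> 16"
    "\<bar>24 * w ^ 3 - 24 * w\<^sup>2 - 4 * w\<bar> \<le> 52" "12 * w ^ 5 - 6 * w ^ 4 \<ge> - 6"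
proof -
  have p: "0 \<le> w ^ n \<and> w ^ n \<le> 1" for n using assms by (simp add: power_le_one)
  have "\<bar>6 * w\<^sup>2 - 10 * w + 3\<bar> \<le> 19" using p[of 2] assms by linarith
  moreover have "\<bar>w\<^sup>2\<bar> \<le> 1" using p[of 2] by simp
  ultimately show "\<bar>w\<^sup>2 * (6 * w\<^sup>2 - 10 * w + 3)\<bar> \<le> 19"
    unfolding abs_mult using mult_mono[of "\<bar>w\<^sup>2\<bar>" 1 "\<bar>6 * w\<^sup>2 - 10 * w + 3\<bar>" 19] by simp
  show "\<bar>6 * w ^ 4 - 8 * w ^ 3 - 2 * w\<^sup>2\<bar> \<le> 16" using p[of 4] p[of 3] p[of 2] by linarith
  show "\<bar>24 * w ^ 3 - 24 * w\<^sup>2 - 4 * w\<bar> \<le> 52" using p[of 3] p[of 2] assms by linarith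
  show "12 * w ^ 5 - 6 * w ^ 4 \<ge> - 6" using p[of 5] p[of 4] by linarith
qed

text \<open>With \<open>g = u \<bullet> P\<close>, the radial part of the form is completed to \<open>4 w\<^sup>2 z (g + \<sigma> y)\<^sup>2 \<ge> 0\<close>; for \<open>\<epsilon> = 0\<close>
  this is the sharp weighted Hardy inequality.\<close>

lemma kinetic_form_lower_bound:
  fixes \<epsilon> :: real
  assumes \<epsilon>: "\<epsilon> > 0" and \<sigma>: "\<sigma> > 0" "\<epsilon> * \<sigma> \<le> 1" and z: "z \<ge> 0" "w = \<sigma> * z" "\<epsilon> * z = 1 - w"
    and U: "U = 1 - \<epsilon>\<^sup>2 * \<sigma>\<^sup>2" and g: "g\<^sup>2 \<le> U * S" and S: "S \<ge> 0"
  shows "2 * (w * z) * S + 2 * (w * z * (2 * w - 1)) * g\<^sup>2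
      + (3 * (w\<^sup>2 * (2 * w - 1)) + w\<^sup>2 * (6 * w\<^sup>2 - 10 * w + 3) * U + 2 * w\<^sup>2 * (2 * w - 1)) * g * y
    \<ge> (6 * w ^ 4 - 8 * w ^ 3 - 2 * w\<^sup>2) * y * g - 4 * w ^ 3 * \<sigma> * y\<^sup>2 - 19 * \<epsilon> * (\<sigma>\<^sup>2 * y\<^sup>2 + S)"
proof -
  have w: "0 \<le> w" "w \<le> 1" using \<epsilon> \<sigma> z(1) z(2) z(3) by (auto simp: mult_nonneg_nonneg) (metis add.commute diff_ge_0_iff_ge less_imp_le mult_nonneg_nonneg)
  define H where "H = w\<^sup>2 * (6 * w\<^sup>2 - 10 * w + 3)"
  have H: "\<bar>H\<bar> \<le> 19" unfolding H_def by (rule poly_bounds[OF w])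
  have "U \<le> 1" by (simp add: U)
  then have gS: "g\<^sup>2 \<le> S" using g mult_right_mono[OF \<open>U \<le> 1\<close> S] by simp
  \<comment> \<open>Dropping the tangential part of the gradient makes the coefficient of
    \<open>g\<^sup>2\<close> equal to \<open>2 w z + 2 w z (2 w - 1) = 4 w\<^sup>2 z\<close>, the
    one needed for the square in \<open>2\<close>.\<close>
  have 1: "2 * (w * z) * S \<ge> 2 * (w * z) * g\<^sup>2" using gS w z by (intro mult_left_mono) auto
  have 2: "4 * w\<^sup>2 * z * g\<^sup>2 + 8 * w ^ 3 * (y * g) + 4 * w ^ 3 * \<sigma> * y\<^sup>2 \<ge> 0"
  proof -
    have "4 * w\<^sup>2 * z * (g + \<sigma> * y)\<^sup>2 \<ge> 0" using z by simp
    also have "4 * w\<^sup>2 * z * (g + \<sigma> * y)\<^sup>2 = 4 * w\<^sup>2 * z * g\<^sup>2 + 8 * w\<^sup>2 * (\<sigma> * z) * (y * g) + 4 * w\<^sup>2 * (\<sigma> * z) * \<sigma> * y\<^sup>2"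
      by (simp add: power2_eq_square algebra_simps)
    finally show ?thesis unfolding z(2)[symmetric] by (simp add: power2_eq_square power3_eq_cube algebra_simps)
  qed
  \<comment> \<open>Cross term due to the length defect: of
    \<open>\<epsilon>\<^sup>2 * \<sigma>\<^sup>2\<close>, one \<open>\<epsilon>\<close> is kept,
    \<open>\<epsilon> * \<sigma> \<le> 1\<close> is spent, and the other \<open>\<sigma>\<close>
    goes to \<open>y\<close>.\<close>
  have 3: "\<epsilon>\<^sup>2 * \<sigma>\<^sup>2 * H * g * y \<le> 19 * \<epsilon> * (\<sigma>\<^sup>2 * y\<^sup>2 + S)"
  proof -
    have "\<epsilon>\<^sup>2 * \<sigma>\<^sup>2 * H * g * y \<le> \<bar>\<epsilon>\<^sup>2 * \<sigma>\<^sup>2 * H * g * y\<bar>" by simp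
    also have "\<dots> = \<bar>H\<bar> * (\<epsilon> * ((\<epsilon> * \<sigma>) * \<bar>(\<sigma> * y) * g\<bar>))" using \<epsilon> \<sigma> by (simp add: abs_mult power2_eq_square)
    also have "\<dots> \<le> 19 * (\<epsilon> * (1 * ((\<sigma> * y)\<^sup>2 + g\<^sup>2)))"
      using H \<epsilon> \<sigma> abs_mult_le_squares[of "\<sigma> * y" g] by (intro mult_mono) auto
    also have "\<dots> \<le> 19 * (\<epsilon> * (\<sigma>\<^sup>2 * y\<^sup>2 + S))" using gS \<epsilon> by (auto simp: power_mult_distrib)
    finally show ?thesis by (simp only: mult.assoc)
  qed
  \<comment> \<open>At \<open>U = 1\<close> the coefficient of \<open>g * y\<close> collapses to
    \<open>6 w^4 - 2 w\<^sup>2\<close>; taking away the \<open>8 w^3\<close> spent on the square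
    leaves the polynomial in the claim.\<close>
  have "3 * (w\<^sup>2 * (2 * w - 1)) + w\<^sup>2 * (6 * w\<^sup>2 - 10 * w + 3) * U + 2 * w\<^sup>2 * (2 * w - 1)
      = 6 * w ^ 4 - 2 * w\<^sup>2 - \<epsilon>\<^sup>2 * \<sigma>\<^sup>2 * H"
    unfolding U H_def by (simp add: power2_eq_square power4_eq_xxxx algebra_simps)
  note * = this
  have "(3 * (w\<^sup>2 * (2 * w - 1)) + w\<^sup>2 * (6 * w\<^sup>2 - 10 * w + 3) * U + 2 * w\<^sup>2 * (2 * w - 1)) * g * y
      = (6 * w ^ 4 - 2 * w\<^sup>2) * y * g - \<epsilon>\<^sup>2 * \<sigma>\<^sup>2 * H * g * y"
    unfolding * by (simp add: algebra_simps)
  moreover have "2 * (w * z) * g\<^sup>2 + 2 * (w * z * (2 * w - 1)) * g\<^sup>2 = 4 * w\<^sup>2 * z * g\<^sup>2"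
    by (simp add: power2_eq_square algebra_simps)
  moreover have "(6 * w ^ 4 - 8 * w ^ 3 - 2 * w\<^sup>2) * y * g = (6 * w ^ 4 - 2 * w\<^sup>2) * y * g - 8 * w ^ 3 * (y * g)"
    by (simp add: algebra_simps)
  ultimately show ?thesis using 1 2 3 by linarith
qed

text \<open>This is the coefficient of \<open>f\<^sup>2\<close> remaining after the term linear in
  the gradient has been integrated by parts. At \<open>w = U = 1\<close> it is
  \<open>4 \<sigma> - 4 \<sigma> = 0\<close>, the cancellation behind the sharp constant; deviations
  are of order \<open>\<epsilon>\<close> because
  \<open>\<sigma> * (1 - w) = \<epsilon> * w\<close>.\<close>

lemma kinetic_remainder_lower_bound:
  fixes \<epsilon> :: real
  assumes \<epsilon>: "\<epsilon> > 0" and \<sigma>: "\<sigma> > 0" "\<epsilon> * \<sigma> \<le> 1" and z: "z \<ge> 0" "w = \<sigma> * z" "\<epsilon> * z = 1 - w"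
    and U: "U = 1 - \<epsilon>\<^sup>2 * \<sigma>\<^sup>2"
  shows "- (1/2) * (- ((24 * w ^ 3 - 24 * w\<^sup>2 - 4 * w) * (\<sigma> * w * (1 - w))) * U
      + (6 * w ^ 4 - 8 * w ^ 3 - 2 * w\<^sup>2) * \<sigma> * (3 - U)) - 4 * w ^ 3 * \<sigma> \<ge> - \<epsilon> * (32 + 8 * \<sigma>\<^sup>2)"
proof -
  have w: "0 \<le> w" "w \<le> 1" using \<epsilon> \<sigma> z(1) z(2) z(3) by (auto simp: mult_nonneg_nonneg) (metis add.commute diff_ge_0_iff_ge less_imp_le mult_nonneg_nonneg)
  define \<tau> where "\<tau> = \<epsilon>\<^sup>2 * \<sigma>\<^sup>2"
  have \<tau>: "0 \<le> \<tau>" "\<tau> \<le> 1" using \<sigma> \<epsilon> unfolding \<tau>_def power_mult_distrib[symmetric] by (auto simp: power_le_one)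
  define c0 c1 where "c0 = 6 * w ^ 4 - 8 * w ^ 3 - 2 * w\<^sup>2" and "c1 = 24 * w ^ 3 - 24 * w\<^sup>2 - 4 * w"
  have \<sigma>w: "\<sigma> * (1 - w) = \<epsilon> * w" using z by (metis mult.left_commute)
  then have \<sigma>w': "\<sigma> * w * (1 - w) = \<epsilon> * w\<^sup>2" by (simp add: power2_eq_square mult.commute mult.left_commute)
  have A: "- (1/2) * (- (c1 * (\<sigma> * w * (1 - w))) * U + c0 * \<sigma> * (3 - U)) - 4 * w ^ 3 * \<sigma>
      = (1/2) * c1 * (\<epsilon> * w\<^sup>2) - c0 * \<sigma> - 4 * w ^ 3 * \<sigma> - (1/2) * (c1 * (\<epsilon> * w\<^sup>2) * \<tau>) - (1/2) * (c0 * \<sigma> * \<tau>)"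
    unfolding \<sigma>w' U \<tau>_def[symmetric] by (simp add: field_simps)
  \<comment> \<open>The factorisation \<open>- c0 - 4 w^3 = (1 - w) w\<^sup>2 (6 w + 2)\<close>
    exposes \<open>1 - w\<close>, which trades \<open>\<sigma>\<close> for
    \<open>\<epsilon>\<close>.\<close>
  have B: "- c0 * \<sigma> - 4 * w ^ 3 * \<sigma> = (\<epsilon> * w) * (w\<^sup>2 * (6 * w + 2))"
    unfolding \<sigma>w[symmetric] c0_def by (simp add: power2_eq_square power3_eq_cube power4_eq_xxxx algebra_simps)
  have C: "(1/2) * c1 * (\<epsilon> * w\<^sup>2) + (\<epsilon> * w) * (w\<^sup>2 * (6 * w + 2)) = \<epsilon> * (12 * w ^ 5 - 6 * w ^ 4)"
    unfolding c1_def by (simp add: eval_nat_numeral algebra_simps)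
  have D: "\<epsilon> * (12 * w ^ 5 - 6 * w ^ 4) \<ge> \<epsilon> * (- 6)" using poly_bounds(4)[OF w] \<epsilon> by (intro mult_left_mono) auto
  have E: "(1/2) * (c1 * (\<epsilon> * w\<^sup>2) * \<tau>) \<le> 26 * \<epsilon>"
  proof -
    have "c1 * (\<epsilon> * w\<^sup>2) * \<tau> \<le> \<bar>c1\<bar> * (\<epsilon> * w\<^sup>2) * \<tau>" using \<epsilon> \<tau> by (intro mult_right_mono) auto
    also have "\<dots> \<le> 52 * (\<epsilon> * 1) * 1"
      using poly_bounds(3)[OF w] \<epsilon> \<tau> w unfolding c1_def by (intro mult_mono) (auto simp: power_le_one)
    finally show ?thesis by simp
  qed
  have F: "(1/2) * (c0 * \<sigma> * \<tau>) \<le> 8 * \<epsilon> * \<sigma>\<^sup>2"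
  proof -
    have "c0 * \<sigma> * \<tau> \<le> \<bar>c0\<bar> * \<sigma> * \<tau>" using \<sigma> \<tau> by (intro mult_right_mono) auto
    also have "\<dots> = \<bar>c0\<bar> * ((\<epsilon> * \<sigma>\<^sup>2) * (\<epsilon> * \<sigma>))" by (simp add: \<tau>_def power2_eq_square)
    also have "\<dots> \<le> 16 * ((\<epsilon> * \<sigma>\<^sup>2) * 1)"
      using poly_bounds(2)[OF w] \<epsilon> \<sigma> unfolding c0_def by (intro mult_mono) auto
    finally show ?thesis by simp
  qed
  \<comment> \<open>The 32 of the claim is \<open>6 + 26\<close>, from \<open>D\<close> and
    \<open>E\<close>.\<close>
  show ?thesis using A B C D E F unfolding c0_def[symmetric] c1_def[symmetric] by (simp add: algebra_simps)
qed


section \<open>Real \<open>H^2\<close> functions and Hardy's inequality\<close>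

locale sobolev2 =
  fixes f :: "(real^3)^'n::finite \<Rightarrow> real" and p :: "(real^3)^'n \<Rightarrow> (real^3)^'n \<Rightarrow> real"
    and q :: "(real^3)^'n \<Rightarrow> (real^3)^'n \<Rightarrow> (real^3)^'n \<Rightarrow> real"
  assumes weak_f: "b \<in> Basis \<Longrightarrow> weak_deriv b f (p b)"
    and weak_p: "b \<in> Basis \<Longrightarrow> c \<in> Basis \<Longrightarrow> weak_deriv c (p b) (q b c)"
    and q_commute: "q b c = q c b"
begin

lemma f_sq_int: "sq_int f"
  using weak_derivD(1)[OF weak_f[OF dir_Basis]] .

lemma p_sq_int: "b \<in> Basis \<Longrightarrow> sq_int (p b)"
  using weak_derivD(2)[OF weak_f] .

lemma q_sq_int: "b \<in> Basis \<Longrightarrow> c \<in> Basis \<Longrightarrow> sq_int (q b c)"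
  using weak_derivD(2)[OF weak_p] .

definition grad_sq :: "'n \<Rightarrow> (real^3)^'n \<Rightarrow> real" where
  "grad_sq j x = (\<Sum>i\<in>UNIV. (p (dir j i) x)\<^sup>2)"

lemma grad_sq_nonneg: "grad_sq j x \<ge> 0"
  unfolding grad_sq_def by (intro sum_nonneg) auto

lemma grad_sq_integrable: "integrable lborel (grad_sq j)"
  unfolding grad_sq_def by (intro Bochner_Integration.integrable_sum sq_int_integrable p_sq_int dir_Basis)

lemma by_parts_self:
  assumes "b \<in> Basis" "bounded_cont W" "bounded_cont W'" "line_deriv b W W'"
  shows "integrable lborel (\<lambda>x. 2 * (W x * f x * p b x) + W' x * f x * f x)"
    "(LINT x|lborel. 2 * (W x * f x * p b x) + W' x * f x * f x) = 0"
proof -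
  have i: "integrable lborel (\<lambda>x. W x * f x * p b x)" "integrable lborel (\<lambda>x. W' x * f x * f x)"
    using assms f_sq_int p_sq_int bounded_cont_integrable by blast+
  then show "integrable lborel (\<lambda>x. 2 * (W x * f x * p b x) + W' x * f x * f x)" by simp
  have "(LINT x|lborel. W x * p b x * f x) = (LINT x|lborel. W x * f x * p b x)"
    by (rule Bochner_Integration.integral_cong) auto
  with bounded_cont_by_parts[OF assms(1) weak_f weak_f assms(2-4)] assms(1)
  have "2 * (LINT x|lborel. W x * f x * p b x) + (LINT x|lborel. W' x * f x * f x) = 0" by simp
  then show "(LINT x|lborel. 2 * (W x * f x * p b x) + W' x * f x * f x) = 0" using i by simp
qed

lemma by_parts_self_sum:
  assumes "finite I" "\<And>i. i \<in> I \<Longrightarrow> b i \<in> Basis"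
    "\<And>i. i \<in> I \<Longrightarrow> bounded_cont (W i)" "\<And>i. i \<in> I \<Longrightarrow> bounded_cont (W' i)" "\<And>i. i \<in> I \<Longrightarrow> line_deriv (b i) (W i) (W' i)"
  shows "integrable lborel (\<lambda>x. \<Sum>i\<in>I. 2 * (W i x * f x * p (b i) x) + W' i x * f x * f x)"
    "(LINT x|lborel. (\<Sum>i\<in>I. 2 * (W i x * f x * p (b i) x) + W' i x * f x * f x)) = 0"
proof -
  show "integrable lborel (\<lambda>x. \<Sum>i\<in>I. 2 * (W i x * f x * p (b i) x) + W' i x * f x * f x)"
    by (intro Bochner_Integration.integrable_sum by_parts_self assms)
  have "(LINT x|lborel. (\<Sum>i\<in>I. 2 * (W i x * f x * p (b i) x) + W' i x * f x * f x))
    = (\<Sum>i\<in>I. LINT x|lborel. 2 * (W i x * f x * p (b i) x) + W' i x * f x * f x)"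
    by (intro Bochner_Integration.integral_sum by_parts_self assms)
  also have "\<dots> = 0" by (intro sum.neutral ballI by_parts_self assms)
  finally show "(LINT x|lborel. (\<Sum>i\<in>I. 2 * (W i x * f x * p (b i) x) + W' i x * f x * f x)) = 0" .
qed

lemma isg_sq_integrable: "\<eta> > 0 \<Longrightarrow> integrable lborel (\<lambda>x. (isg \<eta> c x)\<^sup>2 * (f x)\<^sup>2)"
  using sq_int_integrable[OF bounded_cont_sq_int[OF isg_bounded_cont f_sq_int]] by (simp add: power_mult_distrib)

text \<open>With \<open>y = rel c x\<close>, the divergence of
  \<open>(y / s\<^sup>2) f\<^sup>2\<close> in particle \<open>k\<close> integrates to 0, and a
  square is completed. Since only \<open>c k = 1\<close> matters, the same proof serves
  \<open>x\<^sub>k\<close> and \<open>x\<^sub>k - x\<^sub>l\<close>.\<close>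

lemma Hardy:
  assumes \<eta>: "\<eta> > 0" and c: "c k = 1"
  shows "(LINT x|lborel. (isg \<eta> c x)\<^sup>2 * (f x)\<^sup>2) \<le> 4 * (LINT x|lborel. grad_sq k x)"
proof -
  define W where "W i x = nrel \<eta> c i x * isg \<eta> c x" for i x
  define W' where "W' i x = (isg \<eta> c x)\<^sup>2 - 2 * (nrel \<eta> c i x)\<^sup>2 * (isg \<eta> c x)\<^sup>2" for i x
  note bc = bounded_cont_intros isg_bounded_cont[OF \<eta>] nrel_bounded_cont[OF \<eta>]
  have bW: "bounded_cont (W i)" "bounded_cont (W' i)" for i
    unfolding W_def W'_def by (intro bc)+
  have dW: "line_deriv (dir k i) (W i) (W' i)" for i
    unfolding W_def
    by (rule line_deriv_eq[OF line_deriv_mult[OF nrel_line_deriv[OF \<eta>] isg_line_deriv[OF \<eta>]]])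
       (simp add: W'_def c power2_eq_square algebra_simps)
  note parts = by_parts_self_sum[of UNIV "dir k" W W', OF finite_class.finite_UNIV dir_Basis bW dW]
  have "(LINT x|lborel. (1/2) * ((isg \<eta> c x)\<^sup>2 * (f x)\<^sup>2) - 2 * grad_sq k x) \<le>
      (LINT x|lborel. (\<Sum>i\<in>UNIV. 2 * (W i x * f x * p (dir k i) x) + W' i x * f x * f x))"
  proof (rule integral_mono[OF _ parts(1)])
    show "integrable lborel (\<lambda>x. (1/2) * ((isg \<eta> c x)\<^sup>2 * (f x)\<^sup>2) - 2 * grad_sq k x)"
      by (intro Bochner_Integration.integrable_diff integrable_mult_right isg_sq_integrable \<eta> grad_sq_integrable)
    fix x
    define y where "y = isg \<eta> c x * f x"
    have "2 * (W i x * f x * p (dir k i) x) + W' i x * f x * f x \<ge>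
        y\<^sup>2 - (5/2) * y\<^sup>2 * (nrel \<eta> c i x)\<^sup>2 - 2 * (p (dir k i) x)\<^sup>2" for i
    proof -
      \<comment> \<open>This square leaves, after summing over the coordinates,
        \<open>3 - 5/2 = 1/2\<close> of \<open>y\<^sup>2\<close> against twice the squared gradient,
        hence the constant 4.\<close>
      have "0 \<le> (1/2) * (nrel \<eta> c i x * y + 2 * p (dir k i) x)\<^sup>2" by simp
      then show ?thesis by (simp add: W_def W'_def y_def power2_eq_square algebra_simps)
    qed
    then have "(\<Sum>i\<in>UNIV. 2 * (W i x * f x * p (dir k i) x) + W' i x * f x * f x) \<ge>
        (\<Sum>i\<in>UNIV. y\<^sup>2 - (5/2) * y\<^sup>2 * (nrel \<eta> c i x)\<^sup>2 - 2 * (p (dir k i) x)\<^sup>2)" by (intro sum_mono)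
    moreover have "(\<Sum>i\<in>UNIV. y\<^sup>2 - (5/2) * y\<^sup>2 * (nrel \<eta> c i x)\<^sup>2 - 2 * (p (dir k i) x)\<^sup>2)
        = 3 * y\<^sup>2 - (5/2) * y\<^sup>2 * (1 - \<eta>\<^sup>2 * (isg \<eta> c x)\<^sup>2) - 2 * grad_sq k x"
      unfolding sum_nrel_square[OF \<eta>, symmetric] grad_sq_def
      by (simp add: sum_subtractf sum_distrib_left)
    moreover have "3 * y\<^sup>2 - (5/2) * y\<^sup>2 * (1 - \<eta>\<^sup>2 * (isg \<eta> c x)\<^sup>2) \<ge> (1/2) * y\<^sup>2"
    proof -
      have "0 \<le> (5/2) * y\<^sup>2 * (\<eta>\<^sup>2 * (isg \<eta> c x)\<^sup>2)" by simp
      then show ?thesis by (simp add: algebra_simps)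
    qed
    ultimately show "(1/2) * ((isg \<eta> c x)\<^sup>2 * (f x)\<^sup>2) - 2 * grad_sq k x \<le>
        (\<Sum>i\<in>UNIV. 2 * (W i x * f x * p (dir k i) x) + W' i x * f x * f x)"
      unfolding power_mult_distrib[symmetric] y_def[symmetric] by linarith
  qed
  moreover have "(LINT x|lborel. (1/2) * ((isg \<eta> c x)\<^sup>2 * (f x)\<^sup>2) - 2 * grad_sq k x)
      = (1/2) * (LINT x|lborel. (isg \<eta> c x)\<^sup>2 * (f x)\<^sup>2) - 2 * (LINT x|lborel. grad_sq k x)"
    using isg_sq_integrable[OF \<eta>] grad_sq_integrable
    by (subst Bochner_Integration.integral_diff) auto
  ultimately show ?thesis using parts(2) by linarith
qed

end

section \<open>The regularised multiplier field\<close>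

definition single :: "'n::finite \<Rightarrow> 'n \<Rightarrow> real" where
  "single j k = (if k = j then 1 else 0)"

lemma rel_single: "rel (single j) x = x $ j"
proof -
  have "rel (single j) x = (\<Sum>k\<in>UNIV. if k = j then x $ k else 0)"
    unfolding rel_def single_def by (rule sum.cong) auto
  then show ?thesis by simp
qed

text \<open>\<open>sreg \<epsilon> j\<close> is \<open>z = s / (1 + \<epsilon> s)\<close> with \<open>s = sqrt (|x\<^sub>j|\<^sup>2 + \<epsilon>\<^sup>2) = 1 / \<sigma>\<close>; the field \<open>X = x z\<^sup>2 / s\<close> is a bounded
  regularisation of \<open>|x\<^sub>j| x\<^sub>j\<close>, and \<open>w = \<sigma> z = 1 / (1 + \<epsilon> s)\<close>.\<close>

definition sreg :: "real \<Rightarrow> 'n::finite \<Rightarrow> (real^3)^'n \<Rightarrow> real" where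
  "sreg \<epsilon> j x = 1 / (isg \<epsilon> (single j) x + \<epsilon>)"

definition wreg :: "real \<Rightarrow> 'n::finite \<Rightarrow> (real^3)^'n \<Rightarrow> real" where
  "wreg \<epsilon> j x = isg \<epsilon> (single j) x * sreg \<epsilon> j x"

definition Xreg :: "real \<Rightarrow> 'n::finite \<Rightarrow> 3 \<Rightarrow> (real^3)^'n \<Rightarrow> real" where
  "Xreg \<epsilon> j i x = nrel \<epsilon> (single j) i x * (sreg \<epsilon> j x)\<^sup>2"

text \<open>Jacobian of the field in the variable of its own particle. Up to the length defect of
  \<open>nrel\<close> its eigenvalues are \<open>w z\<close> tangentially and
  \<open>2 w\<^sup>2 z\<close> radially.\<close>

definition DXreg :: "real \<Rightarrow> 'n::finite \<Rightarrow> 3 \<Rightarrow> 3 \<Rightarrow> (real^3)^'n \<Rightarrow> real" where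
  "DXreg \<epsilon> j i m x = (if i = m then wreg \<epsilon> j x * sreg \<epsilon> j x else 0)
    + wreg \<epsilon> j x * sreg \<epsilon> j x * (2 * wreg \<epsilon> j x - 1) * nrel \<epsilon> (single j) i x * nrel \<epsilon> (single j) m x"

text \<open>Derivative along \<open>dir j m\<close> of the diagonal entry
  \<open>DXreg \<epsilon> j i i\<close>; summed over \<open>i\<close> it is the gradient of the
  divergence, the only second derivative of the field that the multiplier calls for.\<close>

definition DDXreg :: "real \<Rightarrow> 'n::finite \<Rightarrow> 3 \<Rightarrow> 3 \<Rightarrow> (real^3)^'n \<Rightarrow> real" where
  "DDXreg \<epsilon> j i m x = (wreg \<epsilon> j x)\<^sup>2 * (2 * wreg \<epsilon> j x - 1) * nrel \<epsilon> (single j) m x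
    + (wreg \<epsilon> j x)\<^sup>2 * (6 * (wreg \<epsilon> j x)\<^sup>2 - 10 * wreg \<epsilon> j x + 3) * (nrel \<epsilon> (single j) i x)\<^sup>2 * nrel \<epsilon> (single j) m x
    + (if i = m then 2 * (wreg \<epsilon> j x)\<^sup>2 * (2 * wreg \<epsilon> j x - 1) * nrel \<epsilon> (single j) i x else 0)"

context
  fixes \<epsilon> :: real assumes \<epsilon>: "\<epsilon> > 0"
begin

lemma sreg_pos: "sreg \<epsilon> j x > 0"
  unfolding sreg_def using isg_pos[OF \<epsilon>, of "single j" x] \<epsilon> by simp

lemma sreg_eps: "\<epsilon> * sreg \<epsilon> j x = 1 - wreg \<epsilon> j x"
  unfolding sreg_def wreg_def using isg_pos[OF \<epsilon>, of "single j" x] \<epsilon> by (simp add: field_simps)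

lemma sreg_bounded_cont: "bounded_cont (sreg \<epsilon> j)"
proof (rule bounded_contI)
  show "continuous_on UNIV (sreg \<epsilon> j)" unfolding sreg_def
  proof (intro continuous_intros ballI)
    show "continuous_on UNIV (isg \<epsilon> (single j))" using isg_bounded_cont[OF \<epsilon>, of "single j"] by (simp add: bounded_cont_def)
    show "isg \<epsilon> (single j) x + \<epsilon> \<noteq> 0" for x using isg_pos[OF \<epsilon>, of "single j" x] \<epsilon> by linarith
  qed
  show "\<bar>sreg \<epsilon> j x\<bar> \<le> 1 / \<epsilon>" for x
    using isg_pos[OF \<epsilon>, of "single j" x] \<epsilon> by (simp add: sreg_def frac_le)
qed

lemma wreg_bounded_cont: "bounded_cont (wreg \<epsilon> j)"
  unfolding wreg_def by (intro bounded_cont_mult isg_bounded_cont sreg_bounded_cont \<epsilon>)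

lemmas reg_bounded_cont = bounded_cont_intros isg_bounded_cont[OF \<epsilon>] nrel_bounded_cont[OF \<epsilon>]
  sreg_bounded_cont wreg_bounded_cont

lemma Xreg_bounded_cont: "bounded_cont (Xreg \<epsilon> j i)"
  unfolding Xreg_def by (intro reg_bounded_cont)

lemma DXreg_bounded_cont: "bounded_cont (DXreg \<epsilon> j i m)"
  unfolding DXreg_def by (cases "i = m") (simp_all, (intro reg_bounded_cont)+)

lemma DDXreg_bounded_cont: "bounded_cont (DDXreg \<epsilon> j i m)"
  unfolding DDXreg_def by (cases "i = m") (simp_all, (intro reg_bounded_cont)+)

lemma sreg_line_deriv:
  "line_deriv (dir k m) (sreg \<epsilon> j) (\<lambda>x. single j k * (wreg \<epsilon> j x)\<^sup>2 * nrel \<epsilon> (single j) m x)"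
proof -
  have "line_deriv (dir k m) (sreg \<epsilon> j)
     (\<lambda>x. - ((sreg \<epsilon> j x)\<^sup>2) * - (single j k * (isg \<epsilon> (single j) x)\<^sup>2 * nrel \<epsilon> (single j) m x))"
    unfolding sreg_def
  proof (rule line_deriv_compose[OF isg_line_deriv[OF \<epsilon>]])
    fix x
    have "isg \<epsilon> (single j) x + \<epsilon> \<noteq> 0" using isg_pos[OF \<epsilon>, of "single j" x] \<epsilon> by simp
    then show "((\<lambda>v. 1 / (v + \<epsilon>)) has_real_derivative - ((1 / (isg \<epsilon> (single j) x + \<epsilon>))\<^sup>2)) (at (isg \<epsilon> (single j) x))"
      by (auto intro!: derivative_eq_intros simp: power2_eq_square)
  qed
  then show ?thesis by (rule line_deriv_eq) (simp add: wreg_def power2_eq_square)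
qed

lemma wreg_line_deriv:
  "line_deriv (dir k m) (wreg \<epsilon> j)
    (\<lambda>x. - (single j k * isg \<epsilon> (single j) x * wreg \<epsilon> j x * (1 - wreg \<epsilon> j x) * nrel \<epsilon> (single j) m x))"
proof -
  have "line_deriv (dir k m) (\<lambda>x. isg \<epsilon> (single j) x * sreg \<epsilon> j x)
    (\<lambda>x. - (single j k * isg \<epsilon> (single j) x * wreg \<epsilon> j x * (1 - wreg \<epsilon> j x) * nrel \<epsilon> (single j) m x))"
    by (rule line_deriv_eq[OF line_deriv_mult[OF isg_line_deriv[OF \<epsilon>] sreg_line_deriv]])
       (simp add: wreg_def power2_eq_square algebra_simps)
  then show ?thesis unfolding wreg_def by simp
qed

lemma Xreg_line_deriv: "line_deriv (dir k m) (Xreg \<epsilon> j i) (\<lambda>x. single j k * DXreg \<epsilon> j i m x)"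
proof -
  have "line_deriv (dir k m) (\<lambda>x. nrel \<epsilon> (single j) i x * (sreg \<epsilon> j x * sreg \<epsilon> j x)) (\<lambda>x. single j k * DXreg \<epsilon> j i m x)"
    by (rule line_deriv_eq[OF line_deriv_mult[OF nrel_line_deriv[OF \<epsilon>] line_deriv_mult[OF sreg_line_deriv sreg_line_deriv]]])
       (simp add: DXreg_def wreg_def power2_eq_square algebra_simps)
  then show ?thesis unfolding Xreg_def by (simp add: power2_eq_square)
qed

lemma DXreg_line_deriv: "line_deriv (dir k m) (DXreg \<epsilon> j i i) (\<lambda>x. single j k * DDXreg \<epsilon> j i m x)"
proof -
  have *: "line_deriv (dir k m) (\<lambda>x. wreg \<epsilon> j x * sreg \<epsilon> j x * (1 + (2 * wreg \<epsilon> j x + (-1)) * (nrel \<epsilon> (single j) i x * nrel \<epsilon> (single j) i x)))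
    (\<lambda>x. single j k * DDXreg \<epsilon> j i m x)"
    by (rule line_deriv_eq[OF line_deriv_mult[OF line_deriv_mult[OF wreg_line_deriv sreg_line_deriv]
          line_deriv_add[OF line_deriv_const line_deriv_mult[OF line_deriv_add[OF line_deriv_mult[OF line_deriv_const wreg_line_deriv] line_deriv_const]
            line_deriv_mult[OF nrel_line_deriv[OF \<epsilon>] nrel_line_deriv[OF \<epsilon>]]]]]])
       (simp add: DDXreg_def wreg_def power2_eq_square algebra_simps)
  have "DXreg \<epsilon> j i i = (\<lambda>x. wreg \<epsilon> j x * sreg \<epsilon> j x * (1 + (2 * wreg \<epsilon> j x + (-1)) * (nrel \<epsilon> (single j) i x * nrel \<epsilon> (single j) i x)))"
    by (auto simp: DXreg_def algebra_simps)
  with * show ?thesis by simp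
qed

end


lemma sum_single: "(\<Sum>k\<in>UNIV. single j k * G k) = G j"
proof -
  have "(\<Sum>k\<in>UNIV. single j k * G k) = (\<Sum>k\<in>UNIV. if k = j then G k else 0)"
    by (rule sum.cong) (auto simp: single_def)
  then show ?thesis by simp
qed

section \<open>The virial identity for the kinetic term\<close>

context sobolev2
begin

text \<open>Half of the multiplier for one particle,
  \<open>X \<bullet> \<nabla>f + (1/2) (div X) f\<close>; hence the factors 2 in the pairings
  below.\<close>

definition mult_op :: "real \<Rightarrow> 'n \<Rightarrow> (real^3)^'n \<Rightarrow> real" where
  "mult_op \<epsilon> j x = (\<Sum>i\<in>UNIV. Xreg \<epsilon> j i x * p (dir j i) x + (1/2) * (DXreg \<epsilon> j i i x * f x))"

lemma mult_op_sq_int: "\<epsilon> > 0 \<Longrightarrow> sq_int (mult_op \<epsilon> j)"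
  unfolding mult_op_def
  by (intro sq_int_sum sq_int_add sq_int_cmult bounded_cont_sq_int Xreg_bounded_cont DXreg_bounded_cont
      f_sq_int p_sq_int dir_Basis)

text \<open>The second summand is left linear in the gradient; integrating it by parts once more
  would ask for third derivatives of the field.\<close>

definition kinetic_form :: "real \<Rightarrow> 'n \<Rightarrow> (real^3)^'n \<Rightarrow> real" where
  "kinetic_form \<epsilon> j x = (\<Sum>m\<in>UNIV. \<Sum>i\<in>UNIV. 2 * DXreg \<epsilon> j i m x * p (dir j m) x * p (dir j i) x + DDXreg \<epsilon> j i m x * p (dir j m) x * f x)"

text \<open>\<open>kinetic_by_parts\<close> is used for each component \<open>i\<close> of the field
  and each direction \<open>dir k m\<close> of the Laplacian. The field depends on particle
  \<open>j\<close> alone, so \<open>single j k\<close> removes the directions of the other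
  particles.\<close>

lemma kinetic_identity:
  assumes \<epsilon>: "\<epsilon> > 0"
  shows "integrable lborel (kinetic_form \<epsilon> j)"
    and "- 2 * (LINT x|lborel. (\<Sum>b\<in>Basis. q b b x) * mult_op \<epsilon> j x) = (LINT x|lborel. kinetic_form \<epsilon> j x)"
proof -
  define T where "T k m i x = - 2 * (Xreg \<epsilon> j i x * q (dir k m) (dir k m) x * p (dir j i) x)
    - DXreg \<epsilon> j i i x * q (dir k m) (dir k m) x * f x" for k m i x
  define R where "R k m i x = 2 * (single j k * DXreg \<epsilon> j i m x * p (dir k m) x * p (dir j i) x)
    + single j k * DDXreg \<epsilon> j i m x * p (dir k m) x * f x" for k m i x
  note sq = f_sq_int p_sq_int[OF dir_Basis] q_sq_int[OF dir_Basis dir_Basis]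
  note bc = Xreg_bounded_cont[OF \<epsilon>] DXreg_bounded_cont[OF \<epsilon>] DDXreg_bounded_cont[OF \<epsilon>] bounded_cont_mult bounded_cont_const
  have iT: "integrable lborel (T k m i)" for k m i
    unfolding T_def by (intro Bochner_Integration.integrable_diff integrable_mult_right bounded_cont_integrable sq bc)
  have iR: "integrable lborel (R k m i)" for k m i
    unfolding R_def by (intro Bochner_Integration.integrable_add integrable_mult_right bounded_cont_integrable sq bc)
  have TR: "(LINT x|lborel. T k m i x) = (LINT x|lborel. R k m i x)" for k m i
  proof -
    have "line_deriv (dir j i) (Xreg \<epsilon> j i) (DXreg \<epsilon> j i i)"
      using Xreg_line_deriv[OF \<epsilon>, of j i j i] by (simp add: single_def)
    \<comment> \<open>Both orders of differentiation must give the same function \<open>fab\<close>,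
      which is where the literal symmetry of \<open>q\<close> enters.\<close>
    moreover have "weak_deriv (dir j i) (p (dir k m)) (q (dir j i) (dir k m))"
      using weak_p[OF dir_Basis dir_Basis, of j i k m] q_commute by metis
    ultimately
    have "- 2 * (LINT x|lborel. Xreg \<epsilon> j i x * q (dir k m) (dir k m) x * p (dir j i) x) - (LINT x|lborel. DXreg \<epsilon> j i i x * q (dir k m) (dir k m) x * f x)
      = 2 * (LINT x|lborel. single j k * DXreg \<epsilon> j i m x * p (dir k m) x * p (dir j i) x)
        + (LINT x|lborel. single j k * DDXreg \<epsilon> j i m x * p (dir k m) x * f x)" 
      by (intro kinetic_by_parts[where a="dir j i" and b="dir k m" and fab="q (dir j i) (dir k m)"])
         (auto intro: dir_Basis weak_f weak_p bc Xreg_line_deriv[OF \<epsilon>] DXreg_line_deriv[OF \<epsilon>])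
    moreover have "(LINT x|lborel. T k m i x) = - 2 * (LINT x|lborel. Xreg \<epsilon> j i x * q (dir k m) (dir k m) x * p (dir j i) x) - (LINT x|lborel. DXreg \<epsilon> j i i x * q (dir k m) (dir k m) x * f x)"
      unfolding T_def
      by (subst Bochner_Integration.integral_diff; (intro integrable_mult_right bounded_cont_integrable sq bc)?) simp
    moreover have "(LINT x|lborel. R k m i x) = 2 * (LINT x|lborel. single j k * DXreg \<epsilon> j i m x * p (dir k m) x * p (dir j i) x)
        + (LINT x|lborel. single j k * DDXreg \<epsilon> j i m x * p (dir k m) x * f x)"
      unfolding R_def
      by (subst Bochner_Integration.integral_add; (intro integrable_mult_right bounded_cont_integrable sq bc)?) simp
    ultimately show ?thesis by simp
  qed
  have Rsum: "(\<Sum>k\<in>UNIV. \<Sum>m\<in>UNIV. \<Sum>i\<in>UNIV. R k m i x) = kinetic_form \<epsilon> j x" for x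
  proof -
    have "(\<Sum>k\<in>UNIV. \<Sum>m\<in>UNIV. \<Sum>i\<in>UNIV. R k m i x) = (\<Sum>k\<in>UNIV. single j k * (\<Sum>m\<in>UNIV. \<Sum>i\<in>UNIV.
        2 * DXreg \<epsilon> j i m x * p (dir k m) x * p (dir j i) x + DDXreg \<epsilon> j i m x * p (dir k m) x * f x))"
      unfolding R_def sum_distrib_left by (intro sum.cong refl) (simp add: algebra_simps)
    then show ?thesis unfolding sum_single kinetic_form_def .
  qed
  have "integrable lborel (\<lambda>x. \<Sum>k\<in>UNIV. \<Sum>m\<in>UNIV. \<Sum>i\<in>UNIV. R k m i x)"
    by (intro Bochner_Integration.integrable_sum iR)
  then show "integrable lborel (kinetic_form \<epsilon> j)" unfolding Rsum .
  have "(\<Sum>k\<in>UNIV. \<Sum>m\<in>UNIV. \<Sum>i\<in>UNIV. T k m i x) = - 2 * ((\<Sum>b\<in>Basis. q b b x) * mult_op \<epsilon> j x)" for x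
    unfolding T_def mult_op_def sum_Basis_dir sum_distrib_right unfolding sum_distrib_left
    by (intro sum.cong refl) (simp add: algebra_simps)
  then have "- 2 * (LINT x|lborel. (\<Sum>b\<in>Basis. q b b x) * mult_op \<epsilon> j x) = (LINT x|lborel. (\<Sum>k\<in>UNIV. \<Sum>m\<in>UNIV. \<Sum>i\<in>UNIV. T k m i x))"
    by simp
  also have "\<dots> = (\<Sum>k\<in>UNIV. \<Sum>m\<in>UNIV. \<Sum>i\<in>UNIV. LINT x|lborel. T k m i x)"
    by (simp add: Bochner_Integration.integral_sum Bochner_Integration.integrable_sum iT)
  also have "\<dots> = (LINT x|lborel. (\<Sum>k\<in>UNIV. \<Sum>m\<in>UNIV. \<Sum>i\<in>UNIV. R k m i x))"
    by (simp add: Bochner_Integration.integral_sum Bochner_Integration.integrable_sum iR TR)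
  finally show "- 2 * (LINT x|lborel. (\<Sum>b\<in>Basis. q b b x) * mult_op \<epsilon> j x) = (LINT x|lborel. kinetic_form \<epsilon> j x)"
    unfolding Rsum .
qed

text \<open>Pointwise, \<open>kinetic_form\<close> dominates half of a divergence \<open>F\<close>
  up to terms of order \<open>\<epsilon>\<close>, and \<open>F\<close> integrates to 0. Its vector
  field \<open>c0 u f\<^sup>2\<close> is chosen to reproduce the term linear in the gradient that is
  left by completing the square.\<close>

lemma kinetic_lower_bound:
  assumes \<epsilon>: "\<epsilon> > 0"
  shows "- 2 * (LINT x|lborel. (\<Sum>b\<in>Basis. q b b x) * mult_op \<epsilon> j x)
    \<ge> - \<epsilon> * (32 * (LINT x|lborel. (f x)\<^sup>2) + 127 * (LINT x|lborel. grad_sq j x))"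
proof -
  define \<sigma> w z u where "\<sigma> = isg \<epsilon> (single j)" and "w = wreg \<epsilon> j" and "z = sreg \<epsilon> j" and "u = nrel \<epsilon> (single j)"
  \<comment> \<open>The coefficient of \<open>y * g\<close> in
    \<open>kinetic_form_lower_bound\<close>; \<open>c1\<close> is its derivative in
    \<open>w\<close>.\<close>
  define c0 where "c0 x = 6 * w x ^ 4 - 8 * w x ^ 3 - 2 * (w x)\<^sup>2" for x
  define c1 where "c1 x = 24 * w x ^ 3 - 24 * (w x)\<^sup>2 - 4 * w x" for x
  define W where "W i x = c0 x * u i x" for i x
  define W' where "W' i x = - (c1 x * (\<sigma> x * w x * (1 - w x))) * (u i x)\<^sup>2 + c0 x * \<sigma> x * (1 - (u i x)\<^sup>2)" for i x
  note bc = reg_bounded_cont[OF \<epsilon>]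
  have bW: "bounded_cont (W i)" "bounded_cont (W' i)" for i
    unfolding W_def W'_def c0_def c1_def \<sigma>_def w_def u_def by (intro bc)+
  have dW: "line_deriv (dir j i) (W i) (W' i)" for i
  proof -
    have "line_deriv (dir j i) c0 (\<lambda>x. c1 x * (- (single j j * isg \<epsilon> (single j) x * wreg \<epsilon> j x * (1 - wreg \<epsilon> j x) * nrel \<epsilon> (single j) i x)))"
      unfolding c0_def[abs_def] w_def
    proof (rule line_deriv_compose[OF wreg_line_deriv[OF \<epsilon>]])
      fix x show "((\<lambda>v. 6 * v ^ 4 - 8 * v ^ 3 - 2 * v\<^sup>2) has_real_derivative c1 x) (at (wreg \<epsilon> j x))"
        unfolding c1_def w_def by (auto intro!: derivative_eq_intros simp: power2_eq_square power3_eq_cube)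
    qed
    from line_deriv_mult[OF this nrel_line_deriv[OF \<epsilon>, of j i "single j" i]]
    show ?thesis unfolding W_def u_def
      by (rule line_deriv_eq) (simp add: W'_def \<sigma>_def w_def u_def single_def power2_eq_square algebra_simps)
  qed
  note parts = by_parts_self_sum[of UNIV "dir j" W W', OF finite_class.finite_UNIV dir_Basis bW dW]
  define F where "F x = (\<Sum>i\<in>UNIV. 2 * (W i x * f x * p (dir j i) x) + W' i x * f x * f x)" for x
  \<comment> \<open>\<open>27 = 19 + 8\<close> collects both errors in
    \<open>\<sigma>\<^sup>2 f\<^sup>2\<close>; Hardy's inequality then gives
    \<open>4 * 27 + 19 = 127\<close>.\<close>
  define L where "L x = (1/2) * F x - \<epsilon> * (32 * (f x)\<^sup>2 + 27 * ((\<sigma> x)\<^sup>2 * (f x)\<^sup>2) + 19 * grad_sq j x)" for x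
  have iF: "integrable lborel F" "(LINT x|lborel. F x) = 0" using parts unfolding F_def by auto
  have i\<sigma>: "integrable lborel (\<lambda>x. (\<sigma> x)\<^sup>2 * (f x)\<^sup>2)" unfolding \<sigma>_def by (rule isg_sq_integrable[OF \<epsilon>])
  have if2: "integrable lborel (\<lambda>x. (f x)\<^sup>2)" by (rule sq_int_integrable[OF f_sq_int])
  have iL: "integrable lborel L"
    unfolding L_def by (intro Bochner_Integration.integrable_diff Bochner_Integration.integrable_add integrable_mult_right iF i\<sigma> if2 grad_sq_integrable)
  have "(LINT x|lborel. L x) = (1/2) * (LINT x|lborel. F x) - \<epsilon> * (32 * (LINT x|lborel. (f x)\<^sup>2)
      + 27 * (LINT x|lborel. (\<sigma> x)\<^sup>2 * (f x)\<^sup>2) + 19 * (LINT x|lborel. grad_sq j x))"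
    unfolding L_def using iF(1) i\<sigma> if2 grad_sq_integrable[of j] by simp
  moreover have "\<epsilon> * (32 * (LINT x|lborel. (f x)\<^sup>2) + 27 * (LINT x|lborel. (\<sigma> x)\<^sup>2 * (f x)\<^sup>2) + 19 * (LINT x|lborel. grad_sq j x))
      \<le> \<epsilon> * (32 * (LINT x|lborel. (f x)\<^sup>2) + 127 * (LINT x|lborel. grad_sq j x))"
    using Hardy[OF \<epsilon>, of "single j" j] \<epsilon> unfolding \<sigma>_def by (intro mult_left_mono) (simp_all add: single_def)
  ultimately have "- (\<epsilon> * (32 * (LINT x|lborel. (f x)\<^sup>2) + 127 * (LINT x|lborel. grad_sq j x))) \<le> (LINT x|lborel. L x)"
    using iF(2) by linarith
  also have "(LINT x|lborel. L x) \<le> - 2 * (LINT x|lborel. (\<Sum>b\<in>Basis. q b b x) * mult_op \<epsilon> j x)"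
    unfolding kinetic_identity(2)[OF \<epsilon>]
  proof (rule integral_mono[OF iL kinetic_identity(1)[OF \<epsilon>]])
    fix x
    define P where "P i = p (dir j i) x" for i
    define g where "g = (\<Sum>i\<in>UNIV. u i x * P i)"
    define U where "U = (\<Sum>i\<in>UNIV. (u i x)\<^sup>2)"
    have S: "grad_sq j x = (\<Sum>i\<in>UNIV. (P i)\<^sup>2)" by (simp add: grad_sq_def P_def)
    have U: "U = 1 - \<epsilon>\<^sup>2 * (\<sigma> x)\<^sup>2" unfolding U_def u_def \<sigma>_def by (rule sum_nrel_square[OF \<epsilon>])
    have \<sigma>: "\<sigma> x > 0" "\<epsilon> * \<sigma> x \<le> 1" unfolding \<sigma>_def using isg_pos[OF \<epsilon>] isg_le[OF \<epsilon>] by auto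
    have z: "z x \<ge> 0" "w x = \<sigma> x * z x" "\<epsilon> * z x = 1 - w x"
      unfolding z_def w_def \<sigma>_def using sreg_pos[OF \<epsilon>, of j x] sreg_eps[OF \<epsilon>] by (auto simp: wreg_def)
    have gS: "g\<^sup>2 \<le> U * grad_sq j x" unfolding g_def U_def S by (rule Cauchy_Schwarz3)
    have "kinetic_form \<epsilon> j x
      = 2 * (w x * z x) * grad_sq j x + 2 * (w x * z x * (2 * w x - 1)) * g\<^sup>2
      + (3 * ((w x)\<^sup>2 * (2 * w x - 1)) + (w x)\<^sup>2 * (6 * (w x)\<^sup>2 - 10 * w x + 3) * U + 2 * (w x)\<^sup>2 * (2 * w x - 1)) * g * f x"
      unfolding kinetic_form_def S g_def U_def DXreg_def DDXreg_def P_def[symmetric] w_def[symmetric] z_def[symmetric] u_def[symmetric]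
      by (rule inner3_expand)
    also have "\<dots> \<ge> c0 x * f x * g - 4 * w x ^ 3 * \<sigma> x * (f x)\<^sup>2 - 19 * \<epsilon> * ((\<sigma> x)\<^sup>2 * (f x)\<^sup>2 + grad_sq j x)"
      unfolding c0_def by (rule kinetic_form_lower_bound[OF \<epsilon> \<sigma> z U gS grad_sq_nonneg])
    finally have 1: "kinetic_form \<epsilon> j x
      \<ge> c0 x * f x * g - 4 * w x ^ 3 * \<sigma> x * (f x)\<^sup>2 - 19 * \<epsilon> * ((\<sigma> x)\<^sup>2 * (f x)\<^sup>2 + grad_sq j x)" .
    define B where "B = - (c1 x * (\<sigma> x * w x * (1 - w x))) * U + c0 x * \<sigma> x * (3 - U)"
    have "F x = 2 * (c0 x * f x * g) + B * (f x)\<^sup>2"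
      unfolding F_def W_def W'_def g_def U_def B_def P_def[symmetric]
      by (simp add: sum_3 power2_eq_square algebra_simps)
    moreover have "(- (1/2) * B - 4 * w x ^ 3 * \<sigma> x) * (f x)\<^sup>2 \<ge> (- \<epsilon> * (32 + 8 * (\<sigma> x)\<^sup>2)) * (f x)\<^sup>2"
      using kinetic_remainder_lower_bound[OF \<epsilon> \<sigma> z U] unfolding B_def c0_def c1_def by (intro mult_right_mono) auto
    ultimately show "L x \<le> kinetic_form \<epsilon> j x"
      using 1 unfolding L_def by (simp add: algebra_simps)
  qed
  finally show ?thesis by simp
qed

end


subsection \<open>The potential term\<close>

text \<open>Integrability of the limit is part of the conclusion: the singular pair weights are
  reached only as limits.\<close>

lemma Fatou_real:
  fixes F :: "nat \<Rightarrow> 'a \<Rightarrow> real"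
  assumes F: "\<And>n. integrable M (F n)" "\<And>n. AE x in M. 0 \<le> F n x" "AE x in M. (\<lambda>n. F n x) \<longlonglongrightarrow> G x"
    and G [measurable]: "G \<in> borel_measurable M"
    and C: "\<And>n. integral\<^sup>L M (F n) \<le> C n" "C \<longlonglongrightarrow> c"
  shows "integrable M G" "integral\<^sup>L M G \<le> c"
proof -
  have [measurable]: "F n \<in> borel_measurable M" for n using F(1) by auto
  have "AE x in M. \<forall>n. 0 \<le> F n x" using F(2) by (simp add: AE_all_countable)
  then have G0: "AE x in M. 0 \<le> G x" using F(3)
    by eventually_elim (auto intro: LIMSEQ_le_const)
  have c0: "c \<ge> 0"
  proof (rule LIMSEQ_le_const[OF C(2)])
    show "\<exists>N. \<forall>n\<ge>N. 0 \<le> C n" using C(1) F(2) integral_nonneg_AE order_trans by blast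
  qed
  have "(\<integral>\<^sup>+x. ennreal (G x) \<partial>M) = (\<integral>\<^sup>+x. liminf (\<lambda>n. ennreal (F n x)) \<partial>M)"
    
  proof (rule nn_integral_cong_AE)
    show "AE x in M. ennreal (G x) = liminf (\<lambda>n. ennreal (F n x))"
      using F(3) by eventually_elim (rule lim_imp_Liminf[symmetric], auto intro: tendsto_ennrealI)
  qed
  also have "\<dots> \<le> liminf (\<lambda>n. \<integral>\<^sup>+x. ennreal (F n x) \<partial>M)" by (rule nn_integral_liminf) measurable
  also have "\<dots> = liminf (\<lambda>n. ennreal (integral\<^sup>L M (F n)))" by (simp add: nn_integral_eq_integral F)
  also have "\<dots> \<le> liminf (\<lambda>n. ennreal (C n))"
    by (intro Liminf_mono always_eventually allI ennreal_leI C)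
  also have "\<dots> = ennreal c" using C(2) by (simp add: lim_imp_Liminf tendsto_ennrealI)
  finally have le: "(\<integral>\<^sup>+x. ennreal (G x) \<partial>M) \<le> ennreal c" .
  then have "(\<integral>\<^sup>+x. ennreal (G x) \<partial>M) < \<infinity>" using ennreal_less_top le_less_trans by (metis infinity_ennreal_def)
  then show i: "integrable M G" by (intro integrableI_nonneg G0 G)
  show "integral\<^sup>L M G \<le> c"
    using le c0 unfolding nn_integral_eq_integral[OF i G0] by simp
qed

text \<open>One vanishing coordinate of \<open>rel c x\<close> already confines \<open>x\<close> to
  the hyperplane orthogonal to \<open>a\<close>.\<close>

lemma AE_rel_neq_0:
  fixes c :: "'n::finite \<Rightarrow> real"
  assumes "c k \<noteq> 0" shows "AE x in lborel. rel c x $ i \<noteq> 0"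
proof -
  define a :: "(real^3)^'n" where "a = (\<chi> j. c j *\<^sub>R axis i 1)"
  have "a $ k $ i \<noteq> 0" using assms by (simp add: a_def axis_def)
  then have "a \<noteq> 0" by auto
  then have "negligible {x. a \<bullet> x = 0}" by (intro negligible_hyperplane) simp
  then have "AE x in lebesgue. x \<notin> {x. a \<bullet> x = 0}" unfolding negligible_iff_null_sets by (rule AE_not_in)
  then have "AE x in lborel. x \<notin> {x. a \<bullet> x = 0}" by (simp add: AE_completion_iff)
  then show ?thesis
  proof eventually_elim
    case (elim x)
    have "a \<bullet> x = (\<Sum>j\<in>UNIV. c j * x $ j $ i)"
      by (simp add: a_def inner_vec_def[of a] inner_vec_def[of "\<chi> j. c j *\<^sub>R axis i 1"] inner_axis')
    then show ?case using elim by (simp add: rel_def)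
  qed
qed

lemma isg_le_inverse_norm:
  assumes "\<eta> > 0" "rel c x \<noteq> 0" shows "isg \<eta> c x \<le> 1 / norm (rel c x)"
proof -
  have "norm (rel c x) \<le> sqrt ((norm (rel c x))\<^sup>2 + \<eta>\<^sup>2)" by (rule real_le_rsqrt) simp
  then show ?thesis unfolding isg_def
    using assms real_sqrt_gt_zero[OF reg_pos[OF assms(1), of "rel c x"]]
    by (intro divide_left_mono mult_pos_pos) auto
qed

definition eps :: "nat \<Rightarrow> real" where "eps n = inverse (real (Suc n))"

lemma eps_pos: "eps n > 0" by (simp add: eps_def)

lemma eps_tendsto: "eps \<longlonglongrightarrow> 0" unfolding eps_def[abs_def] by (rule LIMSEQ_inverse_real_of_nat)

lemma isg_tendsto:
  assumes "rel c x \<noteq> 0" shows "(\<lambda>n. isg (eps n) c x) \<longlonglongrightarrow> 1 / norm (rel c x)"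
proof -
  have "(\<lambda>n. isg (eps n) c x) \<longlonglongrightarrow> 1 / sqrt ((norm (rel c x))\<^sup>2 + 0\<^sup>2)"
    unfolding isg_def using assms by (intro tendsto_intros eps_tendsto) auto
  then show ?thesis by simp
qed

lemma measurable_rel [measurable]: "rel c \<in> borel_measurable borel"
  by (rule borel_measurable_continuous_onI[OF continuous_on_rel])

text \<open>Differentiating \<open>1 / |y|\<close>, \<open>y = rel c x\<close>, along the field
  gives minus this sum over \<open>|y|^3\<close>. It is \<open>X\<^sub>j \<bullet> x\<^sub>j\<close>
  for \<open>single j\<close> and
  \<open>(X\<^sub>k - X\<^sub>l) \<bullet> (x\<^sub>k - x\<^sub>l)\<close> for a pair.\<close>

definition virial_num :: "real \<Rightarrow> ('n::finite \<Rightarrow> real) \<Rightarrow> (real^3)^'n \<Rightarrow> real" where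
  "virial_num \<epsilon> c x = (\<Sum>j\<in>UNIV. \<Sum>i\<in>UNIV. c j * Xreg \<epsilon> j i x * rel c x $ i)"

lemma virial_num_measurable: "\<epsilon> > 0 \<Longrightarrow> virial_num \<epsilon> c \<in> borel_measurable borel"
proof -
  assume \<epsilon>: "\<epsilon> > 0"
  have "continuous_on UNIV (Xreg \<epsilon> j i)" for j :: 'a and i
    using Xreg_bounded_cont[OF \<epsilon>, of j i] by (simp add: bounded_cont_def)
  then have "continuous_on UNIV (virial_num \<epsilon> c)"
    unfolding virial_num_def by (intro continuous_intros)
  then show ?thesis by (rule borel_measurable_continuous_onI)
qed

context sobolev2
begin

lemma f_measurable [measurable]: "f \<in> borel_measurable borel"
  by (rule sq_int_measurable[OF f_sq_int])

definition mult_sum :: "real \<Rightarrow> (real^3)^'n \<Rightarrow> real" where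
  "mult_sum \<epsilon> x = (\<Sum>j\<in>UNIV. mult_op \<epsilon> j x)"

lemma mult_sum_sq_int: "\<epsilon> > 0 \<Longrightarrow> sq_int (mult_sum \<epsilon>)"
  unfolding mult_sum_def by (intro sq_int_sum mult_op_sq_int)

text \<open>Fatou's lemma removes the regularisation. With \<open>f / |y|\<close> square integrable,
  each Coulomb term can be paired with the multiplier separately.\<close>

lemma Hardy_limit:
  assumes c: "c k = 1"
  shows "sq_int (\<lambda>x. 1 / norm (rel c x) * f x)"
    "(LINT x|lborel. (1 / norm (rel c x) * f x)\<^sup>2) \<le> 4 * (LINT x|lborel. grad_sq k x)"
proof -
  have ck: "c k \<noteq> 0" using c by simp
  have *: "AE x in lborel. (\<lambda>n. (isg (eps n) c x)\<^sup>2 * (f x)\<^sup>2) \<longlonglongrightarrow> (1 / norm (rel c x) * f x)\<^sup>2"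
    using AE_rel_neq_0[of c k 1, OF ck]
  proof eventually_elim
    case (elim x)
    then have "rel c x \<noteq> 0" by auto
    then show ?case unfolding power_mult_distrib by (intro tendsto_intros isg_tendsto)
  qed
  note F = Fatou_real[of lborel "\<lambda>n x. (isg (eps n) c x)\<^sup>2 * (f x)\<^sup>2", OF isg_sq_integrable[OF eps_pos] _ * _ Hardy[of _ c k, OF eps_pos c] tendsto_const]
  show "(LINT x|lborel. (1 / norm (rel c x) * f x)\<^sup>2) \<le> 4 * (LINT x|lborel. grad_sq k x)"
    by (rule F) auto
  show "sq_int (\<lambda>x. 1 / norm (rel c x) * f x)"
    unfolding sq_int_def using F(1) by auto
qed

text \<open>Twice the integrand is the divergence of \<open>X f\<^sup>2\<close>. This antisymmetry
  eliminates \<open>E\<close> from the virial identity.\<close>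

lemma mult_sum_pairing_f:
  assumes \<epsilon>: "\<epsilon> > 0" shows "(LINT x|lborel. f x * mult_sum \<epsilon> x) = 0"
proof -
  have dX: "line_deriv (dir j i) (Xreg \<epsilon> j i) (DXreg \<epsilon> j i i)" for j :: 'n and i
    using Xreg_line_deriv[OF \<epsilon>, of j i j i] by (simp add: single_def)
  have "(LINT x|lborel. (\<Sum>a\<in>UNIV. 2 * ((\<lambda>(j, i). Xreg \<epsilon> j i) a x * f x * p ((\<lambda>(j, i). dir j i) a) x) + (\<lambda>(j, i). DXreg \<epsilon> j i i) a x * f x * f x)) = 0"
    by (rule by_parts_self_sum(2)) (auto intro: dir_Basis Xreg_bounded_cont[OF \<epsilon>] DXreg_bounded_cont[OF \<epsilon>] dX)
  also have "(\<lambda>x. (\<Sum>a\<in>UNIV. 2 * ((\<lambda>(j, i). Xreg \<epsilon> j i) a x * f x * p ((\<lambda>(j, i). dir j i) a) x) + (\<lambda>(j, i). DXreg \<epsilon> j i i) a x * f x * f x))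
      = (\<lambda>x. 2 * (f x * mult_sum \<epsilon> x))"
    unfolding mult_sum_def mult_op_def sum_distrib_left UNIV_Times_UNIV[symmetric] sum.cartesian_product
    by (intro ext sum.cong refl) (auto simp: algebra_simps)
  finally show ?thesis by simp
qed

text \<open>Differentiating the Coulomb weight \<open>isg\<close> along the field gives the virial
  term, and differentiating the field gives the divergence part of the multiplier. Positive
  \<open>\<eta>\<close>, independent of \<open>\<epsilon>\<close>, keeps the weights
  bounded.\<close>

lemma potential_by_parts:
  assumes \<epsilon>: "\<epsilon> > 0" and \<eta>: "\<eta> > 0"
  shows "integrable lborel (\<lambda>x. virial_num \<epsilon> c x * (isg \<eta> c x) ^ 3 * (f x)\<^sup>2)"
    and "2 * (LINT x|lborel. isg \<eta> c x * f x * mult_sum \<epsilon> x) = (LINT x|lborel. virial_num \<epsilon> c x * (isg \<eta> c x) ^ 3 * (f x)\<^sup>2)"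
proof -
  define W where "W a x = (case a of (j, i) \<Rightarrow> Xreg \<epsilon> j i x * isg \<eta> c x)" for a and x :: "(real^3)^'n"
  define V where "V a x = (case a of (j, i) \<Rightarrow> c j * Xreg \<epsilon> j i x * nrel \<eta> c i x * (isg \<eta> c x)\<^sup>2)" for a and x :: "(real^3)^'n"
  define W' where "W' a x = (case a of (j, i) \<Rightarrow> DXreg \<epsilon> j i i x * isg \<eta> c x) - V a x" for a and x :: "(real^3)^'n"
  note bc = bounded_cont_intros Xreg_bounded_cont[OF \<epsilon>] DXreg_bounded_cont[OF \<epsilon>] isg_bounded_cont[OF \<eta>] nrel_bounded_cont[OF \<eta>]
  have bV: "bounded_cont (V a)" for a
    unfolding V_def by (cases a) (simp, intro bc)
  have bW: "bounded_cont (W a)" for a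
    unfolding W_def by (cases a) (simp, intro bc)
  have bW': "bounded_cont (W' a)" for a
    unfolding W'_def by (cases a) (simp, intro bc bV)
  have dX: "line_deriv (dir j i) (Xreg \<epsilon> j i) (DXreg \<epsilon> j i i)" for j :: 'n and i
    using Xreg_line_deriv[OF \<epsilon>, of j i j i] by (simp add: single_def)
  have dW: "line_deriv (case a of (j, i) \<Rightarrow> dir j i) (W a) (W' a)" for a
  proof (cases a)
    case (Pair j i)
    show ?thesis unfolding Pair W_def prod.case
      by (rule line_deriv_eq[OF line_deriv_mult[OF dX isg_line_deriv[OF \<eta>]]]) (simp add: W'_def V_def algebra_simps)
  qed
  note parts = by_parts_self_sum[of UNIV "\<lambda>a. case a of (j, i) \<Rightarrow> dir j i" W W', OF finite_class.finite_UNIV _ bW bW' dW]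
  have bas: "(case a of (j, i) \<Rightarrow> dir j i) \<in> Basis" for a :: "'n \<times> 3" by (auto split: prod.split intro: dir_Basis)
  have V: "(\<Sum>a\<in>UNIV. V a x) = virial_num \<epsilon> c x * (isg \<eta> c x) ^ 3" for x
    unfolding V_def virial_num_def nrel_def UNIV_Times_UNIV[symmetric] sum.cartesian_product sum_distrib_right
    by (intro sum.cong refl) (auto simp: power2_eq_square power3_eq_cube)
  have "integrable lborel (\<lambda>x. (\<Sum>a\<in>UNIV. V a x) * f x * f x)"
    by (intro bounded_cont_integrable f_sq_int bounded_cont_sum bV)
  then show iV: "integrable lborel (\<lambda>x. virial_num \<epsilon> c x * (isg \<eta> c x) ^ 3 * (f x)\<^sup>2)"
    unfolding V by (simp add: power2_eq_square mult.assoc)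
  have iA: "integrable lborel (\<lambda>x. isg \<eta> c x * f x * mult_sum \<epsilon> x)"
    by (intro bounded_cont_integrable isg_bounded_cont \<eta> f_sq_int mult_sum_sq_int \<epsilon>)
  have "(\<Sum>a\<in>UNIV. 2 * (W a x * f x * p (case a of (j, i) \<Rightarrow> dir j i) x) + W' a x * f x * f x)
     = 2 * (isg \<eta> c x * f x * mult_sum \<epsilon> x) - virial_num \<epsilon> c x * (isg \<eta> c x) ^ 3 * (f x)\<^sup>2" for x
  proof -
    have "2 * (isg \<eta> c x * f x * mult_sum \<epsilon> x) - (\<Sum>a\<in>UNIV. V a x) * (f x)\<^sup>2
      = (\<Sum>a\<in>UNIV. 2 * (isg \<eta> c x * f x * (case a of (j, i) \<Rightarrow> Xreg \<epsilon> j i x * p (dir j i) x + (1/2) * (DXreg \<epsilon> j i i x * f x))) - V a x * (f x)\<^sup>2)"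
      unfolding mult_sum_def mult_op_def sum_subtractf sum_distrib_left sum_distrib_right UNIV_Times_UNIV[symmetric] sum.cartesian_product
      by (intro arg_cong2[where f="(-)"] sum.cong refl)
    also have "\<dots> = (\<Sum>a\<in>UNIV. 2 * (W a x * f x * p (case a of (j, i) \<Rightarrow> dir j i) x) + W' a x * f x * f x)"
      by (intro sum.cong refl) (auto simp: W_def W'_def power2_eq_square algebra_simps split: prod.split)
    finally show ?thesis unfolding V by simp
  qed
  with parts(2)[OF bas] have "(LINT x|lborel. 2 * (isg \<eta> c x * f x * mult_sum \<epsilon> x) - virial_num \<epsilon> c x * (isg \<eta> c x) ^ 3 * (f x)\<^sup>2) = 0"
    by simp
  then show "2 * (LINT x|lborel. isg \<eta> c x * f x * mult_sum \<epsilon> x) = (LINT x|lborel. virial_num \<epsilon> c x * (isg \<eta> c x) ^ 3 * (f x)\<^sup>2)"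
    using iV iA by simp
qed

text \<open>The limit is taken in the pairing, where Hardy's inequality supplies the domination; the
  virial side inherits it through the identity, without a domination of its own singular
  weight.\<close>

lemma potential_limit:
  assumes \<epsilon>: "\<epsilon> > 0" and c: "c k = 1"
  shows "(\<lambda>n. LINT x|lborel. virial_num \<epsilon> c x * (isg (eps n) c x) ^ 3 * (f x)\<^sup>2) \<longlonglongrightarrow>
    2 * (LINT x|lborel. 1 / norm (rel c x) * f x * mult_sum \<epsilon> x)"
proof -
  note [measurable] = sq_int_measurable[OF mult_sum_sq_int[OF \<epsilon>]]
  have "c k \<noteq> 0" using c by simp
  from AE_rel_neq_0[of c k, OF this, of 1] have ne: "AE x in lborel. rel c x \<noteq> 0" by eventually_elim auto
  have m [measurable]: "isg \<eta> c \<in> borel_measurable borel" if "\<eta> > 0" for \<eta>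
    using isg_bounded_cont[OF that, of c] borel_measurable_continuous_onI unfolding bounded_cont_def by blast
  have [measurable]: "isg (eps n) c \<in> borel_measurable borel" for n by (rule m[OF eps_pos])
  have "(\<lambda>n. LINT x|lborel. isg (eps n) c x * f x * mult_sum \<epsilon> x) \<longlonglongrightarrow> (LINT x|lborel. 1 / norm (rel c x) * f x * mult_sum \<epsilon> x)"
  proof (rule integral_dominated_convergence[where w="\<lambda>x. \<bar>1 / norm (rel c x) * f x * mult_sum \<epsilon> x\<bar>"])
    show "integrable lborel (\<lambda>x. \<bar>1 / norm (rel c x) * f x * mult_sum \<epsilon> x\<bar>)"
      by (intro integrable_abs sq_int_mult_integrable Hardy_limit[of c k, OF c] mult_sum_sq_int \<epsilon>)
    show "AE x in lborel. (\<lambda>n. isg (eps n) c x * f x * mult_sum \<epsilon> x) \<longlonglongrightarrow> 1 / norm (rel c x) * f x * mult_sum \<epsilon> x"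
      using ne by eventually_elim (intro tendsto_intros isg_tendsto)
    show "AE x in lborel. norm (isg (eps n) c x * f x * mult_sum \<epsilon> x) \<le> \<bar>1 / norm (rel c x) * f x * mult_sum \<epsilon> x\<bar>" for n
      using ne
    proof eventually_elim
      case (elim x)
      have "\<bar>isg (eps n) c x\<bar> \<le> \<bar>1 / norm (rel c x)\<bar>"
        using isg_le_inverse_norm[OF eps_pos elim, of n] isg_pos[OF eps_pos, of n c x] by simp
      then show ?case unfolding real_norm_def abs_mult by (intro mult_right_mono) auto
    qed
  qed measurable
  then have "(\<lambda>n. 2 * (LINT x|lborel. isg (eps n) c x * f x * mult_sum \<epsilon> x)) \<longlonglongrightarrow> 2 * (LINT x|lborel. 1 / norm (rel c x) * f x * mult_sum \<epsilon> x)"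
    by (intro tendsto_intros)
  then show ?thesis unfolding potential_by_parts(2)[OF \<epsilon> eps_pos] .
qed

end


section \<open>Geometry of the one-body and two-body terms\<close>

definition pair :: "'n::finite \<Rightarrow> 'n \<Rightarrow> 'n \<Rightarrow> real" where
  "pair k l m = single k m - single l m"

lemma rel_pair: "rel (pair k l) x = x $ k - x $ l"
proof -
  have "rel (pair k l) x = rel (single k) x - rel (single l) x"
    by (simp add: rel_def pair_def scaleR_left_diff_distrib sum_subtractf)
  then show ?thesis by (simp add: rel_single)
qed

lemma pair_self: "k \<noteq> l \<Longrightarrow> pair k l k = 1"
  by (simp add: pair_def single_def)

definition Xcoef :: "real \<Rightarrow> 'n::finite \<Rightarrow> (real^3)^'n \<Rightarrow> real" where
  "Xcoef \<epsilon> j x = isg \<epsilon> (single j) x * (sreg \<epsilon> j x)\<^sup>2"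

lemma Xreg_Xcoef: "Xreg \<epsilon> j i x = Xcoef \<epsilon> j x * x $ j $ i"
  by (simp add: Xreg_def Xcoef_def nrel_def rel_single)

lemma virial_num_single: "virial_num \<epsilon> (single j) x = Xcoef \<epsilon> j x * (norm (x $ j))\<^sup>2"
proof -
  have "virial_num \<epsilon> (single j) x = (\<Sum>k\<in>UNIV. single j k * (\<Sum>i\<in>UNIV. Xreg \<epsilon> k i x * x $ j $ i))"
    by (simp add: virial_num_def rel_single sum_distrib_left mult.assoc)
  also have "\<dots> = (\<Sum>i\<in>UNIV. Xreg \<epsilon> j i x * x $ j $ i)" by (rule sum_single)
  also have "\<dots> = Xcoef \<epsilon> j x * (norm (x $ j))\<^sup>2"
    unfolding norm3 by (simp add: Xreg_Xcoef sum_distrib_left power2_eq_square mult.assoc)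
  finally show ?thesis .
qed

lemma virial_num_pair:
  "virial_num \<epsilon> (pair k l) x = (Xcoef \<epsilon> k x *\<^sub>R x $ k - Xcoef \<epsilon> l x *\<^sub>R x $ l) \<bullet> (x $ k - x $ l)"
proof -
  define G where "G j = (\<Sum>i\<in>UNIV. Xreg \<epsilon> j i x * (x $ k - x $ l) $ i)" for j
  have "virial_num \<epsilon> (pair k l) x = (\<Sum>j\<in>UNIV. single k j * G j) - (\<Sum>j\<in>UNIV. single l j * G j)"
    by (simp add: virial_num_def rel_pair pair_def G_def sum_distrib_left mult.assoc left_diff_distrib sum_subtractf)
  also have "\<dots> = G k - G l" by (simp only: sum_single)
  also have "\<dots> = (Xcoef \<epsilon> k x *\<^sub>R x $ k - Xcoef \<epsilon> l x *\<^sub>R x $ l) \<bullet> (x $ k - x $ l)"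
    by (simp add: G_def Xreg_Xcoef inner_vec_def sum_subtractf[symmetric] left_diff_distrib)
  finally show ?thesis .
qed

text \<open>By Cauchy-Schwarz the inner product is smallest when \<open>a\<close> and
  \<open>b\<close> point the same way, where only the radial profiles are compared.\<close>

lemma radial_field_monotone:
  fixes a b :: "'a::real_inner"
  assumes "0 \<le> \<alpha>" "0 \<le> \<beta>" "0 \<le> (\<alpha> * norm a - \<beta> * norm b) * (norm a - norm b)"
  shows "0 \<le> (\<alpha> *\<^sub>R a - \<beta> *\<^sub>R b) \<bullet> (a - b)"
proof -
  have "(\<alpha> + \<beta>) * (a \<bullet> b) \<le> (\<alpha> + \<beta>) * (norm a * norm b)"
    using assms by (intro mult_left_mono norm_cauchy_schwarz) auto
  moreover have "(\<alpha> *\<^sub>R a - \<beta> *\<^sub>R b) \<bullet> (a - b) = \<alpha> * (norm a)\<^sup>2 + \<beta> * (norm b)\<^sup>2 - (\<alpha> + \<beta>) * (a \<bullet> b)"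
    by (simp add: inner_diff_left inner_diff_right power2_norm_eq_inner inner_commute algebra_simps)
  ultimately show ?thesis using assms(3) by (simp add: power2_eq_square algebra_simps)
qed

text \<open>The profile is \<open>(r \<sigma>) z\<^sup>2\<close>. Both \<open>(r \<sigma>)\<^sup>2 =
  1 - \<epsilon>\<^sup>2 \<sigma>\<^sup>2\<close> and \<open>z\<close> grow with \<open>r\<close>,
  because \<open>\<sigma>\<close> decreases.\<close>

lemma Xcoef_mono:
  assumes \<epsilon>: "\<epsilon> > 0" and le: "norm (x $ k) \<le> norm (x $ l)"
  shows "Xcoef \<epsilon> k x * norm (x $ k) \<le> Xcoef \<epsilon> l x * norm (x $ l)"
proof -
  define \<sigma> r where "\<sigma> j = isg \<epsilon> (single j) x" and "r j = norm (x $ j)" for j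
  have pos: "\<sigma> j > 0" for j unfolding \<sigma>_def by (rule isg_pos[OF \<epsilon>])
  have sq: "(\<sigma> j)\<^sup>2 * ((r j)\<^sup>2 + \<epsilon>\<^sup>2) = 1" for j
    unfolding \<sigma>_def r_def using isg_square[OF \<epsilon>, of "single j" x] by (simp add: rel_single)
  have \<sigma>: "\<sigma> l \<le> \<sigma> k"
  proof -
    have "(r k)\<^sup>2 \<le> (r l)\<^sup>2" using le by (simp add: r_def power_mono)
    then show ?thesis unfolding \<sigma>_def isg_def rel_single r_def[symmetric]
      using reg_pos[OF \<epsilon>, of "x $ k"] unfolding r_def[symmetric]
      by (intro divide_left_mono mult_pos_pos) (auto intro: add_pos_nonneg simp: add_nonneg_pos \<epsilon>)
  qed
  have "(r k * \<sigma> k)\<^sup>2 = 1 - \<epsilon>\<^sup>2 * (\<sigma> k)\<^sup>2" "(r l * \<sigma> l)\<^sup>2 = 1 - \<epsilon>\<^sup>2 * (\<sigma> l)\<^sup>2"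
    using sq[of k] sq[of l] by (simp_all add: power_mult_distrib algebra_simps)
  moreover have "\<epsilon>\<^sup>2 * (\<sigma> l)\<^sup>2 \<le> \<epsilon>\<^sup>2 * (\<sigma> k)\<^sup>2" using \<sigma> pos by (intro mult_left_mono power_mono) (auto simp: less_imp_le)
  ultimately have "(r k * \<sigma> k)\<^sup>2 \<le> (r l * \<sigma> l)\<^sup>2" by simp
  then have 1: "r k * \<sigma> k \<le> r l * \<sigma> l"
    by (rule power2_le_imp_le) (use pos in \<open>auto simp: r_def less_imp_le\<close>)
  have 2: "sreg \<epsilon> k x \<le> sreg \<epsilon> l x" unfolding sreg_def \<sigma>_def[symmetric]
    using \<sigma> pos[of k] pos[of l] \<epsilon> by (intro divide_left_mono mult_pos_pos) auto
  have "(r k * \<sigma> k) * (sreg \<epsilon> k x)\<^sup>2 \<le> (r l * \<sigma> l) * (sreg \<epsilon> l x)\<^sup>2"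
    using sreg_pos[OF \<epsilon>, of k x] pos[of l]
    by (intro mult_mono[OF 1 power_mono[OF 2]]) (auto simp: r_def less_imp_le)
  then show ?thesis by (simp add: Xcoef_def r_def \<sigma>_def mult_ac)
qed

lemma Xcoef_nonneg: "\<epsilon> > 0 \<Longrightarrow> 0 \<le> Xcoef \<epsilon> j x"
  unfolding Xcoef_def using isg_pos[of \<epsilon> "single j" x] by simp

lemma virial_num_pair_nonneg:
  assumes \<epsilon>: "\<epsilon> > 0" shows "0 \<le> virial_num \<epsilon> (pair k l) x"
  unfolding virial_num_pair
proof (rule radial_field_monotone)
  show "0 \<le> (Xcoef \<epsilon> k x * norm (x $ k) - Xcoef \<epsilon> l x * norm (x $ l)) * (norm (x $ k) - norm (x $ l))"
    using Xcoef_mono[OF \<epsilon>, of x k l] Xcoef_mono[OF \<epsilon>, of x l k]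
    by (cases "norm (x $ k) \<le> norm (x $ l)") (auto intro: mult_nonpos_nonpos mult_nonneg_nonneg)
qed (use \<epsilon> in \<open>auto intro: Xcoef_nonneg\<close>)

text \<open>From \<open>z \<le> s\<close> the left side is at most \<open>s / r\<close>, and
  \<open>s \<le> r + \<epsilon>\<close>. The bound is uniform in \<open>\<eta>\<close>; its limit 1
  is the exact value for the field \<open>|x| x\<close>.\<close>

lemma virial_num_single_le:
  assumes \<epsilon>: "\<epsilon> > 0" and \<eta>: "\<eta> > 0"
  shows "virial_num \<epsilon> (single j) x * (isg \<eta> (single j) x) ^ 3 \<le> 1 + \<epsilon> * (1 / norm (x $ j))"
proof (cases "x $ j = 0")
  case True
  then show ?thesis by (simp add: virial_num_single)
next
  case False
  define r where "r = norm (x $ j)"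
  define \<sigma> where "\<sigma> = isg \<epsilon> (single j) x"
  have r: "r > 0" using False by (simp add: r_def)
  have \<sigma>: "\<sigma> > 0" unfolding \<sigma>_def by (rule isg_pos[OF \<epsilon>])
  have z: "sreg \<epsilon> j x \<le> 1 / \<sigma>" unfolding sreg_def \<sigma>_def[symmetric] using \<sigma> \<epsilon> by (intro divide_left_mono) auto
  have i: "isg \<eta> (single j) x \<le> 1 / r" using isg_le_inverse_norm[OF \<eta>, of "single j" x] False by (simp add: rel_single r_def)
  have s: "1 / \<sigma> \<le> r + \<epsilon>"
  proof -
    have "sqrt (r\<^sup>2 + \<epsilon>\<^sup>2) \<le> r + \<epsilon>" using r \<epsilon> by (intro real_le_lsqrt) (auto simp: power2_sum)
    then show ?thesis by (simp add: \<sigma>_def isg_def rel_single r_def)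
  qed
  have "virial_num \<epsilon> (single j) x * (isg \<eta> (single j) x) ^ 3 = (\<sigma> * (sreg \<epsilon> j x)\<^sup>2) * r\<^sup>2 * (isg \<eta> (single j) x) ^ 3"
    by (simp add: virial_num_single Xcoef_def \<sigma>_def r_def)
  also have "\<dots> \<le> (\<sigma> * (1 / \<sigma>)\<^sup>2) * r\<^sup>2 * (1 / r) ^ 3"
    using z i \<sigma> r sreg_pos[OF \<epsilon>, of j x] isg_pos[OF \<eta>, of "single j" x]
    by (intro mult_mono power_mono) (auto simp: less_imp_le)
  also have "\<dots> = (1 / \<sigma>) * (1 / r)" using \<sigma> r by (simp add: power2_eq_square power3_eq_cube)
  also have "\<dots> \<le> (r + \<epsilon>) * (1 / r)" using s r by (intro mult_right_mono) auto
  also have "\<dots> = 1 + \<epsilon> * (1 / r)" using r by (simp add: field_simps)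
  finally show ?thesis by (simp add: r_def)
qed

lemma Xcoef_tendsto:
  assumes "x $ j \<noteq> 0" shows "(\<lambda>n. Xcoef (eps n) j x) \<longlonglongrightarrow> norm (x $ j)"
proof -
  have i: "(\<lambda>n. isg (eps n) (single j) x) \<longlonglongrightarrow> 1 / norm (x $ j)"
    using isg_tendsto[of "single j" x] assms by (simp add: rel_single)
  have "(\<lambda>n. Xcoef (eps n) j x) \<longlonglongrightarrow> 1 / norm (x $ j) * (1 / (1 / norm (x $ j) + 0))\<^sup>2"
    unfolding Xcoef_def sreg_def using assms by (intro tendsto_intros i eps_tendsto) auto
  also have "1 / norm (x $ j) * (1 / (1 / norm (x $ j) + 0))\<^sup>2 = norm (x $ j)"
    using assms by (simp add: power2_eq_square)
  finally show ?thesis .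
qed

text \<open>Writing \<open>d = |a - b|\<close>, the left-hand side is \<open>(|a| + |b|) ((|a| - |b|)\<^sup>2 + d\<^sup>2) / 2\<close>.\<close>

lemma virial_pair_gt_half:
  fixes a b :: "'a::real_inner"
  assumes "a \<noteq> b" "a + b \<noteq> 0"
  shows "(norm a *\<^sub>R a - norm b *\<^sub>R b) \<bullet> (a - b) > (1/2) * norm (a - b) ^ 3"
proof -
  define \<alpha> \<beta> d where "\<alpha> = norm a" and "\<beta> = norm b" and "d = norm (a - b)"
  have d: "d > 0" "d \<le> \<alpha> + \<beta>" unfolding d_def \<alpha>_def \<beta>_def using assms(1) norm_triangle_ineq4 by auto
  have nn: "\<alpha> \<ge> 0" "\<beta> \<ge> 0" by (auto simp: \<alpha>_def \<beta>_def)
  have d2: "d\<^sup>2 = \<alpha>\<^sup>2 + \<beta>\<^sup>2 - 2 * (a \<bullet> b)" unfolding d_def \<alpha>_def \<beta>_def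
    by (simp add: power2_norm_eq_inner inner_diff_left inner_diff_right inner_commute)
  have s2: "(norm (a + b))\<^sup>2 = \<alpha>\<^sup>2 + \<beta>\<^sup>2 + 2 * (a \<bullet> b)" unfolding \<alpha>_def \<beta>_def
    by (simp add: power2_norm_eq_inner inner_add_left inner_add_right inner_commute)
  have "(norm a *\<^sub>R a - norm b *\<^sub>R b) \<bullet> (a - b) = \<alpha> * \<alpha>\<^sup>2 + \<beta> * \<beta>\<^sup>2 - (\<alpha> + \<beta>) * (a \<bullet> b)"
    unfolding \<alpha>_def \<beta>_def
    by (simp add: inner_diff_left inner_diff_right power2_norm_eq_inner inner_commute algebra_simps)
  also have "a \<bullet> b = (\<alpha>\<^sup>2 + \<beta>\<^sup>2 - d\<^sup>2) / 2" using d2 by simp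
  also have "\<alpha> * \<alpha>\<^sup>2 + \<beta> * \<beta>\<^sup>2 - (\<alpha> + \<beta>) * ((\<alpha>\<^sup>2 + \<beta>\<^sup>2 - d\<^sup>2) / 2) = (\<alpha> + \<beta>) * ((\<alpha> - \<beta>)\<^sup>2 + d\<^sup>2) / 2"
    by (simp add: power2_eq_square field_simps)
  finally have eq: "(norm a *\<^sub>R a - norm b *\<^sub>R b) \<bullet> (a - b) = (\<alpha> + \<beta>) * ((\<alpha> - \<beta>)\<^sup>2 + d\<^sup>2) / 2" .
  \<comment> \<open>For unequal norms the square is positive; for equal norms the triangle
    inequality \<open>d \<le> \<alpha> + \<beta>\<close> is strict unless
    \<open>b = - a\<close>.\<close>
  have "d * d\<^sup>2 < (\<alpha> + \<beta>) * ((\<alpha> - \<beta>)\<^sup>2 + d\<^sup>2)"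
  proof (cases "\<alpha> = \<beta>")
    case True
    have "d \<noteq> \<alpha> + \<beta>"
    proof
      assume "d = \<alpha> + \<beta>"
      then have "(norm (a + b))\<^sup>2 = 0" using d2 s2 True by (simp add: power2_eq_square algebra_simps)
      then show False using assms(2) by simp
    qed
    then show ?thesis using d True by (simp add: mult_strict_right_mono)
  next
    case False
    then have "d\<^sup>2 < (\<alpha> - \<beta>)\<^sup>2 + d\<^sup>2" by simp
    then show ?thesis using d by (intro mult_le_less_imp_less) auto
  qed
  then show ?thesis unfolding eq d_def[symmetric] by (simp add: power3_eq_cube power2_eq_square)
qed

section \<open>The virial inequality and the contradiction\<close>

context sobolev2
begin

definition potential_pairing :: "real \<Rightarrow> ('n \<Rightarrow> real) \<Rightarrow> real" where
  "potential_pairing \<epsilon> c = 2 * (LINT x|lborel. 1 / norm (rel c x) * f x * mult_sum \<epsilon> x)"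

text \<open>The error \<open>\<epsilon> / |x\<^sub>j|\<close> is split by
  \<open>v \<le> (v\<^sup>2 + 1) / 2\<close> so that Hardy's inequality absorbs it, with
  \<open>(1/2) * 4 = 2\<close> in front of the gradient.\<close>

lemma potential_pairing_single:
  assumes \<epsilon>: "\<epsilon> > 0"
  shows "potential_pairing \<epsilon> (single j) \<le> (LINT x|lborel. (f x)\<^sup>2)
    + \<epsilon> * ((1/2) * (LINT x|lborel. (f x)\<^sup>2) + 2 * (LINT x|lborel. grad_sq j x))"
proof -
  have sj: "single j j = 1" by (simp add: single_def)
  define h where "h x = 1 / norm (rel (single j) x) * f x" for x
  have h: "sq_int h" "(LINT x|lborel. (h x)\<^sup>2) \<le> 4 * (LINT x|lborel. grad_sq j x)"
    unfolding h_def using Hardy_limit[of "single j" j, OF sj] by auto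
  note i2 = sq_int_integrable[OF f_sq_int] sq_int_integrable[OF h(1)]
  define B where "B = (LINT x|lborel. (f x)\<^sup>2 + \<epsilon> * ((1/2) * (h x)\<^sup>2 + (1/2) * (f x)\<^sup>2))"
  have iB: "integrable lborel (\<lambda>x. (f x)\<^sup>2 + \<epsilon> * ((1/2) * (h x)\<^sup>2 + (1/2) * (f x)\<^sup>2))"
    by (intro Bochner_Integration.integrable_add integrable_mult_right i2)
  have "potential_pairing \<epsilon> (single j) \<le> B"
    unfolding potential_pairing_def
  proof (rule LIMSEQ_le_const2[OF potential_limit[OF \<epsilon>, of "single j" j, OF sj]])
    have "(LINT x|lborel. virial_num \<epsilon> (single j) x * (isg (eps n) (single j) x) ^ 3 * (f x)\<^sup>2) \<le> B" for n
      unfolding B_def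
    proof (rule integral_mono[OF potential_by_parts(1)[OF \<epsilon> eps_pos] iB])
      fix x :: "(real^3)^'n"
      define v where "v = 1 / norm (x $ j)"
      have "0 \<le> (v - 1)\<^sup>2" by simp
      then have "v \<le> (1/2) * v\<^sup>2 + 1/2" by (simp add: power2_eq_square algebra_simps)
      then have "\<epsilon> * v \<le> \<epsilon> * ((1/2) * v\<^sup>2 + 1/2)" using \<epsilon> by (intro mult_left_mono) auto
      then have "virial_num \<epsilon> (single j) x * (isg (eps n) (single j) x) ^ 3 \<le> 1 + \<epsilon> * ((1/2) * v\<^sup>2 + 1/2)"
        using virial_num_single_le[OF \<epsilon> eps_pos, of j x n] unfolding v_def by linarith
      then have "virial_num \<epsilon> (single j) x * (isg (eps n) (single j) x) ^ 3 * (f x)\<^sup>2 \<le> (1 + \<epsilon> * ((1/2) * v\<^sup>2 + 1/2)) * (f x)\<^sup>2"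
        by (intro mult_right_mono) auto
      also have "\<dots> = (f x)\<^sup>2 + \<epsilon> * ((1/2) * (h x)\<^sup>2 + (1/2) * (f x)\<^sup>2)"
        unfolding h_def rel_single v_def[symmetric] by (simp add: power2_eq_square algebra_simps)
      finally show "virial_num \<epsilon> (single j) x * (isg (eps n) (single j) x) ^ 3 * (f x)\<^sup>2
          \<le> (f x)\<^sup>2 + \<epsilon> * ((1/2) * (h x)\<^sup>2 + (1/2) * (f x)\<^sup>2)" .
    qed
    then show "\<exists>N. \<forall>n\<ge>N. (LINT x|lborel. virial_num \<epsilon> (single j) x * (isg (eps n) (single j) x) ^ 3 * (f x)\<^sup>2) \<le> B" by blast
  qed
  also have "B = (LINT x|lborel. (f x)\<^sup>2) + \<epsilon> * ((1/2) * (LINT x|lborel. (h x)\<^sup>2) + (1/2) * (LINT x|lborel. (f x)\<^sup>2))"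
    unfolding B_def using i2 by simp
  also have "\<dots> \<le> (LINT x|lborel. (f x)\<^sup>2) + \<epsilon> * ((1/2) * (LINT x|lborel. (f x)\<^sup>2) + 2 * (LINT x|lborel. grad_sq j x))"
    using h(2) \<epsilon> by (intro add_left_mono mult_left_mono) auto
  finally show ?thesis .
qed

text \<open>A lower bound on the repulsion is enough, so nonnegativity of the virial weight and
  Fatou's lemma handle the limit in \<open>\<eta>\<close>.\<close>

lemma potential_pairing_pair:
  assumes \<epsilon>: "\<epsilon> > 0" and kl: "k \<noteq> l"
  shows "integrable lborel (\<lambda>x. virial_num \<epsilon> (pair k l) x * (1 / norm (x $ k - x $ l)) ^ 3 * (f x)\<^sup>2)"
    and "(LINT x|lborel. virial_num \<epsilon> (pair k l) x * (1 / norm (x $ k - x $ l)) ^ 3 * (f x)\<^sup>2) \<le> potential_pairing \<epsilon> (pair k l)"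
proof -
  note kk = pair_self[OF kl]
  note [measurable] = virial_num_measurable[OF \<epsilon>, of "pair k l"]
  have m: "(\<lambda>x. virial_num \<epsilon> (pair k l) x * (1 / norm (rel (pair k l) x)) ^ 3 * (f x)\<^sup>2) \<in> borel_measurable lborel"
    by measurable
  have "pair k l k \<noteq> 0" using kk by simp
  from AE_rel_neq_0[of "pair k l" k, OF this, of 1]
  have lim: "AE x in lborel. (\<lambda>n. virial_num \<epsilon> (pair k l) x * (isg (eps n) (pair k l) x) ^ 3 * (f x)\<^sup>2)
      \<longlonglongrightarrow> virial_num \<epsilon> (pair k l) x * (1 / norm (rel (pair k l) x)) ^ 3 * (f x)\<^sup>2"
  proof eventually_elim
    case (elim x)
    then have "rel (pair k l) x \<noteq> 0" by auto
    then show ?case by (intro tendsto_intros isg_tendsto)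
  qed
  have nn: "AE x in lborel. 0 \<le> virial_num \<epsilon> (pair k l) x * (isg (eps n) (pair k l) x) ^ 3 * (f x)\<^sup>2" for n
    by (intro AE_I2 mult_nonneg_nonneg virial_num_pair_nonneg[OF \<epsilon>] zero_le_power less_imp_le[OF isg_pos[OF eps_pos]] zero_le_power2)
  note F = Fatou_real[OF potential_by_parts(1)[OF \<epsilon> eps_pos] nn lim m order_refl potential_limit[OF \<epsilon>, of "pair k l" k, OF kk]]
  show "integrable lborel (\<lambda>x. virial_num \<epsilon> (pair k l) x * (1 / norm (x $ k - x $ l)) ^ 3 * (f x)\<^sup>2)"
    "(LINT x|lborel. virial_num \<epsilon> (pair k l) x * (1 / norm (x $ k - x $ l)) ^ 3 * (f x)\<^sup>2) \<le> potential_pairing \<epsilon> (pair k l)"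
    using F unfolding rel_pair potential_pairing_def by auto
qed

text \<open>The equation is paired with twice \<open>mult_sum\<close>: the \<open>E\<close> term
  vanishes by antisymmetry, and the Laplacian contributes at most an error of order
  \<open>\<epsilon>\<close>.\<close>

lemma virial_inequality:
  assumes \<epsilon>: "\<epsilon> > 0" and Z: "Z > 0"
    and eq: "AE x in lborel. coulomb Z x * f x = E * f x + (\<Sum>b\<in>Basis. q b b x)"
  shows "(1/2) * (\<Sum>(k, l)\<in>{(k, l). k \<noteq> l}. potential_pairing \<epsilon> (pair k l)) \<le>
    Z * (\<Sum>j\<in>UNIV. potential_pairing \<epsilon> (single j))
    + \<epsilon> * (\<Sum>j\<in>UNIV. 32 * (LINT x|lborel. (f x)\<^sup>2) + 127 * (LINT x|lborel. grad_sq j x))"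
proof -
  define A where "A = mult_sum \<epsilon>"
  have A: "sq_int A" unfolding A_def by (rule mult_sum_sq_int[OF \<epsilon>])
  define S where "S = {(k, l). k \<noteq> (l::'n)}"
  have ip: "integrable lborel (\<lambda>x. 1 / norm (rel (pair k l) x) * f x * A x)" if "(k, l) \<in> S" for k l
    using that by (intro sq_int_mult_integrable Hardy_limit[of "pair k l" k] A pair_self) (auto simp: S_def)
  have isj: "integrable lborel (\<lambda>x. 1 / norm (rel (single j) x) * f x * A x)" for j
    by (intro sq_int_mult_integrable Hardy_limit[of "single j" j] A) (simp add: single_def)
  have coul: "coulomb Z x * f x * A x = (1/2) * (\<Sum>(k, l)\<in>S. 1 / norm (rel (pair k l) x) * f x * A x)
      - Z * (\<Sum>j\<in>UNIV. 1 / norm (rel (single j) x) * f x * A x)" for x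
    by (simp add: coulomb_def rel_pair rel_single S_def sum_distrib_right left_diff_distrib case_prod_unfold mult.assoc)
  have ip': "integrable lborel (\<lambda>x. \<Sum>(k, l)\<in>S. 1 / norm (rel (pair k l) x) * f x * A x)"
    unfolding case_prod_unfold by (intro Bochner_Integration.integrable_sum ip) simp
  have isj': "integrable lborel (\<lambda>x. \<Sum>j\<in>UNIV. 1 / norm (rel (single j) x) * f x * A x)"
    by (intro Bochner_Integration.integrable_sum isj)
  have "2 * (LINT x|lborel. coulomb Z x * f x * A x) = (1/2) * (\<Sum>(k, l)\<in>S. potential_pairing \<epsilon> (pair k l))
      - Z * (\<Sum>j\<in>UNIV. potential_pairing \<epsilon> (single j))"
  proof -
    have "(LINT x|lborel. (\<Sum>(k, l)\<in>S. 1 / norm (rel (pair k l) x) * f x * A x))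
        = (\<Sum>(k, l)\<in>S. LINT x|lborel. 1 / norm (rel (pair k l) x) * f x * A x)"
      using ip by (subst Bochner_Integration.integral_sum) (auto simp: case_prod_unfold intro!: sum.cong)
    moreover have "(LINT x|lborel. (\<Sum>j\<in>UNIV. 1 / norm (rel (single j) x) * f x * A x))
        = (\<Sum>j\<in>UNIV. LINT x|lborel. 1 / norm (rel (single j) x) * f x * A x)"
      by (intro Bochner_Integration.integral_sum isj)
    ultimately have "(LINT x|lborel. coulomb Z x * f x * A x) = (1/2) * (\<Sum>(k, l)\<in>S. LINT x|lborel. 1 / norm (rel (pair k l) x) * f x * A x)
       - Z * (\<Sum>j\<in>UNIV. LINT x|lborel. 1 / norm (rel (single j) x) * f x * A x)"
      unfolding coul using ip' isj' by simp
    then show ?thesis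
      by (simp add: potential_pairing_def A_def[symmetric] sum_distrib_left case_prod_unfold right_diff_distrib mult_ac)
  qed
  moreover have "(LINT x|lborel. coulomb Z x * f x * A x) = (LINT x|lborel. (\<Sum>b\<in>Basis. q b b x) * A x)"
  proof -
    have sq: "sq_int (\<lambda>x. \<Sum>b\<in>Basis. q b b x)" by (intro sq_int_sum q_sq_int)
    have "(LINT x|lborel. coulomb Z x * f x * A x) = (LINT x|lborel. (E * f x + (\<Sum>b\<in>Basis. q b b x)) * A x)"
    proof (rule integral_cong_AE)
      have "integrable lborel (\<lambda>x. coulomb Z x * f x * A x)" unfolding coul using ip' isj' by simp
      then show "(\<lambda>x. coulomb Z x * f x * A x) \<in> borel_measurable lborel" by auto
      have "integrable lborel (\<lambda>x. (E * f x + (\<Sum>b\<in>Basis. q b b x)) * A x)"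
        by (intro sq_int_mult_integrable sq_int_add sq_int_cmult f_sq_int sq A)
      then show "(\<lambda>x. (E * f x + (\<Sum>b\<in>Basis. q b b x)) * A x) \<in> borel_measurable lborel" by auto
      show "AE x in lborel. coulomb Z x * f x * A x = (E * f x + (\<Sum>b\<in>Basis. q b b x)) * A x"
        using eq by eventually_elim simp
    qed
    also have "\<dots> = (LINT x|lborel. E * (f x * A x) + (\<Sum>b\<in>Basis. q b b x) * A x)"
      by (simp add: algebra_simps)
    also have "\<dots> = E * (LINT x|lborel. f x * A x) + (LINT x|lborel. (\<Sum>b\<in>Basis. q b b x) * A x)"
      using sq_int_mult_integrable[OF f_sq_int A] sq_int_mult_integrable[OF sq A] by simp
    finally show ?thesis using mult_sum_pairing_f[OF \<epsilon>] by (simp add: A_def)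
  qed
  moreover have "- 2 * (LINT x|lborel. (\<Sum>b\<in>Basis. q b b x) * A x) \<ge>
      - \<epsilon> * (\<Sum>j\<in>UNIV. 32 * (LINT x|lborel. (f x)\<^sup>2) + 127 * (LINT x|lborel. grad_sq j x))"
  proof -
    have "(LINT x|lborel. (\<Sum>b\<in>Basis. q b b x) * A x) = (\<Sum>j\<in>UNIV. LINT x|lborel. (\<Sum>b\<in>Basis. q b b x) * mult_op \<epsilon> j x)"
      unfolding A_def mult_sum_def sum_distrib_left[of "\<Sum>b\<in>Basis. q b b _"]
      by (intro Bochner_Integration.integral_sum sq_int_mult_integrable sq_int_sum q_sq_int mult_op_sq_int \<epsilon>)
    moreover have "(\<Sum>j\<in>UNIV. - 2 * (LINT x|lborel. (\<Sum>b\<in>Basis. q b b x) * mult_op \<epsilon> j x)) \<ge>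
        (\<Sum>j\<in>UNIV. - \<epsilon> * (32 * (LINT x|lborel. (f x)\<^sup>2) + 127 * (LINT x|lborel. grad_sq j x)))"
      by (intro sum_mono kinetic_lower_bound \<epsilon>)
    ultimately show ?thesis by (simp only: sum_distrib_left)
  qed
  ultimately show ?thesis unfolding S_def by linarith
qed

lemma no_eigenfunction:
  assumes Z: "Z > 0" and N: "real CARD('n) \<ge> 4 * Z + 1"
    and eq: "AE x in lborel. coulomb Z x * f x = E * f x + (\<Sum>b\<in>Basis. q b b x)"
  shows "AE x in lborel. f x = 0"
proof -
  define S where "S = {(k, l). k \<noteq> (l::'n)}"
  define I where "I = (LINT x|lborel. (f x)\<^sup>2)"
  define G where "G n x = (\<Sum>(k, l)\<in>S. virial_num (eps n) (pair k l) x * (1 / norm (x $ k - x $ l)) ^ 3 * (f x)\<^sup>2)" for n x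
  define H where "H x = (\<Sum>(k, l)\<in>S. ((norm (x $ k) *\<^sub>R x $ k - norm (x $ l) *\<^sub>R x $ l) \<bullet> (x $ k - x $ l))
      * (1 / norm (x $ k - x $ l)) ^ 3 * (f x)\<^sup>2)" for x
  \<comment> \<open>Twice the right-hand side of \<open>virial_inequality\<close> with the nuclear
    pairings replaced by their bounds; the 2 clears the \<open>1/2\<close> before the sum over
    ordered pairs.\<close>
  define C where "C n = 2 * (Z * (\<Sum>j\<in>(UNIV::'n set). I + eps n * ((1/2) * I + 2 * (LINT x|lborel. grad_sq j x)))
    + eps n * (\<Sum>j\<in>UNIV. 32 * I + 127 * (LINT x|lborel. grad_sq j x)))" for n
  have iG: "integrable lborel (G n)" for n
    unfolding G_def by (intro Bochner_Integration.integrable_sum) (auto simp: S_def intro: potential_pairing_pair(1)[OF eps_pos])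
  have GC: "(LINT x|lborel. G n x) \<le> C n" for n
  proof -
    have "(LINT x|lborel. G n x) = (\<Sum>(k, l)\<in>S. LINT x|lborel. virial_num (eps n) (pair k l) x * (1 / norm (x $ k - x $ l)) ^ 3 * (f x)\<^sup>2)"
      unfolding G_def using potential_pairing_pair(1)[OF eps_pos]
      by (subst Bochner_Integration.integral_sum) (auto simp: S_def case_prod_unfold intro!: sum.cong)
    also have "\<dots> \<le> (\<Sum>(k, l)\<in>S. potential_pairing (eps n) (pair k l))"
      by (intro sum_mono) (auto simp: S_def intro: potential_pairing_pair(2)[OF eps_pos])
    also have "\<dots> \<le> 2 * (Z * (\<Sum>j\<in>UNIV. potential_pairing (eps n) (single j))
        + eps n * (\<Sum>j\<in>UNIV. 32 * I + 127 * (LINT x|lborel. grad_sq j x)))"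
      using virial_inequality[OF eps_pos Z eq, of n] unfolding S_def I_def by simp
    also have "\<dots> \<le> C n"
      unfolding C_def I_def using Z
      by (intro mult_left_mono add_right_mono sum_mono potential_pairing_single[OF eps_pos]) auto
    finally show ?thesis .
  qed
  have Clim: "C \<longlonglongrightarrow> 2 * (Z * (real CARD('n) * I))"
  proof -
    have "C \<longlonglongrightarrow> 2 * (Z * (\<Sum>j\<in>(UNIV::'n set). I + 0 * ((1/2) * I + 2 * (LINT x|lborel. grad_sq j x)))
      + 0 * (\<Sum>j\<in>UNIV. 32 * I + 127 * (LINT x|lborel. grad_sq j x)))"
      unfolding C_def[abs_def] by (intro tendsto_intros eps_tendsto)
    then show ?thesis by simp
  qed
  have GH: "AE x in lborel. (\<lambda>n. G n x) \<longlonglongrightarrow> H x"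
  proof -
    have "AE x in lborel. rel (single j) x $ 1 \<noteq> 0" for j :: 'n
      by (rule AE_rel_neq_0[of "single j" j]) (simp add: single_def)
    then have "AE x in lborel. \<forall>j::'n. rel (single j) x $ 1 \<noteq> 0" by (rule eventually_all_finite)
    then show ?thesis
    proof eventually_elim
      case (elim x)
      then have "x $ j \<noteq> 0" for j by (metis rel_single zero_index)
      then show ?case unfolding G_def H_def virial_num_pair case_prod_unfold
        by (intro tendsto_intros Xcoef_tendsto) auto
    qed
  qed
  have Hm: "H \<in> borel_measurable lborel"
  proof -
    have [measurable]: "(\<lambda>x. x $ j) \<in> borel_measurable (borel :: ((real^3)^'n) measure)" for j
      by (intro borel_measurable_continuous_onI continuous_intros)
    show ?thesis unfolding H_def case_prod_unfold by measurable
  qed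
  have Gnn: "AE x in lborel. 0 \<le> G n x" for n
    unfolding G_def by (intro AE_I2 sum_nonneg) (auto intro!: mult_nonneg_nonneg virial_num_pair_nonneg eps_pos)
  note F = Fatou_real[OF iG Gnn GH Hm GC Clim]
  \<comment> \<open>The excess over the pair bound \<open>1/2\<close>. Its integral is at most
    \<open>(1/2) N (4 Z + 1 - N) \<parallel>f\<parallel>\<^sup>2\<close>, so for
    \<open>N = 4 Z + 1\<close> the conclusion rests on the strictness of that bound.\<close>
  define D where "D x = H x - (1/2) * real (card S) * (f x)\<^sup>2" for x
  have iD: "integrable lborel D"
    unfolding D_def by (intro Bochner_Integration.integrable_diff integrable_mult_right F(1) sq_int_integrable f_sq_int)
  have cardS: "real (card S) = real CARD('n) * (real CARD('n) - 1)"
  proof -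
    have "S = UNIV \<times> UNIV - (\<lambda>k. (k, k)) ` UNIV" by (auto simp: S_def)
    then have "card S = CARD('n) * CARD('n) - CARD('n)"
      by (simp add: card_Diff_subset card_image inj_on_def card_cartesian_product)
    moreover have "CARD('n) \<le> CARD('n) * CARD('n)" by simp
    ultimately show ?thesis by (simp add: of_nat_diff algebra_simps)
  qed
  have "(LINT x|lborel. D x) = (LINT x|lborel. H x) - (1/2) * real (card S) * I"
    unfolding D_def I_def using F(1) sq_int_integrable[OF f_sq_int] by simp
  also have "\<dots> \<le> 2 * (Z * (real CARD('n) * I)) - (1/2) * real (card S) * I" using F(2) by simp
  also have "\<dots> = (1/2) * (real CARD('n) * I) * (4 * Z + 1 - real CARD('n))" unfolding cardS by (simp add: field_simps)
  also have "\<dots> \<le> 0"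
  proof (rule mult_nonneg_nonpos)
    show "0 \<le> (1/2) * (real CARD('n) * I)" by (simp add: I_def)
  qed (use N in simp)
  finally have D0: "(LINT x|lborel. D x) \<le> 0" .
  \<comment> \<open>Because \<open>Z > 0\<close> there is at least one pair, so the strict pair
    bounds add up to a strict one.\<close>
  have "CARD('n) > 1" using N Z by (simp add: of_nat_less_iff[of 1, symmetric, where 'a=real] del: of_nat_less_iff)
  then obtain k0 l0 :: 'n where "k0 \<noteq> l0" by (metis card_1_singleton_iff is_singletonI' is_singleton_altdef UNIV_not_empty nat_neq_iff)
  then have Sne: "S \<noteq> {}" by (auto simp: S_def)
  \<comment> \<open>Besides collisions, the antipodal configurations, where the pair bound is
    attained, must be discarded.\<close>
  have gen: "AE x in lborel. \<forall>k l. k \<noteq> l \<longrightarrow> x $ k \<noteq> x $ l \<and> x $ k + x $ (l::'n) \<noteq> (0::real^3)"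
  proof -
    have "AE x in lborel. k \<noteq> l \<longrightarrow> x $ k \<noteq> x $ l \<and> x $ k + x $ l \<noteq> (0::real^3)" for k l :: 'n
    proof (cases "k = l")
      case False
      define c where "c m = single k m + single l m" for m
      have rc: "rel c x = x $ k + x $ l" for x
      proof -
        have "rel c x = rel (single k) x + rel (single l) x"
          by (simp add: rel_def c_def scaleR_left_distrib sum.distrib)
        then show ?thesis by (simp add: rel_single)
      qed
      have "AE x in lborel. rel c x $ 1 \<noteq> 0" "AE x in lborel. rel (pair k l) x $ 1 \<noteq> 0"
        using False by (auto intro!: AE_rel_neq_0[of _ k] simp: c_def pair_def single_def)
      then show ?thesis by eventually_elim (metis rc rel_pair right_minus_eq zero_index)
    qed simp
    then show ?thesis by (intro eventually_all_finite)
  qed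
  have Dpos: "AE x in lborel. 0 \<le> D x \<and> (D x = 0 \<longrightarrow> f x = 0)"
    using gen
  proof eventually_elim
    case (elim x)
    define t where "t a = (case a of (k, l) \<Rightarrow> ((norm (x $ k) *\<^sub>R x $ k - norm (x $ l) *\<^sub>R x $ l) \<bullet> (x $ k - x $ l))
      * (1 / norm (x $ k - x $ l)) ^ 3)" for a :: "'n \<times> 'n"
    have t: "t a > 1/2" if "a \<in> S" for a
    proof -
      obtain k l where a: "a = (k, l)" by (cases a)
      then have "k \<noteq> l" using that by (simp add: S_def)
      then have ne: "x $ k \<noteq> x $ l" "x $ k + x $ l \<noteq> 0" using elim by blast+
      then have "norm (x $ k - x $ l) ^ 3 > 0" by simp
      with virial_pair_gt_half[OF ne] show ?thesis by (simp add: t_def a field_simps)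
    qed
    have "(\<Sum>a\<in>S. 1/2) < (\<Sum>a\<in>S. t a)" using Sne t by (intro sum_strict_mono) auto
    then have pos: "(\<Sum>a\<in>S. t a) - (1/2) * real (card S) > 0" by simp
    have "D x = ((\<Sum>a\<in>S. t a) - (1/2) * real (card S)) * (f x)\<^sup>2"
      by (simp add: D_def H_def t_def sum_distrib_right left_diff_distrib case_prod_unfold)
    then show ?case using pos by simp
  qed
  then have nnD: "AE x in lborel. 0 \<le> D x" by eventually_elim simp
  have "(LINT x|lborel. D x) = 0" using D0 integral_nonneg_AE[OF nnD] by linarith
  then have "AE x in lborel. D x = 0" using integral_nonneg_eq_0_iff_AE[OF iD nnD] by simp
  with Dpos show ?thesis by eventually_elim simp
qed

end

theorem theorem3:
  fixes Z :: real
  assumes "Z > 0" and "real CARD('n::finite) \<ge> 4 * Z + 1"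
  shows "\<not> (\<exists>E::real. is_eigenvalue H2
    (hamiltonian Z :: ((real^3)^'n \<Rightarrow> complex) \<Rightarrow> (real^3)^'n \<Rightarrow> complex) (complex_of_real E))"
proof
  assume "\<exists>E::real. is_eigenvalue H2
    (hamiltonian Z :: ((real^3)^'n \<Rightarrow> complex) \<Rightarrow> (real^3)^'n \<Rightarrow> complex) (complex_of_real E)"
  then obtain E where E: "is_eigenvalue H2
    (hamiltonian Z :: ((real^3)^'n \<Rightarrow> complex) \<Rightarrow> (real^3)^'n \<Rightarrow> complex) (complex_of_real E)" by blast
  obtain f :: "(real^3)^'n \<Rightarrow> real" and p q where f:
    "\<not> (AE x in lborel. f x = 0)"
    "\<And>b. b \<in> Basis \<Longrightarrow> weak_deriv b f (p b)"
    "\<And>b c. b \<in> Basis \<Longrightarrow> c \<in> Basis \<Longrightarrow> weak_deriv c (p b) (q b c)"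
    "\<And>b c. q b c = q c b"
    "AE x in lborel. coulomb Z x * f x = E * f x + (\<Sum>b\<in>Basis. q b b x)"
    using real_eigenfunction[OF E] by blast
  interpret sobolev2 f p q by unfold_locales (use f in auto)
  show False using no_eigenfunction[OF assms f(5)] f(1) by blast
qed

end
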